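(* Let $n\ge1$. Then $\mathcal{N}_{\mathfrak{X},\mathfrak{k}}=\mathcal{N}_{\mathfrak{k}}$, while $\mathcal{N}_{\mathfrak{X},\mathfrak{s}}$ is not irreducible. Specifically, if $n=1$, then $\mathcal{N}_{\mathfrak{X},\mathfrak{s}}=\mathcal{N}_{\mathfrak{s}}$ (which has two irreducible components). If $n\ge2$, then $\mathcal{N}_{\mathfrak{X},\mathfrak{s}}$ has exactly three irreducible components, described as follows. (a) Assume that $n$ is even. The components of $\mathcal{N}_{\mathfrak{X},\mathfrak{s}}$ are the closures of the $K$-orbits $\mathfrak{O}_{\Lambda_+},\mathfrak{O}_{\Lambda_0},\mathfrak{O}_{\Lambda_-}$, where $\Lambda_+,\Lambda_0,\Lambda_-$ each have two rows, both of length $n$: in $\Lambda_+$ both rows start with $+$; in $\Lambda_0$ one row starts with $+$ and the other with $-$; in $\Lambda_-$ both rows start with $-$. In this case $\mathcal{N}_{\mathfrak{X},\mathfrak{s}}$ is equidimensional of dimension $2(n^2-n)$. (b) Assume that $n$ is odd. The components of $\mathcal{N}_{\mathfrak{X},\mathfrak{s}}$ are the closures of the $K$-orbits $\mathfrak{O}_{\Lambda_+},\mathfrak{O}_{\Lambda_0},\mathfrak{O}_{\Lambda_-}$, where $\Lambda_+$ has two rows of lengths $n+1$ and $n-1$, both starting with $+$; $\Lambda_0$ has two rows of length $n$, one starting with $+$ and the other with $-$; $\Lambda_-$ has two rows of lengths $n+1$ and $n-1$, both starting with $-$. The variety $\mathcal{N}_{\mathfrak{X},\mathfrak{s}}$ is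 not equidimensional: it has two components of dimension $2(n^2-n)+1$ and one component of dimension $2(n^2-n)$.
   Context: Work over $\mathbb{C}$. $G=\mathrm{GL}_{2n}$, $\mathfrak{g}=\mathfrak{gl}_{2n}$, $V^+=\mathbb{C}^n\times\{0\}^n$, $V^-=\{0\}^n\times\mathbb{C}^n$, $K=\{g\in G: g(V^\pm)=V^\pm\}\cong\mathrm{GL}_n\times\mathrm{GL}_n$, $\mathfrak{k}=\mathrm{Lie}(K)$ (block diagonal matrices), $\mathfrak{s}$ the space of block off-diagonal matrices. For $x=\begin{pmatrix}x_1&x_2\\ x_3&x_4\end{pmatrix}$ put $x^\theta=\begin{pmatrix}x_1&0\\0&x_4\end{pmatrix}$, $x^{-\theta}=\begin{pmatrix}0&x_2\\ x_3&0\end{pmatrix}$. $\mathcal{N}_{\mathfrak{k}},\mathcal{N}_{\mathfrak{s}}$ are the closed sets of nilpotent matrices in $\mathfrak{k},\mathfrak{s}$; $K$ acts by conjugation. $B_K\subset K$ is a Borel subgroup and $P_{\mathrm S}\subset G$ is the stabilizer of $V^+$. $\mathfrak{X}=K/B_K\times G/P_{\mathrm S}$ is identified with the set of pairs $(\mathfrak{b}',\mathfrak{p}')$ of a Borel subalgebra $\mathfrak{b}'\subset\mathfrak{k}$ and a parabolic subalgebra $\mathfrak{p}'\subset\mathfrak{g}$ conjugate to $\mathrm{Lie}(P_{\mathrm S})$ (the stabilizer of an $n$-dimensional subspace of $\mathbb{C}^{2n}$). With $\mathfrak{nil}$ denoting the nilradical, the conormal variety is $\mathcal{Y}=\{(\mathfrak{b}',\mathfrak{p}',x)\in\mathfrak{X}\times\mathfrak{g}: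 x\in\mathfrak{nil}(\mathfrak{p}'),\ x^\theta\in\mathfrak{nil}(\mathfrak{b}')\}$, with maps $\pi_{\mathfrak{k}}(\mathfrak{b}',\mathfrak{p}',x)=x^\theta\in\mathcal{N}_{\mathfrak{k}}$ and $\pi_{\mathfrak{s}}(\mathfrak{b}',\mathfrak{p}',x)=x^{-\theta}\in\mathcal{N}_{\mathfrak{s}}$. Define $\mathcal{N}_{\mathfrak{X},\mathfrak{k}}:=\overline{\pi_{\mathfrak{k}}(\mathcal{Y})}$ and $\mathcal{N}_{\mathfrak{X},\mathfrak{s}}:=\overline{\pi_{\mathfrak{s}}(\mathcal{Y})}$. A signed Young diagram (of signature $(n,n)$) is a Young diagram with $2n$ boxes filled with $n$ symbols $+$ and $n$ symbols $-$ so that signs alternate along each row, considered up to permutation of rows (so it is determined by the lengths and starting signs of its rows). For such $\Lambda$, $\mathfrak{O}_\Lambda$ is the set of nilpotent $x\in\mathfrak{s}$ having a basis $(\varepsilon_c)_{c\in\Lambda}$ of $\mathbb{C}^{2n}$ indexed by the boxes of $\Lambda$ with $\varepsilon_c\in V^{\pm}$ if $c$ contains the sign $\pm$, $x(\varepsilon_c)=0$ if $c$ is in the first column, and $x(\varepsilon_c)=\varepsilon_{c'}$ with $c'$ the box immediately to the left of $c$ otherwise. The sets $\mathfrak{O}_\Lambda$ are exactly the $K$-orbits of $\mathcal{N}_{\mathfrak{s}}$. *)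

theory Defs
  imports "HOL-Analysis.Analysis" "HOL-Library.Multiset"
begin

section \<open>Irreducible components and Krull dimension in a topological space\<close>

definition irreducible_in :: "'a topology \<Rightarrow> 'a set \<Rightarrow> bool" where
  "irreducible_in T S \<longleftrightarrow> S \<noteq> {} \<and> S \<subseteq> topspace T \<and>
     (\<forall>A B. closedin T A \<and> closedin T B \<and> S \<subseteq> A \<union> B \<longrightarrow> S \<subseteq> A \<or> S \<subseteq> B)"

definition irreducible_components :: "'a topology \<Rightarrow> 'a set \<Rightarrow> 'a set set" where
  "irreducible_components T S =
     {Z. irreducible_in T Z \<and> Z \<subseteq> S \<and>
         (\<forall>Z'. irreducible_in T Z' \<and> Z \<subseteq> Z' \<and> Z' \<subseteq> S \<longrightarrow> Z' = Z)}"

definition krull_dim :: "'a topology \<Rightarrow> 'a set \<Rightarrow> enat" where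
  "krull_dim T S =
     Sup {enat m | m. \<exists>Z :: nat \<Rightarrow> 'a set.
            (\<forall>i\<le>m. irreducible_in T (Z i) \<and> closedin (subtopology T S) (Z i)) \<and>
            (\<forall>i<m. Z i \<subset> Z (Suc i))}"

definition equidimensional :: "'a topology \<Rightarrow> 'a set \<Rightarrow> bool" where
  "equidimensional T S \<longleftrightarrow>
     (\<forall>C\<in>irreducible_components T S. \<forall>D\<in>irreducible_components T S.
        krull_dim T C = krull_dim T D)"


section \<open>The Zariski topology on a space of complex matrices\<close>

inductive_set poly_funs :: "(complex^'a^'b \<Rightarrow> complex) set" where
  const: "(\<lambda>_. c) \<in> poly_funs"
| coord: "(\<lambda>x. x $ i $ j) \<in> poly_funs"
| add: "f \<in> poly_funs \<Longrightarrow> g \<in> poly_funs \<Longrightarrow> (\<lambda>x. f x + g x) \<in> poly_funs"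
| mult: "f \<in> poly_funs \<Longrightarrow> g \<in> poly_funs \<Longrightarrow> (\<lambda>x. f x * g x) \<in> poly_funs"

definition zariski_open :: "(complex^'a^'b) set \<Rightarrow> bool" where
  "zariski_open U \<longleftrightarrow> (\<exists>F\<subseteq>poly_funs. U = {x. \<exists>f\<in>F. f x \<noteq> 0})"

definition zariski :: "(complex^'a^'b) topology" where
  "zariski = topology zariski_open"

lemma istopology_zariski_open: "istopology zariski_open"
  unfolding istopology_def
proof (intro conjI allI impI)
  fix S T :: "(complex^'a^'b) set"
  assume "zariski_open S" "zariski_open T"
  then obtain F G where F: "F \<subseteq> poly_funs" "S = {x. \<exists>f\<in>F. f x \<noteq> 0}"
    and G: "G \<subseteq> poly_funs" "T = {x. \<exists>g\<in>G. g x \<noteq> 0}"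
    unfolding zariski_open_def by auto
  define H where "H = (\<lambda>(f, g) x. f x * g x) ` (F \<times> G)"
  have "H \<subseteq> poly_funs"
    using F(1) G(1) by (auto simp: H_def intro!: poly_funs.mult)
  moreover have "S \<inter> T = {x. \<exists>h\<in>H. h x \<noteq> 0}"
    by (auto simp: F(2) G(2) H_def)
  ultimately show "zariski_open (S \<inter> T)" unfolding zariski_open_def by (intro exI[of _ H]) simp
next
  fix \<K> :: "(complex^'a^'b) set set"
  assume "\<forall>K\<in>\<K>. zariski_open K"
  then have "\<forall>K\<in>\<K>. \<exists>F\<subseteq>poly_funs. K = {x. \<exists>f\<in>F. f x \<noteq> 0}"
    unfolding zariski_open_def .
  then obtain F where F: "\<forall>K\<in>\<K>. F K \<subseteq> poly_funs \<and> K = {x. \<exists>f\<in>F K. f x \<noteq> 0}"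
    by (rule bchoice[THEN exE])
  have sub: "(\<Union>K\<in>\<K>. F K) \<subseteq> poly_funs"
    using F by (intro UN_least) simp
  have mem: "x \<in> K \<longleftrightarrow> (\<exists>f\<in>F K. f x \<noteq> 0)" if "K \<in> \<K>" for K x
  proof -
    have "K = {x. \<exists>f\<in>F K. f x \<noteq> 0}" by (rule conjunct2[OF bspec[OF F that]])
    then have "x \<in> K \<longleftrightarrow> x \<in> {x. \<exists>f\<in>F K. f x \<noteq> 0}" by (rule arg_cong)
    then show ?thesis by (simp only: mem_Collect_eq)
  qed
  have "\<Union>\<K> = {x. \<exists>f\<in>(\<Union>K\<in>\<K>. F K). f x \<noteq> 0}"
    by (rule set_eqI) (simp add: mem)
  with sub show "zariski_open (\<Union>\<K>)"
    unfolding zariski_open_def by (intro exI[of _ "\<Union>K\<in>\<K>. F K"]) (rule conjI)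
qed

lemma openin_zariski: "openin zariski = zariski_open"
  unfolding zariski_def by (rule topology_inverse'[OF istopology_zariski_open])

lemma topspace_zariski: "topspace zariski = UNIV"
proof -
  have "zariski_open UNIV"
    unfolding zariski_open_def
    by (rule exI[of _ "{\<lambda>_. 1}"]) (auto intro: poly_funs.const)
  then show ?thesis
    using openin_subset[of zariski UNIV] by (auto simp: openin_zariski)
qed

lemma closedin_zariski:
  fixes A :: "(complex^'a^'b) set"
  shows "closedin zariski A \<longleftrightarrow> (\<exists>F\<subseteq>poly_funs. A = {x. \<forall>f\<in>F. f x = 0})"
proof -
  have "- A = {x. \<exists>f\<in>F. f x \<noteq> 0} \<longleftrightarrow> A = {x. \<forall>f\<in>F. f x = 0}"
    for F :: "(complex^'a^'b \<Rightarrow> complex) set"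
    by (simp add: set_eq_iff) metis
  then have "zariski_open (- A) \<longleftrightarrow> (\<exists>F\<subseteq>poly_funs. A = {x. \<forall>f\<in>F. f x = 0})"
    unfolding zariski_open_def by (simp only:)
  then show ?thesis
    by (simp add: closedin_def topspace_zariski openin_zariski Compl_eq_Diff_UNIV)
qed


section \<open>Lie algebras of matrices\<close>

text \<open>Products of matrices are \<open>**\<close>; the type class product on \<open>complex^'m^'m\<close> is entrywise.\<close>

definition nilpotent_matrix :: "complex^'m^'m \<Rightarrow> bool" where
  "nilpotent_matrix x \<longleftrightarrow> (\<exists>k. (((**) x) ^^ k) (mat 1) = 0)"

definition csubspace :: "(complex^'m^'m) set \<Rightarrow> bool" where
  "csubspace A \<longleftrightarrow> 0 \<in> A \<and> (\<forall>x\<in>A. \<forall>y\<in>A. x + y \<in> A) \<and>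
     (\<forall>c. \<forall>x\<in>A. (\<chi> i j. c * x $ i $ j) \<in> A)"

definition bracket :: "complex^'m^'m \<Rightarrow> complex^'m^'m \<Rightarrow> complex^'m^'m" where
  "bracket x y = x ** y - y ** x"

definition lie_subalgebra :: "(complex^'m^'m) set \<Rightarrow> bool" where
  "lie_subalgebra A \<longleftrightarrow> csubspace A \<and> (\<forall>x\<in>A. \<forall>y\<in>A. bracket x y \<in> A)"

definition lie_ideal :: "(complex^'m^'m) set \<Rightarrow> (complex^'m^'m) set \<Rightarrow> bool" where
  "lie_ideal I A \<longleftrightarrow> csubspace I \<and> I \<subseteq> A \<and> (\<forall>x\<in>A. \<forall>y\<in>I. bracket x y \<in> I)"

definition derived_algebra :: "(complex^'m^'m) set \<Rightarrow> (complex^'m^'m) set" where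
  "derived_algebra A = csubspace hull {bracket x y | x y. x \<in> A \<and> y \<in> A}"

definition solvable_lie :: "(complex^'m^'m) set \<Rightarrow> bool" where
  "solvable_lie A \<longleftrightarrow> (\<exists>k. (derived_algebra ^^ k) A = {0})"

definition borel_subalgebra :: "(complex^'m^'m) set \<Rightarrow> (complex^'m^'m) set \<Rightarrow> bool" where
  "borel_subalgebra b L \<longleftrightarrow> lie_subalgebra b \<and> solvable_lie b \<and> b \<subseteq> L \<and>
     (\<forall>b'. lie_subalgebra b' \<and> solvable_lie b' \<and> b \<subseteq> b' \<and> b' \<subseteq> L \<longrightarrow> b' = b)"

text \<open>
  The nilradical of a parabolic subalgebra means the Lie algebra of the unipotent radical of the
  corresponding group, i.e. the largest ideal consisting of nilpotent matrices. (The largest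
  ideal that is nilpotent as an abstract Lie algebra would also contain the scalar matrices.)
  A sum of two ideals consisting of nilpotent matrices again consists of nilpotent matrices, so
  the largest such ideal is the union of all of them.
\<close>
definition nilrad :: "(complex^'m^'m) set \<Rightarrow> (complex^'m^'m) set" where
  "nilrad A = \<Union>{I. lie_ideal I A \<and> (\<forall>x\<in>I. nilpotent_matrix x)}"


section \<open>The symmetric pair\<close>

text \<open>
  With \<open>n = CARD('n)\<close>, the coordinates of \<open>\<complex>\<^sup>2\<^sup>n\<close> are indexed by \<open>'n + 'n\<close>: the summand
  \<open>Inl\<close> spans \<open>V\<^sup>+\<close> and the summand \<open>Inr\<close> spans \<open>V\<^sup>-\<close>.
\<close>
type_synonym 'n bvec = "complex^('n + 'n)"
type_synonym 'n bmat = "complex^('n + 'n)^('n + 'n)"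

datatype sign = Plus | Minus

fun flip_sign :: "sign \<Rightarrow> sign" where
  "flip_sign Plus = Minus"
| "flip_sign Minus = Plus"

fun V :: "sign \<Rightarrow> ('n::finite) bvec set" where
  "V Plus = {v. \<forall>i. v $ Inr i = 0}"
| "V Minus = {v. \<forall>i. v $ Inl i = 0}"

definition K :: "('n::finite) bmat set" where
  "K = {g. invertible g \<and> (\<forall>s. (*v) g ` V s = V s)}"

definition conj_by :: "'n bmat \<Rightarrow> 'n bmat \<Rightarrow> ('n::finite) bmat" where
  "conj_by g x = g ** x ** matrix_inv g"

definition lie_k :: "('n::finite) bmat set" where
  "lie_k = {x. \<forall>i j. x $ Inl i $ Inr j = 0 \<and> x $ Inr i $ Inl j = 0}"

definition space_s :: "('n::finite) bmat set" where
  "space_s = {x. \<forall>i j. x $ Inl i $ Inl j = 0 \<and> x $ Inr i $ Inr j = 0}"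

definition diag_part :: "('n::finite) bmat \<Rightarrow> 'n bmat" where
  "diag_part x = (\<chi> i j. if isl i = isl j then x $ i $ j else 0)"

definition offdiag_part :: "('n::finite) bmat \<Rightarrow> 'n bmat" where
  "offdiag_part x = (\<chi> i j. if isl i = isl j then 0 else x $ i $ j)"

definition N_k :: "('n::finite) bmat set" where
  "N_k = {x \<in> lie_k. nilpotent_matrix x}"

definition N_s :: "('n::finite) bmat set" where
  "N_s = {x \<in> space_s. nilpotent_matrix x}"

definition K_orbits :: "('n::finite) bmat set \<Rightarrow> 'n bmat set set" where
  "K_orbits A = {{conj_by g x | g. g \<in> K} | x. x \<in> A}"


section \<open>The conormal variety and its images\<close>

definition lie_P_S :: "('n::finite) bmat set" where
  "lie_P_S = {x. \<forall>v\<in>V Plus. x *v v \<in> V Plus}"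

definition double_flag :: "(('n::finite) bmat set \<times> 'n bmat set) set" where
  "double_flag = {(b, p). borel_subalgebra b lie_k \<and>
     (\<exists>g. invertible g \<and> p = conj_by g ` lie_P_S)}"

definition conormal :: "(('n::finite) bmat set \<times> 'n bmat set \<times> 'n bmat) set" where
  "conormal = {(b, p, x). (b, p) \<in> double_flag \<and> x \<in> nilrad p \<and> diag_part x \<in> nilrad b}"

definition pi_k :: "'n bmat set \<times> 'n bmat set \<times> 'n bmat \<Rightarrow> ('n::finite) bmat" where
  "pi_k = (\<lambda>(b, p, x). diag_part x)"

definition pi_s :: "'n bmat set \<times> 'n bmat set \<times> 'n bmat \<Rightarrow> ('n::finite) bmat" where
  "pi_s = (\<lambda>(b, p, x). offdiag_part x)"

definition N_Xk :: "('n::finite) bmat set" where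
  "N_Xk = zariski closure_of (pi_k ` conormal)"

definition N_Xs :: "('n::finite) bmat set" where
  "N_Xs = zariski closure_of (pi_s ` conormal)"


section \<open>Signed Young diagrams\<close>

text \<open>
  A signed Young diagram is the multiset of the pairs (length, starting sign) of its rows.
  To name its boxes we choose an enumeration of the rows; the box \<open>(r, c)\<close> lies in row \<open>r\<close> and
  column \<open>c\<close>, both counted from 0.
\<close>
type_synonym signed_diagram = "(nat \<times> sign) multiset"

definition boxes :: "(nat \<times> sign) list \<Rightarrow> (nat \<times> nat) set" where
  "boxes rs = {(r, c). r < length rs \<and> c < fst (rs ! r)}"

fun box_sign :: "(nat \<times> sign) list \<Rightarrow> nat \<times> nat \<Rightarrow> sign" where
  "box_sign rs (r, c) = (flip_sign ^^ c) (snd (rs ! r))"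

text \<open>
  The definition makes sense for every \<open>\<Lambda>\<close>, but the set is empty unless \<open>\<Lambda>\<close> has \<open>n\<close> boxes of
  each sign.
\<close>
definition signed_orbit :: "signed_diagram \<Rightarrow> ('n::finite) bmat set" where
  "signed_orbit \<Lambda> = {x \<in> N_s. \<exists>rs (e :: nat \<times> nat \<Rightarrow> 'n bvec). mset rs = \<Lambda> \<and>
     inj_on e (boxes rs) \<and> vec.independent (e ` boxes rs) \<and>
     vec.span (e ` boxes rs) = UNIV \<and>
     (\<forall>b\<in>boxes rs. e b \<in> V (box_sign rs b)) \<and>
     (\<forall>r c. (r, c) \<in> boxes rs \<longrightarrow>
        x *v e (r, c) = (if c = 0 then 0 else e (r, c - 1)))}"

end

theory Submission
  imports Defs "HOL-Computational_Algebra.Polynomial" "HOL-Library.Function_Algebras"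
begin

text \<open>
  A point of the conormal variety is a matrix \<open>x\<close> with \<open>x\<^sup>2 = 0\<close> and nilpotent block diagonal part.
  If \<open>W\<close> is an \<open>n\<close>-dimensional space between the image and the kernel of \<open>x\<close>, then a flag of the
  projection of \<open>W\<close> to \<open>V\<^sup>+\<close> adapted to \<open>x\<^sup>\<theta>\<close> is lifted through \<open>W\<close> to a flag in \<open>V\<^sup>-\<close>, and
  \<open>y = x\<^sup>-\<^sup>\<theta>\<close> lowers the resulting pair of flags. Let \<open>p\<close>, \<open>q\<close> be the dimensions of the
  intersections of \<open>W\<close> with \<open>V\<^sup>+\<close>, \<open>V\<^sup>-\<close>. After a small perturbation of \<open>y\<close> one can decrease
  \<open>p\<close> or \<open>q\<close> as long as one of them is at least 2, and for \<open>p, q \<le> 1\<close> a general \<open>y\<close> lowering the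
  flags has a cyclic normal form, which is one of the three orbits. Conversely each of these orbits
  contains a matrix that is completed to \<open>x\<close> with \<open>x\<^sup>2 = 0\<close> by an imaginary multiple of a shift.

  The dimension of an orbit closure is computed from a birational parametrization by an affine
  space: chains of irreducible closed sets give algebraically independent functions, whose number
  is bounded by counting monomials, and the images of a coordinate flag give a longest chain.
\<close>

subsection \<open>The Zariski topology\<close>

text \<open>Whether \<open>y\<close> lies in the image is an existential condition: some nilpotent
  block diagonal matrix has to complete it. The flags replace this by inclusions that mention
  \<open>y\<close> alone, and only these inclusions survive the perturbation; hence the induction
  runs over all \<open>y\<close> lowering a pair of flags and not over the image. The difference p -
  q is a relative shift of the two flags. For p, q \<le> 1 it is 0, 1 or -1, one value for each
  orbit, and p = q = 1 gives the same orbit as p = q = 0. The bound 2 is the codimension in V of a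
  member of the flag: two independent vectors outside it are needed to start the refinement. The
  number 2(n^2 - n) counts the entries of a block diagonal matrix with two rows frozen, one for each
  row of the diagram. For rows of unequal length one coefficient linking the two frozen rows remains
  free, whence the extra 1 for odd n.\<close>

lemma in_zariski_closure:
  "x \<in> zariski closure_of S \<longleftrightarrow> (\<forall>f\<in>poly_funs. (\<forall>s\<in>S. f s = 0) \<longrightarrow> f x = 0)"
proof
  assume x: "x \<in> zariski closure_of S"
  show "\<forall>f\<in>poly_funs. (\<forall>s\<in>S. f s = 0) \<longrightarrow> f x = 0"
  proof (intro ballI impI, rule ccontr)
    fix f assume f: "f \<in> poly_funs" "\<forall>s\<in>S. f s = 0" "f x \<noteq> 0"
    have "openin zariski {y. f y \<noteq> 0}"
      unfolding openin_zariski zariski_open_def by (rule exI[of _ "{f}"]) (use f in auto)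
    moreover have "x \<in> {y. f y \<noteq> 0}" using f(3) by simp
    moreover have "\<forall>T. x \<in> T \<and> openin zariski T \<longrightarrow> (\<exists>y. y \<in> S \<and> y \<in> T)"
      using x unfolding in_closure_of by (rule conjunct2)
    ultimately have "\<exists>y. y \<in> S \<and> y \<in> {y. f y \<noteq> 0}" by (elim allE impE) (rule conjI)
    then show False using f(2) by auto
  qed
next
  assume *: "\<forall>f\<in>poly_funs. (\<forall>s\<in>S. f s = 0) \<longrightarrow> f x = 0"
  show "x \<in> zariski closure_of S" unfolding in_closure_of
  proof (intro conjI allI impI)
    show "x \<in> topspace zariski" by (simp add: topspace_zariski)
    fix T assume T: "x \<in> T \<and> openin zariski T"
    then obtain F where F: "F \<subseteq> poly_funs" "T = {x. \<exists>f\<in>F. f x \<noteq> 0}"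
      unfolding openin_zariski zariski_open_def by auto
    with T obtain f where "f \<in> F" "f x \<noteq> 0" by auto
    with * F show "\<exists>y. y \<in> S \<and> y \<in> T" by blast
  qed
qed

lemma poly_fun_vanish_closure:
  assumes "f \<in> poly_funs" "\<And>s. s \<in> S \<Longrightarrow> f s = 0" "x \<in> zariski closure_of S"
  shows "f x = 0"
  using assms in_zariski_closure by blast

lemma subset_zariski_closure: "S \<subseteq> zariski closure_of S"
  by (simp add: closure_of_subset topspace_zariski)

lemma closedin_zariski_closure: "closedin zariski (zariski closure_of S)"
  by (rule closedin_closure_of)

lemma zariski_closed_separate:
  assumes "closedin zariski A" "x \<notin> A"
  obtains f where "f \<in> poly_funs" "\<And>a. a \<in> A \<Longrightarrow> f a = 0" "f x \<noteq> 0"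
  using assms unfolding closedin_zariski by blast

lemma poly_funs_sum: "(\<And>i. i \<in> I \<Longrightarrow> F i \<in> poly_funs) \<Longrightarrow> (\<lambda>x. \<Sum>i\<in>I. F i x) \<in> poly_funs"
  by (induction I rule: infinite_finite_induct) (auto intro: poly_funs.intros)

lemma poly_funs_prod: "(\<And>i. i \<in> I \<Longrightarrow> F i \<in> poly_funs) \<Longrightarrow> (\<lambda>x. \<Prod>i\<in>I. F i x) \<in> poly_funs"
  by (induction I rule: infinite_finite_induct) (auto intro: poly_funs.intros)

lemma poly_funs_power: "f \<in> poly_funs \<Longrightarrow> (\<lambda>x. f x ^ k) \<in> poly_funs"
  by (induction k) (auto intro: poly_funs.intros)

lemma poly_funs_uminus: "f \<in> poly_funs \<Longrightarrow> (\<lambda>x. - f x) \<in> poly_funs"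
  using poly_funs.mult[OF poly_funs.const[of "-1"]] by simp

lemma poly_funs_diff: "f \<in> poly_funs \<Longrightarrow> g \<in> poly_funs \<Longrightarrow> (\<lambda>x. f x - g x) \<in> poly_funs"
  using poly_funs.add[OF _ poly_funs_uminus] by simp

lemmas poly_funs_intros = poly_funs.intros poly_funs_sum poly_funs_prod poly_funs_power
  poly_funs_uminus poly_funs_diff

lemma poly_funs_compose:
  assumes "f \<in> poly_funs" "\<And>i j. (\<lambda>h. \<phi> h $ i $ j) \<in> poly_funs"
  shows "(\<lambda>h. f (\<phi> h)) \<in> poly_funs"
  using assms(1) by induction (auto intro: poly_funs.intros assms(2))

lemma zariski_closure_map:
  assumes "\<And>i j. (\<lambda>h. \<phi> h $ i $ j) \<in> poly_funs" "\<And>s. s \<in> S \<Longrightarrow> \<phi> s \<in> zariski closure_of T"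
    "x \<in> zariski closure_of S"
  shows "\<phi> x \<in> zariski closure_of T"
  unfolding in_zariski_closure
proof (intro ballI impI)
  fix f assume f: "f \<in> poly_funs" "\<forall>s\<in>T. f s = 0"
  show "f (\<phi> x) = 0"
  proof (rule poly_fun_vanish_closure[OF poly_funs_compose[OF f(1) assms(1)] _ assms(3)])
    fix s assume "s \<in> S"
    then show "f (\<phi> s) = 0" using poly_fun_vanish_closure[OF f(1) _ assms(2)] f(2) by blast
  qed
qed

lemma poly_funs_matrix_mul:
  fixes \<phi> :: "complex^'a^'b \<Rightarrow> complex^'d^'c" and \<psi> :: "complex^'a^'b \<Rightarrow> complex^'e^'d"
  assumes "\<And>i j. (\<lambda>h. \<phi> h $ i $ j) \<in> poly_funs" "\<And>i j. (\<lambda>h. \<psi> h $ i $ j) \<in> poly_funs"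
  shows "(\<lambda>h. (\<phi> h ** \<psi> h) $ i $ j) \<in> poly_funs"
  by (simp add: matrix_matrix_mult_def) (intro poly_funs_intros assms)

lemma poly_funs_det:
  fixes \<phi> :: "complex^'a^'b \<Rightarrow> complex^'c^'c"
  assumes "\<And>i j. (\<lambda>h. \<phi> h $ i $ j) \<in> poly_funs"
  shows "(\<lambda>h. det (\<phi> h)) \<in> poly_funs"
  unfolding det_def by (intro poly_funs_intros assms)

text \<open>Spelled out in coordinates because \<open>complex^'a^'b\<close> carries no complex scaling in the library.\<close>
definition line :: "complex^'a^'b \<Rightarrow> complex^'a^'b \<Rightarrow> complex \<Rightarrow> complex^'a^'b" where
  "line u w c = (\<chi> i j. u $ i $ j + c * w $ i $ j)"

lemma line_nth [simp]: "line u w c $ i $ j = u $ i $ j + c * w $ i $ j"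
  by (simp add: line_def)

lemma line_0 [simp]: "line u w 0 = u" and line_1: "line u (v - u) 1 = v"
  by (simp_all add: vec_eq_iff)

lemma poly_fun_on_line:
  assumes "f \<in> poly_funs"
  shows "\<exists>p. \<forall>c. f (line u w c) = poly p c"
  using assms
proof induction
  case (const a)
  then show ?case by (intro exI[of _ "[:a:]"]) simp
next
  case (coord i j)
  then show ?case by (intro exI[of _ "[:u $ i $ j, w $ i $ j:]"]) simp
next
  case (add f g)
  then obtain p q where "\<forall>c. f (line u w c) = poly p c" "\<forall>c. g (line u w c) = poly q c" by blast
  then show ?case by (intro exI[of _ "p + q"]) simp
next
  case (mult f g)
  then obtain p q where "\<forall>c. f (line u w c) = poly p c" "\<forall>c. g (line u w c) = poly q c" by blast
  then show ?case by (intro exI[of _ "p * q"]) simp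
qed

text \<open>A polynomial in one variable with infinitely many zeros is zero, hence vanishes at 0
  too. This is how statements about general perturbations of \<open>y\<close> return to
  \<open>y\<close>.\<close>

lemma zariski_closure_line:
  assumes "finite F" "\<And>c. c \<notin> F \<Longrightarrow> line y w c \<in> zariski closure_of S"
  shows "y \<in> zariski closure_of S"
  unfolding in_zariski_closure
proof (intro ballI impI)
  fix f assume f: "f \<in> poly_funs" "\<forall>s\<in>S. f s = 0"
  obtain p where p: "\<forall>c. f (line y w c) = poly p c" using poly_fun_on_line[OF f(1)] by blast
  have "poly p c = 0" if "c \<notin> F" for c
    using poly_fun_vanish_closure[OF f(1) _ assms(2)[OF that]] f(2) p by auto
  then have "- F \<subseteq> {c. poly p c = 0}" by auto
  moreover have "infinite (- F)" using assms(1)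
    by (simp add: Compl_eq_Diff_UNIV Diff_infinite_finite infinite_UNIV_char_0)
  ultimately have "p = 0" using poly_roots_finite finite_subset by blast
  then show "f y = 0" using p[rule_format, of 0] by simp
qed

lemma poly_nonzero_ex:
  fixes P :: "complex poly set"
  assumes "finite P" "0 \<notin> P" "finite F"
  shows "\<exists>c. c \<notin> F \<and> (\<forall>p\<in>P. poly p c \<noteq> 0)"
proof -
  have "finite (F \<union> (\<Union>p\<in>P. {c. poly p c = 0}))"
    using assms by (intro finite_UnI finite_UN_I poly_roots_finite) auto
  then obtain c where "c \<notin> F \<union> (\<Union>p\<in>P. {c. poly p c = 0})"
    using ex_new_if_finite[OF infinite_UNIV_char_0] by blast
  then show ?thesis by auto
qed

text \<open>A rational map with one common denominator \<open>q\<close> on an affine subspace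
  \<open>D\<close>. Numerators take the place of quotients because \<open>poly_funs\<close> has no
  division, and \<open>affine\<close> has the form in which it is used: restriction to the line
  through two points.\<close>

locale rational_map =
  fixes D :: "(complex^'a^'b) set" and q :: "complex^'a^'b \<Rightarrow> complex"
    and \<phi> :: "complex^'a^'b \<Rightarrow> complex^'c^'d"
  assumes affine: "\<And>u v c. u \<in> D \<Longrightarrow> v \<in> D \<Longrightarrow> line u (v - u) c \<in> D"
    and denom: "q \<in> poly_funs"
    and frac: "\<And>i j. \<exists>P\<in>poly_funs. \<forall>h\<in>D. q h \<noteq> 0 \<longrightarrow> q h * \<phi> h $ i $ j = P h"
begin

abbreviation dom where "dom \<equiv> {h \<in> D. q h \<noteq> 0}"

text \<open>Clearing denominators in \<open>f (\<phi> h)\<close>. The exponent depends on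
  \<open>f\<close>, since sums and products add the exponents of their parts.\<close>

lemma pullback:
  assumes "f \<in> poly_funs"
  shows "\<exists>e. \<exists>P\<in>poly_funs. \<forall>h\<in>dom. q h ^ e * f (\<phi> h) = P h"
  using assms
proof induction
  case (const c)
  then show ?case by (intro exI[of _ 0] bexI[of _ "\<lambda>_. c"]) (auto intro: poly_funs.intros)
next
  case (coord i j)
  then show ?case using frac[of i j] by (intro exI[of _ 1]) auto
next
  case (add f g)
  then obtain e P e' Q where *: "P \<in> poly_funs" "\<forall>h\<in>dom. q h ^ e * f (\<phi> h) = P h"
    "Q \<in> poly_funs" "\<forall>h\<in>dom. q h ^ e' * g (\<phi> h) = Q h" by blast
  have "q h ^ (e + e') * (f (\<phi> h) + g (\<phi> h)) = q h ^ e' * P h + q h ^ e * Q h" if "h \<in> dom" for h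
    using *(2,4)[rule_format, OF that] by (auto simp: power_add algebra_simps)
  then show ?case
    by (intro exI[of _ "e + e'"] bexI[of _ "\<lambda>h. q h ^ e' * P h + q h ^ e * Q h"] ballI)
      (auto intro!: poly_funs_intros * denom)
next
  case (mult f g)
  then obtain e P e' Q where *: "P \<in> poly_funs" "\<forall>h\<in>dom. q h ^ e * f (\<phi> h) = P h"
    "Q \<in> poly_funs" "\<forall>h\<in>dom. q h ^ e' * g (\<phi> h) = Q h" by blast
  have "q h ^ (e + e') * (f (\<phi> h) * g (\<phi> h)) = P h * Q h" if "h \<in> dom" for h
    using *(2,4)[rule_format, OF that, symmetric] by (auto simp: power_add algebra_simps)
  then show ?case
    by (intro exI[of _ "e + e'"] bexI[of _ "\<lambda>h. P h * Q h"] ballI)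
      (auto intro!: poly_funs_intros *)
qed

text \<open>If neither closed set contains the image, functions \<open>f\<close> and
  \<open>g\<close> detect this at two points \<open>u\<close> and \<open>v\<close>. On the line
  through them the two numerators and the denominator are nonzero polynomials in one variable, and a
  common non-root gives an image point outside both sets.\<close>

lemma irreducible_image:
  assumes "dom \<noteq> {}"
  shows "irreducible_in zariski (\<phi> ` dom)"
  unfolding irreducible_in_def
proof (intro conjI allI impI)
  show "\<phi> ` dom \<noteq> {}" using assms by simp
  show "\<phi> ` dom \<subseteq> topspace zariski" by (simp add: topspace_zariski)
  fix A B assume AB: "closedin zariski A \<and> closedin zariski B \<and> \<phi> ` dom \<subseteq> A \<union> B"
  show "\<phi> ` dom \<subseteq> A \<or> \<phi> ` dom \<subseteq> B"
  proof (rule ccontr)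
    assume "\<not> ?thesis"
    then obtain u v where u: "u \<in> dom" "\<phi> u \<notin> A" and v: "v \<in> dom" "\<phi> v \<notin> B" by blast
    obtain f where f: "f \<in> poly_funs" "\<And>a. a \<in> A \<Longrightarrow> f a = 0" "f (\<phi> u) \<noteq> 0"
      using zariski_closed_separate[OF _ u(2)] AB by blast
    obtain g where g: "g \<in> poly_funs" "\<And>a. a \<in> B \<Longrightarrow> g a = 0" "g (\<phi> v) \<noteq> 0"
      using zariski_closed_separate[OF _ v(2)] AB by blast
    obtain e P where P: "P \<in> poly_funs" "\<forall>h\<in>dom. q h ^ e * f (\<phi> h) = P h" using pullback[OF f(1)]
      by blast
    obtain e' Q where Q: "Q \<in> poly_funs" "\<forall>h\<in>dom. q h ^ e' * g (\<phi> h) = Q h" using pullback[OF g(1)]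
      by blast
    obtain pP where pP: "\<forall>c. P (line u (v - u) c) = poly pP c" using poly_fun_on_line[OF P(1)] by blast
    obtain pQ where pQ: "\<forall>c. Q (line u (v - u) c) = poly pQ c" using poly_fun_on_line[OF Q(1)] by blast
    obtain pq where pq: "\<forall>c. q (line u (v - u) c) = poly pq c" using poly_fun_on_line[OF denom] by blast
    note pol = pP pQ pq
    \<comment> \<open>The parameters 0 and 1 are the points \<open>u\<close> and
      \<open>v\<close>.\<close>
    have "poly pP 0 \<noteq> 0" "poly pQ 1 \<noteq> 0" "poly pq 0 \<noteq> 0"
      using pol[THEN spec[of _ 0]] pol[THEN spec[of _ 1]] P(2)[rule_format, OF u(1), symmetric]
        Q(2)[rule_format, OF v(1), symmetric] u v f g by (auto simp: line_1)
    then have "0 \<notin> {pP, pQ, pq}" by auto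
    from poly_nonzero_ex[OF _ this, of "{}"] obtain c
      where c: "poly pP c \<noteq> 0" "poly pQ c \<noteq> 0" "poly pq c \<noteq> 0" by auto
    define h where "h = line u (v - u) c"
    have h: "h \<in> dom" using c pol affine[of u v c] u v by (auto simp: h_def)
    then have "f (\<phi> h) \<noteq> 0" "g (\<phi> h) \<noteq> 0"
      using P(2)[rule_format, OF h] Q(2)[rule_format, OF h] c pol by (auto simp: h_def)
    then show False using f(2) g(2) AB h by blast
  qed
qed

end

section \<open>Irreducible sets and the components of a finite union of closed sets\<close>

lemma irreducible_closure:
  assumes "irreducible_in T S"
  shows "irreducible_in T (T closure_of S)"
  unfolding irreducible_in_def
proof (intro conjI allI impI)
  show "T closure_of S \<noteq> {}" using assms closure_of_subset unfolding irreducible_in_def by blast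
  show "T closure_of S \<subseteq> topspace T" by (rule closure_of_subset_topspace)
  fix A B assume AB: "closedin T A \<and> closedin T B \<and> T closure_of S \<subseteq> A \<union> B"
  then have "S \<subseteq> A \<union> B" using assms closure_of_subset unfolding irreducible_in_def by blast
  then have "S \<subseteq> A \<or> S \<subseteq> B" using assms AB unfolding irreducible_in_def by blast
  then show "T closure_of S \<subseteq> A \<or> T closure_of S \<subseteq> B" using AB closure_of_minimal by metis
qed

lemma irreducible_subset_Union:
  assumes "irreducible_in T Z" "finite \<C>" "\<And>C. C \<in> \<C> \<Longrightarrow> closedin T C" "Z \<subseteq> \<Union>\<C>"
  shows "\<exists>C\<in>\<C>. Z \<subseteq> C"
  using assms(2,3,4)
proof (induction \<C>)
  case empty
  then show ?case using assms(1) unfolding irreducible_in_def by auto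
next
  case (insert C \<C>)
  have "closedin T (\<Union>\<C>)" using insert by (intro closedin_Union) auto
  moreover have "closedin T C" "Z \<subseteq> C \<union> \<Union>\<C>" using insert by auto
  ultimately have "Z \<subseteq> C \<or> Z \<subseteq> \<Union>\<C>" using assms(1) unfolding irreducible_in_def by blast
  then show ?case using insert by auto
qed

text \<open>An irreducible subset of the union lies in a single member, so the members are the
  maximal irreducible subsets as soon as none contains another.\<close>

lemma irreducible_components_Union:
  assumes "finite \<C>" "\<And>C. C \<in> \<C> \<Longrightarrow> closedin T C" "\<And>C. C \<in> \<C> \<Longrightarrow> irreducible_in T C"
    and anti: "\<And>C C'. C \<in> \<C> \<Longrightarrow> C' \<in> \<C> \<Longrightarrow> C \<subseteq> C' \<Longrightarrow> C = C'"
  shows "irreducible_components T (\<Union>\<C>) = \<C>"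
proof (intro equalityI subsetI)
  fix Z assume Z: "Z \<in> irreducible_components T (\<Union>\<C>)"
  then have irr: "irreducible_in T Z" and sub: "Z \<subseteq> \<Union>\<C>"
    and max: "\<And>Z'. irreducible_in T Z' \<Longrightarrow> Z \<subseteq> Z' \<Longrightarrow> Z' \<subseteq> \<Union>\<C> \<Longrightarrow> Z' = Z"
    unfolding irreducible_components_def by simp_all
  obtain C where C: "C \<in> \<C>" "Z \<subseteq> C"
    using irreducible_subset_Union[OF irr assms(1,2) sub] by auto
  then have "C = Z" by (intro max assms(3)) auto
  then show "Z \<in> \<C>" using C by simp
next
  fix C assume C: "C \<in> \<C>"
  have "Z = C" if Z: "irreducible_in T Z" "C \<subseteq> Z" "Z \<subseteq> \<Union>\<C>" for Z
  proof -
    obtain C' where "C' \<in> \<C>" "Z \<subseteq> C'" using irreducible_subset_Union[OF Z(1) assms(1,2) Z(3)] by auto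
    then show ?thesis using anti[OF C] Z by blast
  qed
  then show "C \<in> irreducible_components T (\<Union>\<C>)"
    unfolding irreducible_components_def using C assms(3) by auto
qed

lemma irreducible_components_irreducible:
  assumes "irreducible_in T S"
  shows "irreducible_components T S = {S}"
  using assms unfolding irreducible_components_def by auto

text \<open>\<open>S\<close> is covered by the zero set of \<open>f\<close> and the closure of the
  rest, and it is not contained in the zero set. Used to discard the points of an orbit where its
  parametrization degenerates.\<close>

lemma irreducible_dense_open:
  assumes "irreducible_in zariski S" "f \<in> poly_funs" "s \<in> S" "f s \<noteq> 0"
  shows "S \<subseteq> zariski closure_of {x \<in> S. f x \<noteq> 0}"
proof -
  have "closedin zariski {x. f x = 0}"
    unfolding closedin_zariski by (rule exI[of _ "{f}"]) (use assms in auto)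
  moreover have "S \<subseteq> zariski closure_of {x \<in> S. f x \<noteq> 0} \<union> {x. f x = 0}"
    using subset_zariski_closure[of "{x \<in> S. f x \<noteq> 0}"] by auto
  ultimately show ?thesis
    using assms closedin_zariski_closure unfolding irreducible_in_def by blast
qed

subsection \<open>Krull dimension\<close>

lemma krull_dim_le:
  assumes closed: "closedin T S"
    and bound: "\<And>Z m. (\<And>i. i \<le> m \<Longrightarrow> irreducible_in T (Z i) \<and> closedin T (Z i) \<and> Z i \<subseteq> S) \<Longrightarrow>
      (\<And>i. i < m \<Longrightarrow> Z i \<subset> Z (Suc i)) \<Longrightarrow> m \<le> d"
  shows "krull_dim T S \<le> enat d"
  unfolding krull_dim_def
proof (rule Sup_least, clarify)
  fix m Z assume Z: "\<forall>i\<le>m. irreducible_in T (Z i) \<and>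
    closedin (subtopology T S) (Z i)" "\<forall>i<m. Z i \<subset> Z (Suc i)"
  have "irreducible_in T (Z i) \<and> closedin T (Z i) \<and> Z i \<subseteq> S" if "i \<le> m" for i
    using Z(1) that closed by (auto simp: closedin_closed_subtopology)
  then have "m \<le> d" by (rule bound[of m Z]) (use Z(2) in auto)
  then show "enat m \<le> enat d" by simp
qed

lemma krull_dim_ge:
  assumes closed: "closedin T S"
    and "\<And>i. i \<le> m \<Longrightarrow> irreducible_in T (Z i) \<and> closedin T (Z i) \<and> Z i \<subseteq> S"
    and "\<And>i. i < m \<Longrightarrow> Z i \<subset> Z (Suc i)"
  shows "enat m \<le> krull_dim T S"
proof -
  have "\<forall>i\<le>m. irreducible_in T (Z i) \<and> closedin (subtopology T S) (Z i)"
    using assms(2) closed by (simp add: closedin_closed_subtopology)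
  moreover have "\<forall>i<m. Z i \<subset> Z (Suc i)" using assms(3) by simp
  ultimately show ?thesis unfolding krull_dim_def
    by (intro Sup_upper CollectI exI[of _ m] exI[of _ Z] conjI refl)
qed

lemma chain_mono:
  assumes "\<And>i. i < m \<Longrightarrow> Z i \<subset> Z (Suc i)" "i \<le> m"
  shows "Z i \<subseteq> Z m"
  using assms(2)
proof (induction rule: inc_induct)
  case (step k)
  then show ?case using assms(1)[of k] by blast
qed simp

lemma krull_dim_Union:
  assumes "finite \<C>" "\<C> \<noteq> {}" "\<And>C. C \<in> \<C> \<Longrightarrow> closedin T C" "\<And>C. C \<in> \<C> \<Longrightarrow> krull_dim T C = enat d"
  shows "krull_dim T (\<Union>\<C>) = enat d"
proof (rule antisym)
  have closed: "closedin T (\<Union>\<C>)" using assms by (intro closedin_Union) auto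
  show "krull_dim T (\<Union>\<C>) \<le> enat d"
  proof (rule krull_dim_le[OF closed])
    fix Z m assume Z: "\<And>i. i \<le> m \<Longrightarrow> irreducible_in T (Z i) \<and> closedin T (Z i) \<and> Z i \<subseteq> \<Union>\<C>"
      "\<And>i. i < m \<Longrightarrow> Z i \<subset> Z (Suc i)"
    obtain C where C: "C \<in> \<C>" "Z m \<subseteq> C"
      using irreducible_subset_Union[OF _ assms(1,3), of "Z m"] Z(1)[of m] by auto
    have "Z i \<subseteq> C" if "i \<le> m" for i using chain_mono[of m Z i] Z(2) that C(2) by blast
    then have "enat m \<le> krull_dim T C" using Z C assms(3) by (intro krull_dim_ge[of _ _ _ Z]) auto
    then show "m \<le> d" using assms(4)[OF C(1)] by simp
  qed
  obtain C where C: "C \<in> \<C>" using assms by auto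
  have "krull_dim T C \<le> krull_dim T (\<Union>\<C>)"
    unfolding krull_dim_def
  proof (rule Sup_subset_mono, clarify)
    fix m Z assume Z: "\<forall>i\<le>m. irreducible_in T (Z i) \<and>
      closedin (subtopology T C) (Z i)" "\<forall>i<m. Z i \<subset> Z (Suc i)"
    have "\<forall>i\<le>m. irreducible_in T (Z i) \<and> closedin (subtopology T (\<Union>\<C>)) (Z i)"
      using Z(1) C closed assms(3)[OF C] by (auto simp: closedin_closed_subtopology)
    with Z(2) show "\<exists>m'. enat m = enat m' \<and> (\<exists>Z. (\<forall>i\<le>m'. irreducible_in T (Z i) \<and>
        closedin (subtopology T (\<Union>\<C>)) (Z i)) \<and> (\<forall>i<m'. Z i \<subset> Z (Suc i)))" by blast
  qed
  then show "enat d \<le> krull_dim T (\<Union>\<C>)" using assms(4)[OF C] by simp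
qed

subsection \<open>Algebraic independence\<close>

definition expo :: "nat \<Rightarrow> nat \<Rightarrow> nat list set" where
  "expo m N = {as. set as \<subseteq> {..N} \<and> length as = m}"

definition monom_fun :: "('a \<Rightarrow> complex) list \<Rightarrow> nat list \<Rightarrow> 'a \<Rightarrow> complex" where
  "monom_fun fs as z = prod_list (map2 (\<lambda>f a. f z ^ a) fs as)"

text \<open>Bounding the exponents by \<open>N\<close> keeps the sums finite; letting
  \<open>N\<close> vary covers all polynomial relations.\<close>

definition alg_indep :: "('a \<Rightarrow> complex) list \<Rightarrow> 'a set \<Rightarrow> bool" where
  "alg_indep fs Z \<longleftrightarrow> (\<forall>N c. (\<forall>z\<in>Z. (\<Sum>as\<in>expo (length fs) N. c as * monom_fun fs as z) = 0) \<longrightarrow>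
     (\<forall>as\<in>expo (length fs) N. c as = 0))"

lemma finite_expo [simp]: "finite (expo m N)"
  unfolding expo_def by (rule finite_lists_length_eq) simp

lemma card_expo: "card (expo m N) = Suc N ^ m"
  unfolding expo_def by (subst card_lists_length_eq) auto

lemma expo_0 [simp]: "expo 0 N = {[]}"
  by (auto simp: expo_def)

lemma expo_Suc: "expo (Suc m) N = (\<lambda>(a, as). a # as) ` ({..N} \<times> expo m N)"
proof (intro equalityI subsetI)
  fix xs assume "xs \<in> expo (Suc m) N"
  then show "xs \<in> (\<lambda>(a, as). a # as) ` ({..N} \<times> expo m N)"
    by (cases xs) (auto simp: expo_def)
qed (auto simp: expo_def)

lemma sum_expo_Suc: "(\<Sum>as\<in>expo (Suc m) N. g as) = (\<Sum>a\<le>N. \<Sum>as\<in>expo m N. g (a # as))"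
proof -
  have "(\<Sum>as\<in>expo (Suc m) N. g as) = (\<Sum>(a, as)\<in>{..N} \<times> expo m N. g (a # as))"
    unfolding expo_Suc by (subst sum.reindex) (auto simp: inj_on_def case_prod_unfold)
  then show ?thesis by (simp add: sum.cartesian_product)
qed

lemma monom_fun_Nil [simp]: "monom_fun [] as z = 1"
  by (simp add: monom_fun_def)

lemma monom_fun_Cons [simp]: "monom_fun (f # fs) (a # as) z = f z ^ a * monom_fun fs as z"
  by (simp add: monom_fun_def)

lemma poly_funs_monom_fun:
  "set fs \<subseteq> poly_funs \<Longrightarrow> (\<lambda>z. monom_fun fs as z) \<in> poly_funs"
proof (induction fs arbitrary: as)
  case Nil
  then show ?case by (simp add: poly_funs.const)
next
  case (Cons f fs)
  then show ?case
    by (cases as) (auto simp: monom_fun_def[of "f # fs" "[]"] intro!: poly_funs_intros)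
qed

lemma alg_indep_mono: "alg_indep fs Z \<Longrightarrow> Z \<subseteq> Z' \<Longrightarrow> alg_indep fs Z'"
  unfolding alg_indep_def by (meson subsetD)

text \<open>The ring of polynomial functions on an irreducible set has no zero divisors.\<close>

lemma irreducible_mult_zero:
  assumes "irreducible_in zariski Z" "f \<in> poly_funs" "g \<in> poly_funs" "\<And>z. z \<in> Z \<Longrightarrow> f z * g z = 0"
    "z0 \<in> Z" "f z0 \<noteq> 0" "z \<in> Z"
  shows "g z = 0"
proof -
  have "Z \<subseteq> {z. f z = 0} \<union> {z. g z = 0}" using assms(4) by auto
  moreover have "closedin zariski {z. f z = 0}" "closedin zariski {z. g z = 0}"
    unfolding closedin_zariski by (rule exI[of _ "{f}"], use assms(2) in simp)
      (rule exI[of _ "{g}"], use assms(3) in simp)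
  ultimately have "Z \<subseteq> {z. f z = 0} \<or> Z \<subseteq> {z. g z = 0}" using assms(1) unfolding irreducible_in_def
    by blast
  then show ?thesis using assms by auto
qed

text \<open>In a relation between \<open>h\<close> and \<open>fs\<close> on \<open>Z'\<close> one cancels the largest possible power of \<open>h\<close>
  and restricts to \<open>Z\<close>: what remains is a relation between the \<open>fs\<close> on \<open>Z\<close>.\<close>
lemma alg_indep_extend:
  assumes irr: "irreducible_in zariski Z'" and sub: "Z \<subseteq> Z'" and h: "h \<in> poly_funs"
    and h0: "\<And>z. z \<in> Z \<Longrightarrow> h z = 0" and z0: "z0 \<in> Z'" "h z0 \<noteq> 0"
    and fs: "set fs \<subseteq> poly_funs" "alg_indep fs Z"
  shows "alg_indep (h # fs) Z'"
  unfolding alg_indep_def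
proof (intro allI impI)
  fix N c assume rel: "\<forall>z\<in>Z'. (\<Sum>as\<in>expo (length (h # fs)) N. c as * monom_fun (h # fs) as z) = 0"
  define p where "p a z = (\<Sum>as\<in>expo (length fs) N. c (a # as) * monom_fun fs as z)" for a z
  have pp: "(\<lambda>z. p a z) \<in> poly_funs" for a
    unfolding p_def by (intro poly_funs_intros poly_funs_monom_fun fs)
  have rel': "(\<Sum>a\<le>N. h z ^ a * p a z) = 0" if "z \<in> Z'" for z
    using rel[rule_format, OF that]
    by (simp add: sum_expo_Suc p_def sum_distrib_left algebra_simps)
  have "c (a # as) = 0" if "a \<le> N" "as \<in> expo (length fs) N" for a as
    using that
  proof (induction a arbitrary: as rule: less_induct)
    case (less a)
    \<comment> \<open>The induction hypothesis removes the terms below \<open>a\<close>; then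
      \<open>h ^ a\<close> factors out of the relation and is cancelled on the irreducible set
      \<open>Z'\<close>.\<close>
    have "p b z = 0" if "b < a" for b z
      unfolding p_def using less.IH[OF that] less.prems that by (intro sum.neutral) auto
    moreover have "{..N} = {..<a} \<union> {a..N}" using less.prems by auto
    then have "(\<Sum>b\<le>N. h z ^ b * p b z) = (\<Sum>b<a. h z ^ b * p b z) + (\<Sum>b=a..N. h z ^ b * p b z)" for z
      by (simp add: sum.union_disjoint ivl_disj_int)
    ultimately have *: "(\<Sum>b\<le>N. h z ^ b * p b z) = h z ^ a * (\<Sum>b=a..N. h z ^ (b - a) * p b z)" for z
      by (simp add: sum_distrib_left mult.assoc[symmetric] power_add[symmetric])
    have 0: "(\<Sum>b=a..N. h z ^ (b - a) * p b z) = 0" if "z \<in> Z'" for z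
      by (rule irreducible_mult_zero[OF irr poly_funs_power[OF h], where z = z])
        (use rel' * z0 that h pp in \<open>auto intro!: poly_funs_intros\<close>)
    have "p a z = 0" if "z \<in> Z" for z
    proof -
      \<comment> \<open>On \<open>Z\<close> every positive power of \<open>h\<close> vanishes, while
        \<open>0 ^ 0 = 1\<close> keeps the term \<open>b = a\<close>.\<close>
      have "(\<Sum>b=a..N. h z ^ (b - a) * p b z) = (\<Sum>b=a..N. if b = a then p b z else 0)"
        by (rule sum.cong) (auto simp: h0[OF that])
      then show ?thesis using 0 that sub less.prems by auto
    qed
    then show ?case
      using fs(2)[unfolded alg_indep_def, THEN spec[of _ N], THEN spec[of _
        "\<lambda>as. c (a # as)"]] less.prems
      by (simp add: p_def)
  qed
  then show "\<forall>as\<in>expo (length (h # fs)) N. c as = 0" by (auto simp: expo_Suc)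
qed

text \<open>Each strict inclusion contributes one function, namely a polynomial that vanishes on the
  smaller set and not on the larger one.\<close>

lemma chain_alg_indep:
  assumes "\<And>i. i \<le> m \<Longrightarrow> irreducible_in zariski (Z i) \<and> closedin zariski (Z i)"
    and "\<And>i. i < m \<Longrightarrow> Z i \<subset> Z (Suc i)"
  shows "\<exists>fs. length fs = m \<and> set fs \<subseteq> poly_funs \<and> alg_indep fs (Z m)"
  using assms
proof (induction m)
  case 0
  then have "Z 0 \<noteq> {}" unfolding irreducible_in_def by auto
  then show ?case by (intro exI[of _ "[]"]) (auto simp: alg_indep_def)
next
  case (Suc m)
  then obtain fs where fs: "length fs = m" "set fs \<subseteq> poly_funs" "alg_indep fs (Z m)" by auto
  have sub: "Z m \<subset> Z (Suc m)" using Suc.prems(2) by simp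
  then obtain x where x: "x \<in> Z (Suc m)" "x \<notin> Z m" by auto
  obtain h where "h \<in> poly_funs" "\<And>a. a \<in> Z m \<Longrightarrow> h a = 0" "h x \<noteq> 0"
    using zariski_closed_separate[OF _ x(2)] Suc.prems(1)[of m] by auto
  then have "alg_indep (h # fs) (Z (Suc m))"
    using fs x sub Suc.prems(1)[of "Suc m"] by (intro alg_indep_extend[of _ "Z m" _ x]) auto
  then show ?case using fs \<open>h \<in> poly_funs\<close> by (intro exI[of _ "h # fs"]) auto
qed

subsection \<open>Counting monomials\<close>

interpretation funvs: vector_space "\<lambda>(c::complex) (f::'x \<Rightarrow> complex) x. c * f x"
  by standard (auto simp: fun_eq_iff algebra_simps)

text \<open>Extended by 0 outside \<open>T\<close>, so that an identity valid on \<open>T\<close> is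
  an equality of functions and linear algebra in \<open>funvs\<close> applies.\<close>

definition box_monom :: "('a \<times> 'b) set \<Rightarrow> (complex^'b^'a) set \<Rightarrow> ('a \<times> 'b \<Rightarrow> nat) \<Rightarrow> complex^'b^'a \<Rightarrow>
  complex" where
  "box_monom J T e h = (if h \<in> T then \<Prod>k\<in>J. h $ fst k $ snd k ^ e k else 0)"

text \<open>The exponents are bounded in each variable separately, so for finite \<open>J\<close>
  there are at most \<open>Suc k ^ card J\<close> spanning monomials. This count is the source of
  the dimension bound.\<close>

definition box_polys :: "('a \<times> 'b) set \<Rightarrow> (complex^'b^'a) set \<Rightarrow> nat \<Rightarrow> (complex^'b^'a \<Rightarrow> complex) set"
  where
  "box_polys J T k = funvs.span (box_monom J T ` (J \<rightarrow>\<^sub>E {..k}))"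

definition restr :: "'x set \<Rightarrow> ('x \<Rightarrow> complex) \<Rightarrow> 'x \<Rightarrow> complex" where
  "restr T f x = (if x \<in> T then f x else 0)"

lemma box_polys_monom:
  fixes J :: "('a::finite \<times> 'b::finite) set"
  assumes "\<And>i. i \<in> J \<Longrightarrow> e i \<le> k"
  shows "box_monom J T e \<in> box_polys J T k"
proof -
  have "box_monom J T e = box_monom J T (restrict e J)" by (auto simp: box_monom_def fun_eq_iff)
  moreover have "restrict e J \<in> J \<rightarrow>\<^sub>E {..k}" using assms by auto
  ultimately show ?thesis unfolding box_polys_def by (metis funvs.span_base imageI)
qed

lemma box_polys_mult:
  fixes J :: "('a::finite \<times> 'b::finite) set"
  assumes "f \<in> box_polys J T a" "g \<in> box_polys J T b"
  shows "(\<lambda>h. f h * g h) \<in> box_polys J T (a + b)"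
proof -
  have mm: "(\<lambda>h. box_monom J T e h * box_monom J T e' h) \<in> box_polys J T (a + b)"
    if "e \<in> J \<rightarrow>\<^sub>E {..a}" "e' \<in> J \<rightarrow>\<^sub>E {..b}" for e e'
  proof -
    have "(\<lambda>h. box_monom J T e h * box_monom J T e' h) = box_monom J T (\<lambda>k. e k + e' k)"
      by (auto simp: box_monom_def fun_eq_iff power_add prod.distrib)
    also have "\<dots> \<in> box_polys J T (a + b)"
      using that by (intro box_polys_monom) (meson PiE_mem add_mono atMost_iff)
    finally show ?thesis .
  qed
  have sub: "(\<lambda>h. c * u h + v h) \<in> box_polys J T k"
    if "u \<in> box_polys J T k" "v \<in> box_polys J T k" for u v c k
    using funvs.span_add[OF funvs.span_scale[of u _ c] , of _ v] that
    unfolding box_polys_def by (simp add: plus_fun_def)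
  have zero: "(\<lambda>h. 0) \<in> box_polys J T k" for k
    using funvs.span_zero unfolding box_polys_def by (simp add: zero_fun_def)
  have m: "(\<lambda>h. box_monom J T e h * g h) \<in> box_polys J T (a + b)" if e: "e \<in> J \<rightarrow>\<^sub>E {..a}" for e
    using assms(2) unfolding box_polys_def[of J T b]
  proof (induction rule: funvs.span_induct_alt)
    case base
    then show ?case using zero by simp
  next
    case (step c x y)
    have "(\<lambda>h. c * (box_monom J T e h * x h) + box_monom J T e h * y h) \<in> box_polys J T (a + b)"
      using step mm[OF e] by (intro sub) auto
    then show ?case by (simp add: algebra_simps)
  qed
  show ?thesis using assms(1) unfolding box_polys_def[of J T a]
  proof (induction rule: funvs.span_induct_alt)
    case base
    then show ?case using zero by simp
  next
    case (step c x y)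
    have "(\<lambda>h. c * (x h * g h) + y h * g h) \<in> box_polys J T (a + b)"
      using step m by (intro sub) auto
    then show ?case by (simp add: algebra_simps)
  qed
qed

lemma box_polys_mono: "a \<le> b \<Longrightarrow> box_polys J T a \<subseteq> box_polys J T b"
  unfolding box_polys_def by (intro funvs.span_mono image_mono PiE_mono) auto

lemma box_polys_one: "restr T (\<lambda>_. 1) \<in> box_polys (J :: ('a::finite \<times> 'b::finite) set) T 0"
proof -
  have "restr T (\<lambda>_. 1) = box_monom J T (\<lambda>_. 0)" by (simp add: restr_def box_monom_def fun_eq_iff)
  then show ?thesis using box_polys_monom[of J "\<lambda>_. 0" 0 T] by simp
qed

lemma box_polys_power:
  fixes J :: "('a::finite \<times> 'b::finite) set"
  assumes "restr T f \<in> box_polys J T k"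
  shows "restr T (\<lambda>h. f h ^ a) \<in> box_polys J T (a * k)"
proof (induction a)
  case 0
  then show ?case using box_polys_one by simp
next
  case (Suc a)
  have "restr T (\<lambda>h. f h ^ Suc a) = (\<lambda>h. restr T f h * restr T (\<lambda>h. f h ^ a) h)"
    by (auto simp: restr_def)
  then show ?case using box_polys_mult[OF assms Suc] by simp
qed

text \<open>Coordinates outside \<open>J\<close> are constant on \<open>T\<close> and turn into
  coefficients.\<close>

lemma poly_fun_box_polys:
  fixes J :: "('a::finite \<times> 'b::finite) set"
  assumes fixed: "\<And>h i j. h \<in> T \<Longrightarrow> (i, j) \<notin> J \<Longrightarrow> h $ i $ j = c0 i j"
    and "f \<in> poly_funs"
  shows "\<exists>k. restr T f \<in> box_polys J T k"
  using assms(2)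
proof induction
  case (const c)
  have "restr T (\<lambda>_. c) = (\<lambda>h. c * restr T (\<lambda>_. 1) h)" by (auto simp: restr_def)
  also have "\<dots> \<in> box_polys J T 0"
    using box_polys_one unfolding box_polys_def by (intro funvs.span_scale)
  finally show ?case by blast
next
  case (coord i j)
  show ?case
  proof (cases "(i, j) \<in> J")
    case True
    have "(\<Prod>k\<in>J. h $ fst k $ snd k ^ (if k = (i, j) then 1 else 0)) = h $ i $ j" for h ::
      "complex^'b^'a"
    proof -
      have "(\<Prod>k\<in>J. h $ fst k $ snd k ^ (if k = (i, j) then 1 else 0)) = (\<Prod>k\<in>J. if k
        = (i, j) then h $ i $ j else 1)"
        by (rule prod.cong) auto
      then show ?thesis using True by simp
    qed
    then have "restr T (\<lambda>x. x $ i $ j) = box_monom J T (\<lambda>k. if k = (i, j) then 1 else 0)"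
      by (auto simp: restr_def box_monom_def fun_eq_iff)
    then show ?thesis using box_polys_monom[of J "\<lambda>k. if k = (i, j) then 1 else 0" 1 T]
      by (auto intro: exI[of _ 1])
  next
    case False
    then have "restr T (\<lambda>x. x $ i $ j) = (\<lambda>h. c0 i j * restr T (\<lambda>_. 1) h)"
      using fixed by (auto simp: restr_def)
    also have "\<dots> \<in> box_polys J T 0"
      using box_polys_one unfolding box_polys_def by (intro funvs.span_scale)
    finally show ?thesis by blast
  qed
next
  case (add f g)
  then obtain a b where ab: "restr T f \<in> box_polys J T a" "restr T g \<in> box_polys J T b" by blast
  then have "restr T f \<in> box_polys J T (max a b)" "restr T g \<in> box_polys J T (max a b)"
    using box_polys_mono[of a "max a b" J T] box_polys_mono[of b "max a b" J T] by auto
  then have "restr T f + restr T g \<in> box_polys J T (max a b)" unfolding box_polys_def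
    by (rule funvs.span_add)
  moreover have "restr T f + restr T g = restr T (\<lambda>h. f h + g h)" by (auto simp: restr_def)
  ultimately show ?case by auto
next
  case (mult f g)
  then obtain a b where ab: "restr T f \<in> box_polys J T a" "restr T g \<in> box_polys J T b" by blast
  have "restr T (\<lambda>h. f h * g h) = (\<lambda>h. restr T f h * restr T g h)" by (auto simp: restr_def)
  then show ?case using box_polys_mult[OF ab] by auto
qed

lemma exponent_compare:
  fixes m d k :: nat
  assumes "\<And>N. Suc N ^ m \<le> Suc (k * N) ^ d"
  shows "m \<le> d"
proof (rule ccontr)
  assume "\<not> m \<le> d"
  \<comment> \<open>With this choice \<open>Suc k ^ d\<close> is smaller than \<open>Suc N\<close>,
    so \<open>(Suc k * Suc N) ^ d\<close> stays below \<open>Suc N ^ Suc d\<close>.\<close>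
  define N where "N = Suc k ^ d"
  have "Suc N ^ Suc d \<le> Suc N ^ m" using \<open>\<not> m \<le> d\<close> by (intro power_increasing) auto
  also have "\<dots> \<le> Suc (k * N) ^ d" by (rule assms)
  also have "\<dots> \<le> (Suc k * Suc N) ^ d" by (intro power_mono) auto
  also have "\<dots> = N * Suc N ^ d" by (simp only: power_mult_distrib N_def)
  finally show False by simp
qed

lemma sum_fun_apply: "(\<Sum>x\<in>A. f x) h = (\<Sum>x\<in>A. f x h)"
  by (induction A rule: infinite_finite_induct) (simp_all add: zero_fun_def plus_fun_def)

context rational_map
begin

text \<open>With m functions, the \<open>Suc N ^ m\<close> monomials in their pullbacks, multiplied
  by a common power of \<open>q\<close>, are linearly independent polynomials in
  \<open>card J\<close> variables of degree linear in \<open>N\<close>. Comparing the growth of both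
  counts in \<open>N\<close> bounds m.\<close>

lemma alg_indep_le_card:
  assumes fixed: "\<And>h i j. h \<in> D \<Longrightarrow> (i, j) \<notin> J \<Longrightarrow> h $ i $ j = c0 i j"
    and fs: "set fs \<subseteq> poly_funs" "alg_indep fs (\<phi> ` dom)"
  shows "length fs \<le> card J"
proof -
  note box = poly_fun_box_polys[of dom J c0, OF fixed]
  have "\<exists>E k. restr dom (\<lambda>h. q h ^ E) \<in> box_polys J dom k \<and>
      (\<forall>f\<in>set fs. restr dom (\<lambda>h. q h ^ E * f (\<phi> h)) \<in> box_polys J dom k)"
    using fs(1)
  proof (induction fs)
    case Nil
    then show ?case using box_polys_one[of dom J] by (intro exI[of _ 0] exI[of _ 0]) auto
  next
    case (Cons f fs)
    then obtain E k where E: "restr dom (\<lambda>h. q h ^ E) \<in> box_polys J dom k"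
      "\<forall>f\<in>set fs. restr dom (\<lambda>h. q h ^ E * f (\<phi> h)) \<in> box_polys J dom k" by auto
    obtain e P where P: "P \<in> poly_funs" "\<forall>h\<in>dom. q h ^ e * f (\<phi> h) = P h"
      using pullback[of f] Cons.prems by (auto simp del: mult_cancel_left)
    have eq: "restr dom (\<lambda>h. q h ^ e * f (\<phi> h)) = restr dom P" using P(2) by (auto simp: restr_def)
    obtain k1 where "restr dom P \<in> box_polys J dom k1" using box[OF _ _ P(1)] by blast
    then have k1: "restr dom (\<lambda>h. q h ^ e * f (\<phi> h)) \<in> box_polys J dom k1" using eq by simp
    obtain k2 where k2: "restr dom (\<lambda>h. q h ^ e) \<in> box_polys J dom k2"
      using box[OF _ _ poly_funs_power[OF denom]] by blast
    let ?k = "k + k1 + k2"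
    have mul: "restr dom (\<lambda>h. u h * v h) \<in> box_polys J dom ?k"
      if "restr dom u \<in> box_polys J dom a" "restr dom v \<in> box_polys J dom b" "a + b \<le> ?k" for u v a b
    proof -
      have "restr dom (\<lambda>h. u h * v h) = (\<lambda>h. restr dom u h * restr dom v h)" by (auto simp: restr_def)
      then show ?thesis using box_polys_mult[OF that(1,2)] box_polys_mono[OF that(3)] by auto
    qed
    have "restr dom (\<lambda>h. q h ^ (e + E)) \<in> box_polys J dom ?k"
      using mul[OF k2 E(1)] by (simp add: power_add)
    moreover have "restr dom (\<lambda>h. q h ^ (e + E) * f (\<phi> h)) \<in> box_polys J dom ?k"
      using mul[OF k1 E(1)] by (simp add: power_add mult_ac)
    moreover have "restr dom (\<lambda>h. q h ^ (e + E) * g (\<phi> h)) \<in> box_polys J dom ?k" if "g \<in> set fs" for g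
      using mul[OF k2 E(2)[rule_format, OF that]] by (simp add: power_add mult_ac)
    ultimately show ?case by (intro exI[of _ "e + E"] exI[of _ ?k]) auto
  qed
  then obtain E k where E: "restr dom (\<lambda>h. q h ^ E) \<in> box_polys J dom k"
      "\<forall>f\<in>set fs. restr dom (\<lambda>h. q h ^ E * f (\<phi> h)) \<in> box_polys J dom k" by blast
  \<comment> \<open>The power \<open>E * N * m\<close> clears the denominators of all monomials with
    exponents up to \<open>N\<close> at once, so one and the same factor multiplies a whole
    relation.\<close>
  define G where "G m N as = restr dom (\<lambda>h. q h ^ (E * N * m) * monom_fun fs as (\<phi> h))" for m N as
  have G: "restr dom (\<lambda>h. q h ^ (E * N * length gs) * monom_fun gs as (\<phi> h)) \<in> box_polys J dom (k *
    N * length gs)"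
    if "set gs \<subseteq> set fs" "as \<in> expo (length gs) N" for gs as N
    using that
  proof (induction gs arbitrary: as)
    case Nil
    then show ?case using box_polys_one[of dom J] by simp
  next
    case (Cons g gs)
    then obtain a as' where as: "as = a # as'" "a \<le> N" "as' \<in> expo (length gs) N"
      by (auto simp: expo_Suc)
    have g: "restr dom (\<lambda>h. q h ^ E * g (\<phi> h)) \<in> box_polys J dom k" using E Cons.prems by auto
    \<comment> \<open>Of the power \<open>E * N\<close> of \<open>q\<close> belonging to
      \<open>g\<close>, the part \<open>E * a\<close> goes into \<open>(q ^ E * g) ^ a\<close>; the
      rest is \<open>(q ^ E) ^ (N - a)\<close>. All \<open>N\<close> factors have degree at most
      \<open>k\<close>.\<close>
    have "restr dom (\<lambda>h. q h ^ (E * N * length (g # gs)) * monom_fun (g # gs) as (\<phi> h)) =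
      (\<lambda>h. (restr dom (\<lambda>h. (q h ^ E * g (\<phi> h)) ^ a) h * restr dom (\<lambda>h. (q h ^ E) ^ (N - a)) h) *
        restr dom (\<lambda>h. q h ^ (E * N * length gs) * monom_fun gs as' (\<phi> h)) h)"
    proof -
      have "E * N = E * a + E * (N - a)" using as(2) by (simp add: distrib_left[symmetric])
      then have "q h ^ (E * N) = q h ^ (E * a) * q h ^ (E * (N - a))" for h by (simp add: power_add)
      then show ?thesis
        by (auto simp: as(1) restr_def fun_eq_iff power_add power_mult_distrib power_mult[symmetric]
          mult_ac)
    qed
    also have "\<dots> \<in> box_polys J dom ((a * k + (N - a) * k) + k * N * length gs)"
      using Cons as by (intro box_polys_mult box_polys_power g E(1)) auto
    also have "(a * k + (N - a) * k) + k * N * length gs = k * N * length (g # gs)"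
    proof -
      have "a * k + (N - a) * k = N * k" using as(2) by (simp add: add_mult_distrib[symmetric])
      then show ?thesis by (simp add: algebra_simps)
    qed
    finally show ?case .
  qed
  have "Suc N ^ length fs \<le> Suc ((k * length fs) * N) ^ card J" for N
  proof -
    let ?m = "length fs"
    let ?G = "G ?m N"
    have rel: "c as = 0" if "(\<Sum>as\<in>expo ?m N. (\<lambda>h. c as * ?G as h)) = 0" "as \<in> expo ?m N" for c as
    proof -
      have "(\<Sum>as\<in>expo ?m N. c as * monom_fun fs as (\<phi> h)) = 0" if h: "h \<in> dom" for h
      proof -
        have "(\<Sum>as\<in>expo ?m N. c as * ?G as h) = 0"
          using fun_cong[OF \<open>(\<Sum>as\<in>expo ?m N. (\<lambda>h. c as * ?G as h)) = 0\<close>, of h]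
          by (simp add: sum_fun_apply)
        then have "q h ^ (E * N * ?m) * (\<Sum>as\<in>expo ?m N. c as * monom_fun fs as (\<phi> h)) = 0"
          using h by (simp add: G_def restr_def sum_distrib_left mult_ac)
        then show ?thesis using h by simp
      qed
      then show ?thesis using fs(2) that(2) unfolding alg_indep_def by blast
    qed
    have inj: "inj_on ?G (expo ?m N)"
    proof (rule inj_onI, rule ccontr)
      fix as bs assume *: "as \<in> expo ?m N" "bs \<in> expo ?m N" "?G as = ?G bs" "as \<noteq> bs"
      \<comment> \<open>Equal functions for \<open>as\<close> and \<open>bs\<close> would be a
        relation with coefficients 1 and -1.\<close>
      define c where "c xs = (if xs = as then 1 else if xs = bs then -1 else 0 :: complex)" for xs
      have "(\<Sum>xs\<in>expo ?m N. (\<lambda>h. c xs * ?G xs h)) = (\<Sum>xs\<in>{as, bs}. (\<lambda>h. c xs * ?G xs h))"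
        using * by (intro sum.mono_neutral_right) (auto simp: c_def fun_eq_iff)
      also have "\<dots> = 0" using * by (auto simp: c_def fun_eq_iff)
      finally show False using rel[of c as] * by (simp add: c_def)
    qed
    have "funvs.independent (?G ` expo ?m N)"
    proof (rule funvs.independent_if_scalars_zero)
      fix u x assume u: "(\<Sum>x\<in>?G ` expo ?m N. (\<lambda>h. u x * x h)) = 0" and "x \<in> ?G ` expo ?m N"
      then obtain as where as: "as \<in> expo ?m N" "x = ?G as" by blast
      have "(\<Sum>as\<in>expo ?m N. (\<lambda>h. u (?G as) * ?G as h)) = 0"
        using u by (subst (asm) sum.reindex[OF inj]) (simp add: o_def)
      from rel[OF this as(1)] as(2) show "u x = 0" by simp
    qed simp
    moreover have "?G ` expo ?m N \<subseteq> funvs.span (box_monom J dom ` (J \<rightarrow>\<^sub>E {..k * N * ?m}))"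
      using G[of fs] unfolding G_def box_polys_def by auto
    moreover have fin: "finite (J \<rightarrow>\<^sub>E {..k * N * ?m})" by (intro finite_PiE) auto
    ultimately have "card (?G ` expo ?m N) \<le> card (box_monom J dom ` (J \<rightarrow>\<^sub>E {..k * N * ?m}))"
      using funvs.independent_span_bound by blast
    also have "\<dots> \<le> card (J \<rightarrow>\<^sub>E {..k * N * ?m})" using fin by (rule card_image_le)
    also have "\<dots> = Suc ((k * ?m) * N) ^ card J" by (simp add: card_PiE mult_ac)
    finally show ?thesis by (simp add: card_image[OF inj] card_expo)
  qed
  then show ?thesis by (rule exponent_compare)
qed

text \<open>The closure of the image has dimension \<open>card J\<close> if \<open>\<phi>\<close> has a rational left inverse
  \<open>\<psi> / \<rho>\<close>: for the lower bound take the images of the members of a coordinate flag through \<open>h0\<close>.\<close>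
lemma krull_dim_image:
  assumes D: "D = {h. \<forall>i j. (i, j) \<notin> J \<longrightarrow> h $ i $ j = h0 $ i $ j}"
    and h0: "q h0 \<noteq> 0" "\<rho> (\<phi> h0) \<noteq> 0"
    and \<rho>: "\<rho> \<in> poly_funs" and \<psi>: "\<And>k. k \<in> J \<Longrightarrow> \<psi> k \<in> poly_funs"
    and left_inv: "\<And>h i j. h \<in> dom \<Longrightarrow> (i, j) \<in> J \<Longrightarrow>
        \<psi> (i, j) (\<phi> h) = (h $ i $ j - h0 $ i $ j) * \<rho> (\<phi> h)"
  shows "krull_dim zariski (zariski closure_of (\<phi> ` dom)) = enat (card J)"
proof (rule antisym)
  let ?Z = "zariski closure_of (\<phi> ` dom)"
  show "krull_dim zariski ?Z \<le> enat (card J)"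
  proof (rule krull_dim_le[OF closedin_zariski_closure])
    fix Z m assume Z: "\<And>i. i \<le> m \<Longrightarrow> irreducible_in zariski (Z i) \<and> closedin zariski (Z i) \<and> Z i \<subseteq> ?Z"
      "\<And>i. i < m \<Longrightarrow> Z i \<subset> Z (Suc i)"
    obtain fs where fs: "length fs = m" "set fs \<subseteq> poly_funs" "alg_indep fs (Z m)"
      using chain_alg_indep[of m Z] Z by blast
    have "alg_indep fs ?Z" using alg_indep_mono fs(3) Z(1)[of m] by blast
    \<comment> \<open>A relation on the image is a polynomial identity and therefore extends to the
      closure.\<close>
    then have "alg_indep fs (\<phi> ` dom)"
    proof (unfold alg_indep_def, intro allI impI)
      fix N c
      assume *: "\<forall>N c. (\<forall>z\<in>?Z. (\<Sum>as\<in>expo (length fs) N. c as * monom_fun fs as z) = 0) \<longrightarrow>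
          (\<forall>as\<in>expo (length fs) N. c as = 0)"
        and 0: "\<forall>z\<in>\<phi> ` dom. (\<Sum>as\<in>expo (length fs) N. c as * monom_fun fs as z) = 0"
      have "(\<Sum>as\<in>expo (length fs) N. c as * monom_fun fs as z) = 0" if "z \<in> ?Z" for z
        by (rule poly_fun_vanish_closure[OF _ _ that])
          (use 0 fs(2) in \<open>auto intro!: poly_funs_intros poly_funs_monom_fun\<close>)
      with * show "\<forall>as\<in>expo (length fs) N. c as = 0" by blast
    qed
    then show "m \<le> card J" using alg_indep_le_card[of J "\<lambda>i j. h0 $ i $ j"] fs D by auto
  qed
  have "finite J" by simp
  then obtain js where js: "set js = J" "distinct js" using finite_distinct_list by blast
  define Ds where "Ds m = {h. \<forall>i j. (i, j) \<notin> set (take m js) \<longrightarrow> h $ i $ j = h0 $ i $ j}" for m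
  have Ds_sub: "Ds m \<subseteq> D" for m
    using set_take_subset[of m js] js(1) unfolding Ds_def D by blast
  have h0_mem: "h0 \<in> Ds m" for m by (simp add: Ds_def)
  define Z where "Z m = zariski closure_of (\<phi> ` {h \<in> Ds m. q h \<noteq> 0})" for m
  have irr: "irreducible_in zariski (Z m)" for m
  proof -
    interpret r: rational_map "Ds m" q \<phi>
    proof
      show "\<And>u v c. u \<in> Ds m \<Longrightarrow> v \<in> Ds m \<Longrightarrow> line u (v - u) c \<in> Ds m" by (simp add: Ds_def)
      show "\<exists>P\<in>poly_funs. \<forall>h\<in>Ds m. q h \<noteq> 0 \<longrightarrow> q h * \<phi> h $ i $ j = P h" for i j
        using frac[of i j] Ds_sub by blast
    qed (rule denom)
    show ?thesis unfolding Z_def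
      by (intro irreducible_closure r.irreducible_image) (use h0_mem h0 in auto)
  qed
  have "enat (length js) \<le> krull_dim zariski ?Z"
  proof (rule krull_dim_ge[OF closedin_zariski_closure, of _ Z])
    show "irreducible_in zariski (Z i) \<and> closedin zariski (Z i) \<and> Z i \<subseteq> ?Z" for i
      using irr Ds_sub[of i] unfolding Z_def by (auto intro!: closure_of_mono closedin_zariski_closure)
  next
    fix m assume m: "m < length js"
    obtain a b where ab: "js ! m = (a, b)" by force
    have abJ: "(a, b) \<in> J" using m ab js(1) nth_mem by metis
    have ab_new: "(a, b) \<notin> set (take m js)"
    proof -
      have "distinct (take m js @ js ! m # drop (Suc m) js)" using js(2) id_take_nth_drop[OF m] by simp
      then show ?thesis using ab by simp
    qed
    have Suc: "set (take (Suc m) js) = insert (a, b) (set (take m js))"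
      using m ab by (simp add: take_Suc_conv_app_nth)
    have "Z m \<subseteq> Z (Suc m)" unfolding Z_def
      by (intro closure_of_mono image_mono) (auto simp: Ds_def Suc)
    moreover have "\<not> Z (Suc m) \<subseteq> Z m"
    proof
      assume sub: "Z (Suc m) \<subseteq> Z m"
      \<comment> \<open>The coordinate \<open>(a, b)\<close> is frozen on \<open>Ds m\<close>, so
        \<open>\<psi> (a, b)\<close> vanishes on \<open>Z m\<close>. Moving \<open>h0\<close> in
        this coordinate direction gives a point of \<open>Z (Suc m)\<close> where it does not
        vanish.\<close>
      have van: "\<psi> (a, b) z = 0" if "z \<in> Z m" for z
      proof (rule poly_fun_vanish_closure[OF \<psi>[OF abJ] _ that[unfolded Z_def]])
        fix s assume "s \<in> \<phi> ` {h \<in> Ds m. q h \<noteq> 0}"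
        then obtain h where h: "h \<in> Ds m" "q h \<noteq> 0" "s = \<phi> h" by auto
        then have "h \<in> dom" "h $ a $ b = h0 $ a $ b" using Ds_sub ab_new by (auto simp: Ds_def)
        then show "\<psi> (a, b) s = 0" using left_inv[OF _ abJ] h by simp
      qed
      define w where "w = (\<chi> i j. if (i, j) = (a, b) then 1 else (0 :: complex))"
      obtain e P where P: "P \<in> poly_funs" "\<forall>h\<in>dom. q h ^ e * \<rho> (\<phi> h) = P h" using pullback[OF \<rho>]
        by blast
      obtain p where p: "\<forall>c. P (line h0 w c) = poly p c" using poly_fun_on_line[OF P(1)] by blast
      obtain p' where p': "\<forall>c. q (line h0 w c) = poly p' c" using poly_fun_on_line[OF denom] by blast
      have "h0 \<in> dom" using h0_mem[of 0] Ds_sub h0 by auto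
      then have "poly p 0 \<noteq> 0" "poly p' 0 \<noteq> 0"
        using p[rule_format, of 0] p'[rule_format, of 0] P(2)[rule_format, of h0] h0 by auto
      then have "0 \<notin> {p, p'}" by auto
      from poly_nonzero_ex[OF _ this, of "{0}"] obtain c
        where c: "c \<noteq> 0" "poly p c \<noteq> 0" "poly p' c \<noteq> 0" by auto
      define h where "h = line h0 w c"
      have hS: "h \<in> Ds (Suc m)" by (auto simp: Ds_def Suc h_def w_def)
      have qh: "q h \<noteq> 0" using c p' by (simp add: h_def)
      then have hd: "h \<in> dom" using hS Ds_sub by auto
      have "\<rho> (\<phi> h) \<noteq> 0" using P(2)[rule_format, OF hd] c p by (auto simp: h_def)
      moreover have "h $ a $ b - h0 $ a $ b = c" by (simp add: h_def w_def)
      ultimately have "\<psi> (a, b) (\<phi> h) \<noteq> 0" using left_inv[OF hd abJ] c by simp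
      moreover have "\<phi> h \<in> Z (Suc m)" unfolding Z_def
        using hS qh subset_zariski_closure[of "\<phi> ` {h \<in> Ds (Suc m). q h \<noteq> 0}"] by auto
      ultimately show False using van sub by blast
    qed
    ultimately show "Z m \<subset> Z (Suc m)" by blast
  qed
  then show "enat (card J) \<le> krull_dim zariski ?Z" using distinct_card[OF js(2)] js(1) by simp
qed

end

subsection \<open>Powers and conjugation of matrices\<close>

definition mpow :: "complex^'m^'m \<Rightarrow> nat \<Rightarrow> complex^'m^'m" where
  "mpow x k = (((**) x) ^^ k) (mat 1)"

lemma mpow_0 [simp]: "mpow x 0 = mat 1" and mpow_Suc: "mpow x (Suc k) = x ** mpow x k"
  by (simp_all add: mpow_def)

lemma mpow_1 [simp]: "mpow x (Suc 0) = x"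
  by (simp add: mpow_Suc)

lemma nilpotent_matrix_mpow: "nilpotent_matrix x \<longleftrightarrow> (\<exists>k. mpow x k = 0)"
  by (simp add: nilpotent_matrix_def mpow_def)

lemma mpow_add: "mpow x (a + b) = mpow x a ** mpow x b"
  by (induction a) (simp_all add: mpow_Suc matrix_mul_assoc)

lemma intertwine_mpow:
  assumes "h ** y = x ** h"
  shows "h ** mpow y k = mpow x k ** h"
proof (induction k)
  case (Suc k)
  have "h ** mpow y (Suc k) = x ** (h ** mpow y k)" by (simp add: mpow_Suc matrix_mul_assoc assms)
  then show ?case using Suc by (simp add: mpow_Suc matrix_mul_assoc)
qed simp

lemma mpow_Suc2: "mpow x (Suc k) = mpow x k ** x"
  using mpow_add[of x k 1] by simp

lemma poly_funs_mpow: "(\<lambda>x :: complex^'m^'m. mpow x k $ i $ j) \<in> poly_funs"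
proof (induction k arbitrary: i j)
  case 0
  then show ?case by (simp add: poly_funs.const)
next
  case (Suc k)
  then show ?case unfolding mpow_Suc by (intro poly_funs_matrix_mul poly_funs.coord)
qed

lemma matrix_inv_mul:
  fixes g :: "complex^'m^'m"
  assumes "invertible g"
  shows "matrix_inv g ** g = mat 1" "g ** matrix_inv g = mat 1"
  using someI_ex[OF assms[unfolded invertible_def]] by (simp_all add: matrix_inv_def)

lemma matrix_inv_unique:
  fixes g :: "complex^'m^'m"
  assumes "g ** h = mat 1"
  shows "matrix_inv g = h" "invertible g"
proof -
  have hg: "h ** g = mat 1" using assms matrix_left_right_inverse by blast
  then show "invertible g" using assms unfolding invertible_def by blast
  then show "matrix_inv g = h"
    using matrix_inv_mul(1)[of g] assms by (metis matrix_mul_assoc matrix_mul_lid matrix_mul_rid)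
qed

lemma invertible_matrix_inv: "invertible (g :: complex^'m^'m) \<Longrightarrow> invertible (matrix_inv g)"
  and matrix_inv_inv: "invertible (g :: complex^'m^'m) \<Longrightarrow> matrix_inv (matrix_inv g) = g"
  using matrix_inv_unique[of "matrix_inv g" g] matrix_inv_mul(1)[of g] by auto

lemma matrix_inv_mult:
  fixes g h :: "complex^'m^'m"
  assumes "invertible g" "invertible h"
  shows "matrix_inv (g ** h) = matrix_inv h ** matrix_inv g"
proof (rule matrix_inv_unique(1))
  have "g ** h ** (matrix_inv h ** matrix_inv g) = g ** (h ** matrix_inv h) ** matrix_inv g"
    by (simp add: matrix_mul_assoc)
  then show "g ** h ** (matrix_inv h ** matrix_inv g) = mat 1" using assms by (simp add: matrix_inv_mul)
qed

lemma conj_by_eq_iff: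
  fixes x :: "('n::finite) bmat"
  assumes "invertible g"
  shows "conj_by g x = y \<longleftrightarrow> g ** x = y ** g"
proof
  assume "g ** x = y ** g"
  then have "conj_by g x = y ** (g ** matrix_inv g)" unfolding conj_by_def
    by (simp add: matrix_mul_assoc)
  then show "conj_by g x = y" using assms by (simp add: matrix_inv_mul)
next
  assume "conj_by g x = y"
  then have "y ** g = g ** x ** (matrix_inv g ** g)" unfolding conj_by_def
    by (simp add: matrix_mul_assoc)
  then show "g ** x = y ** g" using assms by (simp add: matrix_inv_mul)
qed

lemma conj_by_conj_by:
  fixes x :: "('n::finite) bmat"
  shows "invertible g \<Longrightarrow> invertible h \<Longrightarrow> conj_by g (conj_by h x) = conj_by (g ** h) x"
  by (simp add: conj_by_def matrix_inv_mult matrix_mul_assoc)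

lemma conj_by_1 [simp]: "conj_by (mat 1) (x :: ('n::finite) bmat) = x"
  using matrix_inv_unique(1)[of "mat 1 :: 'n bmat" "mat 1"] by (simp add: conj_by_def)

lemma conj_by_inv:
  fixes x :: "('n::finite) bmat"
  assumes "invertible g"
  shows "conj_by g (conj_by (matrix_inv g) x) = x" "conj_by (matrix_inv g) (conj_by g x) = x"
  using assms by (simp_all add: conj_by_conj_by invertible_matrix_inv matrix_inv_mul)

lemma conj_by_mult:
  fixes x :: "('n::finite) bmat"
  assumes "invertible g"
  shows "conj_by g (x ** y) = conj_by g x ** conj_by g y"
proof -
  have "conj_by g x ** conj_by g y = g ** x ** (matrix_inv g ** g) ** y ** matrix_inv g"
    by (simp add: conj_by_def matrix_mul_assoc)
  then show ?thesis using assms by (simp add: conj_by_def matrix_inv_mul matrix_mul_assoc)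
qed

lemma conj_by_add: "conj_by g (x + y) = conj_by g x + conj_by g (y :: ('n::finite) bmat)"
  by (simp add: conj_by_def vec_eq_iff matrix_matrix_mult_def distrib_left distrib_right sum.distrib)

lemma conj_by_diff: "conj_by g (x - y) = conj_by g x - conj_by g (y :: ('n::finite) bmat)"
  by (simp add: conj_by_def vec_eq_iff matrix_matrix_mult_def left_diff_distrib
      right_diff_distrib sum_subtractf)

lemma conj_by_0 [simp]: "conj_by g (0 :: ('n::finite) bmat) = 0"
  by (simp add: conj_by_def)

lemma conj_by_scale:
  "conj_by g (\<chi> i j. c * x $ i $ j) = (\<chi> i j. c * conj_by g (x :: ('n::finite) bmat) $ i $ j)"
  by (simp add: conj_by_def vec_eq_iff matrix_matrix_mult_def sum_distrib_left sum_distrib_right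
    mult_ac)

lemma conj_by_mpow:
  fixes x :: "('n::finite) bmat"
  assumes "invertible g"
  shows "mpow (conj_by g x) k = conj_by g (mpow x k)"
proof (induction k)
  case 0
  then show ?case using assms by (simp add: conj_by_def matrix_inv_mul)
next
  case (Suc k)
  then show ?case using assms by (simp add: mpow_Suc conj_by_mult)
qed

lemma nilpotent_conj_by: "invertible g \<Longrightarrow> nilpotent_matrix x \<Longrightarrow> nilpotent_matrix (conj_by g x)"
  unfolding nilpotent_matrix_mpow by (metis conj_by_mpow conj_by_0)

lemma poly_funs_conj_by: "(\<lambda>x :: ('n::finite) bmat. conj_by g x $ i $ j) \<in> poly_funs"
  unfolding conj_by_def by (intro poly_funs_matrix_mul poly_funs.coord poly_funs.const)

lemma closure_conj_by:
  fixes x :: "('n::finite) bmat"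
  assumes "x \<in> zariski closure_of S" "\<And>s. s \<in> S \<Longrightarrow> conj_by g s \<in> zariski closure_of T"
  shows "conj_by g x \<in> zariski closure_of T"
  using zariski_closure_map[OF poly_funs_conj_by assms(2,1)] .

lemma matrix_mult_nth: "(x ** y) $ i $ j = (\<Sum>k\<in>UNIV. x $ i $ k * y $ k $ j)"
  by (simp add: matrix_matrix_mult_def)

lemma mat_1_nth: "(mat 1 :: complex^'m^'m) $ i $ j = (if i = j then 1 else 0)"
  by (simp add: mat_def)

subsection \<open>Signs and levels of indices\<close>

definition sg :: "'n + 'n \<Rightarrow> sign" where
  "sg = case_sum (\<lambda>_. Plus) (\<lambda>_. Minus)"

text \<open>The index type carries no order; an arbitrary numbering from 0 supplies one for flags
  and triangular matrices.\<close>

definition index_num :: "'n::finite \<Rightarrow> nat" where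
  "index_num = (SOME f. bij_betw f UNIV {..<CARD('n)})"

definition num :: "('n::finite) + 'n \<Rightarrow> nat" where
  "num = case_sum index_num index_num"

lemma sg_simps [simp]: "sg (Inl i) = Plus" "sg (Inr i) = Minus"
  by (simp_all add: sg_def)

lemma bij_index_num: "bij_betw (index_num :: 'n::finite \<Rightarrow> nat) UNIV {..<CARD('n)}"
  unfolding index_num_def
proof (rule someI_ex[where P = "\<lambda>f :: 'n \<Rightarrow> nat. bij_betw f UNIV {..<CARD('n)}"])
  show "\<exists>f :: 'n \<Rightarrow> nat. bij_betw f UNIV {..<CARD('n)}"
    using ex_bij_betw_finite_nat[of "UNIV :: 'n set"] by (simp add: atLeast0LessThan)
qed

lemma num_less: "num (j :: ('n::finite) + 'n) < CARD('n)"
  using bij_betwE[OF bij_index_num] by (cases j) (auto simp: num_def)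

lemma index_eqI: "sg i = sg j \<Longrightarrow> num i = num j \<Longrightarrow> i = (j :: ('n::finite) + 'n)"
  using bij_betw_imp_inj_on[OF bij_index_num[where 'n = 'n]]
  by (cases i; cases j) (auto simp: num_def sg_def inj_on_def)

definition idx :: "sign \<Rightarrow> nat \<Rightarrow> ('n::finite) + 'n" where
  "idx s k = (THE j. sg j = s \<and> num j = k)"

lemma idx: 
  assumes "k < CARD('n::finite)"
  shows "sg (idx s k :: 'n + 'n) = s" "num (idx s k :: 'n + 'n) = k"
proof -
  obtain i :: 'n where i: "index_num i = k"
    using assms bij_betw_imp_surj_on[OF bij_index_num[where 'n = 'n]] by (metis imageE lessThan_iff)
  define j :: "'n + 'n" where "j = (if s = Plus then Inl i else Inr i)"
  have j: "sg j = s \<and> num j = k" using i by (cases s) (auto simp: j_def num_def)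
  then have "sg (idx s k :: 'n + 'n) = s \<and> num (idx s k :: 'n + 'n) = k"
    unfolding idx_def by (rule theI) (use j index_eqI in auto)
  then show "sg (idx s k :: 'n + 'n) = s" "num (idx s k :: 'n + 'n) = k" by auto
qed

lemma idx_unique: "idx (sg j) (num j) = (j :: ('n::finite) + 'n)"
  by (rule index_eqI) (simp_all add: idx num_less)

lemma flip_flip [simp]: "flip_sign (flip_sign s) = s" and flip_neq [simp]: "flip_sign s \<noteq> s"
  "s \<noteq> flip_sign s"
  by (cases s; simp)+

lemma neq_sign_iff: "s \<noteq> t \<longleftrightarrow> s = flip_sign t"
  by (cases s; cases t) auto

lemma V_sg: "V s = {v. \<forall>i. sg i \<noteq> s \<longrightarrow> v $ i = 0}"
  by (cases s) (auto simp: sg_def split: sum.splits)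

lemma lie_k_sg: "lie_k = {x. \<forall>i j. sg i \<noteq> sg j \<longrightarrow> x $ i $ j = 0}"
  by (auto simp: lie_k_def sg_def split: sum.splits)

lemma space_s_sg: "space_s = {x. \<forall>i j. sg i = sg j \<longrightarrow> x $ i $ j = 0}"
  by (auto simp: space_s_def sg_def split: sum.splits)

lemma diag_part_nth: "diag_part x $ i $ j = (if sg i = sg j then x $ i $ j else 0)"
  and offdiag_part_nth: "offdiag_part x $ i $ j = (if sg i = sg j then 0 else x $ i $ j)"
  by (cases i; cases j; simp add: diag_part_def offdiag_part_def)+

lemma diag_part_in [simp]: "diag_part x \<in> lie_k" and offdiag_part_in [simp]: "offdiag_part x \<in> space_s"
  by (auto simp: lie_k_sg space_s_sg diag_part_nth offdiag_part_nth)

lemma diag_offdiag: "x = diag_part x + offdiag_part x"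
  by (simp add: vec_eq_iff diag_part_nth offdiag_part_nth)

lemma diag_offdiag_unique:
  assumes "z \<in> lie_k" "y \<in> space_s"
  shows "diag_part (z + y) = z" "offdiag_part (z + y) = y"
  using assms by (auto simp: vec_eq_iff diag_part_nth offdiag_part_nth lie_k_sg space_s_sg)

lemma lie_k_mult_nz: "x \<in> lie_k \<Longrightarrow> x $ i $ k \<noteq> 0 \<Longrightarrow> sg i = sg k"
  by (auto simp: lie_k_sg)

lemma lie_k_mult: "x \<in> lie_k \<Longrightarrow> y \<in> lie_k \<Longrightarrow> x ** y \<in> lie_k"
  by (simp add: lie_k_sg matrix_mult_nth) (metis (mono_tags, lifting) mult_eq_0_iff sum.neutral)

lemma lie_k_space_s_mult:
  "x \<in> lie_k \<Longrightarrow> y \<in> space_s \<Longrightarrow> x ** y \<in> space_s"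
  "y \<in> space_s \<Longrightarrow> x \<in> lie_k \<Longrightarrow> y ** x \<in> space_s"
  by (simp_all add: lie_k_sg space_s_sg matrix_mult_nth) (metis (mono_tags,
    lifting) mult_eq_0_iff sum.neutral)+

lemma matrix_vector_nth: "(x *v v) $ i = (\<Sum>k\<in>UNIV. x $ i $ k * v $ k)"
  by (simp add: matrix_vector_mult_def)

lemma lie_k_vec: "x \<in> lie_k \<Longrightarrow> v \<in> V s \<Longrightarrow> x *v v \<in> V s"
  by (simp add: lie_k_sg V_sg matrix_vector_nth) (metis (mono_tags, lifting) mult_eq_0_iff sum.neutral)

lemma space_s_vec: "x \<in> space_s \<Longrightarrow> v \<in> V s \<Longrightarrow> x *v v \<in> V (flip_sign s)"
proof -
  assume x: "x \<in> space_s" and v: "v \<in> V s"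
  have "x $ i $ k * v $ k = 0" if "sg i \<noteq> flip_sign s" for i k
    using x v that by (cases s; cases "sg i"; cases "sg k") (auto simp: space_s_sg V_sg)
  then show "x *v v \<in> V (flip_sign s)" by (auto simp: V_sg matrix_vector_nth intro!: sum.neutral)
qed

lemma axis_mem_V: "axis j 1 \<in> V s \<longleftrightarrow> sg j = s"
  by (auto simp: V_sg axis_def)

lemma matrix_vector_axis: "((x :: complex^'m^'k) *v axis j 1) $ i = x $ i $ j"
  by (simp add: matrix_vector_nth axis_def if_distrib cong: if_cong)

lemma subspace_V: "vec.subspace (V s)"
  by (rule vec.subspaceI) (auto simp: V_sg)

text \<open>A block diagonal matrix maps each \<open>V s\<close> into itself; invertibility makes
  the dimensions equal and hence the image all of \<open>V s\<close>.\<close>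

lemma K_iff: "(g :: ('n::finite) bmat) \<in> K \<longleftrightarrow> invertible g \<and> g \<in> lie_k"
proof
  assume g: "g \<in> K"
  have "g $ i $ j = 0" if "sg i \<noteq> sg j" for i j
  proof -
    have "g *v axis j 1 \<in> V (sg j)" using g axis_mem_V[of j "sg j"] unfolding K_def by blast
    then show ?thesis using that by (auto simp: V_sg matrix_vector_axis)
  qed
  then show "invertible g \<and> g \<in> lie_k" using g by (auto simp: K_def lie_k_sg)
next
  assume g: "invertible g \<and> g \<in> lie_k"
  have "(*v) g ` V s = V s" for s
  proof (rule vec.subspace_dim_equal)
    show "vec.subspace ((*v) g ` V s)"
      by (intro vec.subspace_image subspace_V matrix_vector_mul_linear_gen)
    show "(*v) g ` V s \<subseteq> V s" using g lie_k_vec by blast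
    have "inj ((*v) g)" using g by (metis invertible_left_inverse matrix_left_invertible_injective)
    then have "vec.dim ((*v) g ` V s) = vec.dim (V s :: 'n bvec set)"
      using vec.dim_image_eq[OF matrix_vector_mul_linear_gen inj_on_subset[OF _ subset_UNIV]] by blast
    then show "vec.dim (V s :: 'n bvec set) \<le> vec.dim ((*v) g ` V s)" by simp
  qed (rule subspace_V)
  then show "g \<in> K" using g by (simp add: K_def)
qed

lemma K_invertible: "g \<in> K \<Longrightarrow> invertible g"
  by (simp add: K_iff)

lemma K_inv: 
  assumes "g \<in> K"
  shows "matrix_inv g \<in> K"
proof -
  have inv: "invertible g" and im: "\<And>s. (*v) g ` V s = V s" using assms by (auto simp: K_def)
  have "(*v) (matrix_inv g) ` V s = V s" for s
  proof -
    have "(*v) (matrix_inv g) ` V s = (*v) (matrix_inv g) ` (*v) g ` V s" by (simp add: im)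
    then show ?thesis using inv by (simp add: image_image matrix_vector_mul_assoc matrix_inv_mul)
  qed
  then show ?thesis using inv by (simp add: K_def invertible_matrix_inv)
qed

lemma K_mult: "g \<in> K \<Longrightarrow> h \<in> K \<Longrightarrow> g ** h \<in> K"
  by (simp add: K_iff lie_k_mult invertible_mult)

lemma K_1: "mat 1 \<in> K"
  by (auto simp: K_iff lie_k_sg mat_1_nth invertible_def)

lemma conj_by_lie_k: "g \<in> K \<Longrightarrow> x \<in> lie_k \<Longrightarrow> conj_by g x \<in> lie_k"
  and conj_by_space_s: "g \<in> K \<Longrightarrow> x \<in> space_s \<Longrightarrow> conj_by g x \<in> space_s"
  using K_inv[of g] by (simp_all add: conj_by_def K_iff lie_k_mult lie_k_space_s_mult)

lemma diag_part_conj_by: "g \<in> K \<Longrightarrow> diag_part (conj_by g x) = conj_by g (diag_part x)"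
  and offdiag_part_conj_by: "g \<in> K \<Longrightarrow> offdiag_part (conj_by g x) = conj_by g (offdiag_part x)"
  using diag_offdiag_unique[of "conj_by g (diag_part x)" "conj_by g (offdiag_part x)"]
  by (simp_all add: conj_by_lie_k conj_by_space_s conj_by_add[symmetric] diag_offdiag[symmetric])

subsection \<open>Matrices lowering a level function\<close>

text \<open>Column \<open>j\<close> is the image of the basis vector at \<open>j\<close>, so
  \<open>x\<close> moves it to levels at least \<open>d\<close> lower. The inequality is additive to
  avoid truncated subtraction.\<close>

definition lowers :: "('m \<Rightarrow> nat) \<Rightarrow> nat \<Rightarrow> complex^'m^'m \<Rightarrow> bool" where
  "lowers lev d x \<longleftrightarrow> (\<forall>i j. x $ i $ j \<noteq> 0 \<longrightarrow> lev i + d \<le> lev j)"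

lemma lowersD: "lowers lev d x \<Longrightarrow> x $ i $ j \<noteq> 0 \<Longrightarrow> lev i + d \<le> lev j"
  by (simp add: lowers_def)

lemma lowers_mono: "lowers lev d x \<Longrightarrow> d' \<le> d \<Longrightarrow> lowers lev d' x"
  unfolding lowers_def by (meson add_left_mono le_trans)

lemma lowers_mult:
  assumes "lowers lev d x" "lowers lev e y"
  shows "lowers lev (d + e) (x ** y)"
  unfolding lowers_def
proof (intro allI impI)
  fix i j assume "(x ** y) $ i $ j \<noteq> 0"
  then obtain k where "x $ i $ k * y $ k $ j \<noteq> 0" unfolding matrix_mult_nth
    by (meson sum.not_neutral_contains_not_neutral)
  then have "lev i + d \<le> lev k" "lev k + e \<le> lev j" using assms by (auto simp: lowers_def)
  then show "lev i + (d + e) \<le> lev j" by simp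
qed

lemma lowers_mpow: "lowers lev d x \<Longrightarrow> lowers lev (k * d) (mpow x k)"
proof (induction k)
  case 0
  then show ?case by (simp add: lowers_def mat_1_nth)
next
  case (Suc k)
  then show ?case using lowers_mult[of lev d x "k * d" "mpow x k"] by (simp add: mpow_Suc)
qed

lemma lowers_mpow_1: "lowers lev 1 x \<Longrightarrow> lowers lev k (mpow x k)"
  using lowers_mpow[of lev 1 x k] by simp

lemma lowers_eq_0:
  assumes "lowers lev d x" "\<And>j. lev j < d"
  shows "x = 0"
  using assms unfolding lowers_def by (metis add_leD2 not_le vec_eq_iff zero_index)

lemma lowers_nilpotent: 
  fixes x :: "complex^('m::finite)^'m"
  assumes "lowers lev 1 x"
  shows "nilpotent_matrix x"
proof -
  have "lev j < Suc (Max (range lev))" for j by (simp add: less_Suc_eq_le)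
  then have "mpow x (Suc (Max (range lev))) = 0" using lowers_eq_0 lowers_mpow_1[OF assms] by blast
  then show ?thesis unfolding nilpotent_matrix_mpow by blast
qed

text \<open>In the support of a nonzero kernel vector take an index of maximal level: in its row
  only the diagonal term survives.\<close>

lemma triangular_invertible:
  fixes m :: "complex^('m::finite)^'m"
  assumes diag: "\<And>i. m $ i $ i \<noteq> 0" and tri: "\<And>i j. m $ i $ j \<noteq> 0 \<Longrightarrow> i \<noteq> j \<Longrightarrow> (lev i :: nat) < lev j"
  shows "invertible m"
proof -
  have "v = 0" if "m *v v = 0" for v
  proof (rule ccontr)
    assume "v \<noteq> 0"
    then have ne: "{i. v $ i \<noteq> 0} \<noteq> {}" by (auto simp: vec_eq_iff)
    obtain i where i: "v $ i \<noteq> 0" "\<And>j. v $ j \<noteq> 0 \<Longrightarrow> lev j \<le> lev i"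
    proof -
      have "Max (lev ` {i. v $ i \<noteq> 0}) \<in> lev ` {i. v $ i \<noteq> 0}" using ne by (intro Max_in) auto
      then obtain i where "v $ i \<noteq> 0" "lev i = Max (lev ` {i. v $ i \<noteq> 0})" by auto
      then show ?thesis by (intro that[of i]) (auto intro!: Max_ge)
    qed
    have "(m *v v) $ i = (\<Sum>k\<in>{i}. m $ i $ k * v $ k)"
      unfolding matrix_vector_nth
    proof (rule sum.mono_neutral_right)
      show "\<forall>k\<in>UNIV - {i}. m $ i $ k * v $ k = 0" using tri i(2)
        by (metis DiffD2 insertCI leD mult_eq_0_iff)
    qed auto
    then show False using that diag i by simp
  qed
  then show ?thesis by (metis invertible_left_inverse matrix_left_invertible_ker)
qed

subsection \<open>Flags adapted to a nilpotent matrix\<close>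

text \<open>Among \<open>u\<close>, \<open>x u\<close>, \<open>x^2 u\<close>, ... take the vector
  just before the first one that lies in \<open>S\<close>.\<close>

lemma nilpotent_step:
  assumes S: "vec.subspace S" and sub: "S \<subset> T" and T:
    "\<And>v. v \<in> T \<Longrightarrow> x *v v \<in> T" and nil: "nilpotent_matrix x"
  shows "\<exists>v\<in>T. v \<notin> S \<and> x *v v \<in> S"
proof -
  obtain u where u: "u \<in> T" "u \<notin> S" using sub by blast
  obtain k where "mpow x k = 0" using nil nilpotent_matrix_mpow by blast
  then have ex: "\<exists>k. mpow x k *v u \<in> S" using vec.subspace_0[OF S] by (intro exI[of _ k]) simp
  define l where "l = (LEAST k. mpow x k *v u \<in> S)"
  have l: "mpow x l *v u \<in> S" unfolding l_def using ex by (rule LeastI_ex)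
  then obtain m where m: "l = Suc m" using u(2) by (cases l) auto
  have notin: "mpow x m *v u \<notin> S" using not_less_Least[of m "\<lambda>k. mpow x k *v u \<in> S"] m
    by (simp add: l_def)
  have "mpow x k *v u \<in> T" for k
    using u(1) T by (induction k) (simp_all add: mpow_Suc matrix_vector_mul_assoc[symmetric])
  then show ?thesis using notin l m
    by (intro bexI[of _ "mpow x m *v u"]) (auto simp: mpow_Suc matrix_vector_mul_assoc)
qed

text \<open>Adjoin the vector of \<open>nilpotent_step\<close> again and again. The enlarged space
  is mapped into the old one, which gives both the lowering property and the invariance required for
  the next step.\<close>

lemma nilpotent_flag:
  fixes x :: "complex^('m::finite)^'m"
  assumes T: "vec.subspace T" "\<And>v. v \<in> T \<Longrightarrow> x *v v \<in> T" and nil: "nilpotent_matrix x"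
    and S: "vec.subspace S" "S \<subseteq> T" "\<And>v. v \<in> S \<Longrightarrow> x *v v \<in> S" and d: "vec.dim T = vec.dim S + d"
  shows "\<exists>A. A 0 = S \<and> A d = T \<and> (\<forall>i\<le>d. vec.subspace (A i) \<and> vec.dim (A i) = vec.dim S + i \<and> A i \<subseteq> T) \<and>
    (\<forall>i<d. A i \<subseteq> A (Suc i) \<and> (\<forall>v\<in>A (Suc i). x *v v \<in> A i))"
  using S d
proof (induction d arbitrary: S)
  case 0
  have "S = T" using vec.subspace_dim_equal[of S T] T 0 by simp
  then show ?case using T(1) by (intro exI[of _ "\<lambda>_. S"]) auto
next
  case (Suc d)
  have "S \<noteq> T" using Suc.prems(4) by auto
  then have "S \<subset> T" using Suc.prems(2) by auto
  from nilpotent_step[OF Suc.prems(1) this T(2) nil]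
  obtain v where v: "v \<in> T" "v \<notin> S" "x *v v \<in> S" by auto
  define S' where "S' = vec.span (insert v S)"
  have spanS: "vec.span S = S" using Suc.prems(1) by (simp add: vec.span_eq_iff)
  have S': "vec.subspace S'" "S \<subseteq> S'" by (auto simp: S'_def intro: vec.span_base)
  have dimS': "vec.dim S' = Suc (vec.dim S)" using v(2) by (simp add: S'_def vec.dim_insert spanS)
  have xS': "x *v u \<in> S" if u: "u \<in> S'" for u
  proof -
    obtain c where "u - c *s v \<in> S" using u unfolding S'_def vec.span_insert spanS by blast
    then have "x *v (u - c *s v) + c *s (x *v v) \<in> S"
      using Suc.prems v by (intro vec.subspace_add vec.subspace_scale) auto
    moreover have "x *v (u - c *s v) + c *s (x *v v) = x *v u"
      by (simp add: matrix_vector_mult_diff_distrib vector_scalar_commute)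
    ultimately show ?thesis by simp
  qed
  have "S' \<subseteq> T" unfolding S'_def using v Suc.prems T by (intro vec.span_minimal) auto
  have "x *v u \<in> S'" if "u \<in> S'" for u using xS'[OF that] S'(2) by auto
  then obtain A where A: "A 0 = S'" "A d = T" "\<forall>i\<le>d. vec.subspace (A i) \<and>
    vec.dim (A i) = vec.dim S' + i \<and> A i \<subseteq> T"
      "\<forall>i<d. A i \<subseteq> A (Suc i) \<and> (\<forall>v\<in>A (Suc i). x *v v \<in> A i)"
    using Suc.IH[OF S'(1) \<open>S' \<subseteq> T\<close>] S' xS' dimS' Suc.prems(4) by auto
  define B where "B = case_nat S A"
  have "B 0 = S" "B (Suc d) = T" using A by (simp_all add: B_def)
  moreover have "vec.subspace (B i) \<and> vec.dim (B i) = vec.dim S + i \<and> B i \<subseteq> T" if "i \<le> Suc d" for i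
    using that A(3) Suc.prems dimS' by (cases i) (auto simp: B_def)
  moreover have "B i \<subseteq> B (Suc i) \<and> (\<forall>v\<in>B (Suc i). x *v v \<in> B i)" if "i < Suc d" for i
    using that A(1,4) S' xS' by (cases i) (auto simp: B_def)
  ultimately show ?case by blast
qed

text \<open>A uniform exponent turns nilpotency into polynomial equations, so that the nilpotent
  cones are closed.\<close>

lemma nilpotent_mpow_card:
  fixes x :: "complex^('m::finite)^'m"
  assumes "nilpotent_matrix x"
  shows "mpow x CARD('m) = 0"
proof -
  have "vec.dim (UNIV :: (complex^'m) set) = vec.dim {0 :: complex^'m} + CARD('m)"
    by (simp add: card_cart_basis)
  from nilpotent_flag[OF vec.subspace_UNIV _ assms vec.subspace_single_0 _ _ this]
  obtain A :: "nat \<Rightarrow> (complex^'m) set" where A: "A 0 = {0}" "A CARD('m) = UNIV"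
      "\<forall>i<CARD('m). \<forall>v\<in>A (Suc i). x *v v \<in> A i" by auto
  have "mpow x k *v v \<in> A (CARD('m) - k)" if "k \<le> CARD('m)" for k v
    using that
  proof (induction k)
    case 0
    then show ?case using A(2) by simp
  next
    case (Suc k)
    moreover have "CARD('m) - k = Suc (CARD('m) - Suc k)" using Suc by simp
    ultimately show ?case using A(3) by (simp add: mpow_Suc matrix_vector_mul_assoc[symmetric])
  qed
  from this[of "CARD('m)"] have "mpow x CARD('m) *v v = 0" for v using A(1) by simp
  then show ?thesis by (simp add: matrix_eq)
qed

subsection \<open>Adapted bases\<close>

lemma rank_nullity:
  fixes m :: "complex^('a::finite)^('b::finite)"
  assumes W: "vec.subspace W"
  shows "vec.dim W = vec.dim ((*v) m ` W) + vec.dim {w \<in> W. m *v w = 0}"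
proof -
  let ?N = "{w \<in> W. m *v w = 0}"
  have lin: "Vector_Spaces.linear (*s) (*s) ((*v) m)" by (rule matrix_vector_mul_linear_gen)
  have N: "vec.subspace ?N"
    using W by (auto simp: vec.subspace_def matrix_vector_right_distrib vector_scalar_commute)
  obtain B where B: "B \<subseteq> ?N" "vec.independent B" "?N \<subseteq> vec.span B" "card B = vec.dim ?N"
    using vec.basis_exists[of ?N] by blast
  obtain B' where B': "B \<subseteq> B'" "B' \<subseteq> W" "vec.independent B'" "W \<subseteq> vec.span B'"
    using vec.maximal_independent_subset_extend[of B W] B by blast
  have fin: "finite B'" using B'(3) vec.finiteI_independent by blast
  define C where "C = B' - B"
  have spanB: "vec.span B = ?N" using B(1,3) N by (metis subset_antisym vec.span_minimal)
  have spanB': "vec.span B' = W" using B'(2,4) W by (metis subset_antisym vec.span_minimal)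
  have C: "vec.independent C" unfolding C_def using B'(3) by (rule vec.independent_mono) auto
  have inj: "inj_on ((*v) m) (vec.span C)"
  proof (rule inj_onI)
    fix u v assume uv: "u \<in> vec.span C" "v \<in> vec.span C" "m *v u = m *v v"
    have "vec.span C \<subseteq> W" using spanB' vec.span_mono[of C B'] by (auto simp: C_def)
    then have "u - v \<in> ?N" using uv vec.subspace_diff[OF W]
      by (auto simp: matrix_vector_mult_diff_distrib)
    then have "u - v \<in> vec.span B" using spanB by simp
    moreover have "u - v \<in> vec.span C" using uv by (simp add: vec.span_diff)
    \<comment> \<open>A vector in both spans has the same coordinates over \<open>B\<close> and over
      \<open>C\<close>; as these sets are disjoint, all coordinates vanish.\<close>
    ultimately have "vec.representation B (u - v) = vec.representation C (u - v)"
      using vec.representation_extend[OF B'(3), of "u - v"] B'(1) by (metis C_def Diff_subset)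
    then have "vec.representation B (u - v) b = 0" for b
      using vec.representation_ne_zero[of B "u - v" b] vec.representation_ne_zero[of C "u - v" b]
      by (auto simp: C_def)
    then have "u - v = 0"
      using vec.sum_nonzero_representation_eq[OF B(2) \<open>u - v \<in> vec.span B\<close>] by simp
    then show "u = v" by simp
  qed
  have "(*v) m ` W = vec.span ((*v) m ` B')" using spanB' vec.linear_span_image[OF lin, of B'] by simp
  also have "\<dots> = vec.span ((*v) m ` C)"
  proof (rule vec.span_eq[THEN iffD2], intro conjI image_subsetI)
    fix b assume b: "b \<in> B'"
    show "m *v b \<in> vec.span ((*v) m ` C)"
    proof (cases "b \<in> B")
      case True
      then have "m *v b = 0" using B(1) by auto
      then show ?thesis by (simp add: vec.span_zero)
    next
      case False
      then show ?thesis using b by (auto simp: C_def intro: vec.span_base)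
    qed
  next
    fix b assume "b \<in> C"
    then show "m *v b \<in> vec.span ((*v) m ` B')" by (auto simp: C_def intro: vec.span_base)
  qed
  finally have "vec.dim ((*v) m ` W) = vec.dim ((*v) m ` C)" by (simp add: vec.dim_span)
  also have "\<dots> = vec.dim C" using vec.dim_image_eq[OF lin inj] .
  also have "\<dots> = card C" using C by (rule vec.dim_eq_card_independent)
  finally have "vec.dim ((*v) m ` W) = card B' - card B"
    using B'(1) fin by (simp add: C_def card_Diff_subset finite_subset)
  moreover have "card B \<le> card B'" using B'(1) fin by (rule card_mono[rotated])
  moreover have "card B' = vec.dim W" using B'(3) spanB'
    by (metis vec.dim_eq_card_independent vec.dim_span)
  ultimately show ?thesis using B(4) by simp
qed

lemma flag_between:
  fixes S :: "(complex^('m::finite)) set"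
  assumes "vec.subspace S" "vec.subspace T" "S \<subseteq> T" "vec.dim T = vec.dim S + d"
  shows "\<exists>A. A 0 = S \<and> A d = T \<and> (\<forall>i\<le>d. vec.subspace (A i) \<and> vec.dim (A i) = vec.dim S + i) \<and>
    (\<forall>i<d. A i \<subseteq> A (Suc i))"
proof -
  have "nilpotent_matrix (0 :: complex^'m^'m)" unfolding nilpotent_matrix_mpow
    by (rule exI[of _ 1]) simp
  then have "\<exists>A. A 0 = S \<and> A d = T \<and> (\<forall>i\<le>d. vec.subspace (A i) \<and> vec.dim (A i) = vec.dim S + i \<and>
    A i \<subseteq> T) \<and>
    (\<forall>i<d. A i \<subseteq> A (Suc i) \<and> (\<forall>v\<in>A (Suc i). 0 *v v \<in> A i))"
    using assms vec.subspace_0[OF assms(1)] vec.subspace_0[OF assms(2)] by (intro nilpotent_flag) auto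
  then obtain A where "A 0 = S" "A d = T" "\<forall>i\<le>d. vec.subspace (A i) \<and>
    vec.dim (A i) = vec.dim S + i \<and> A i \<subseteq> T"
    "\<forall>i<d. A i \<subseteq> A (Suc i) \<and> (\<forall>v\<in>A (Suc i). 0 *v v \<in> A i)" by (elim exE conjE)
  then show ?thesis by (intro exI[of _ A]) simp
qed

lemma complete_flag_basis:
  fixes A :: "nat \<Rightarrow> (complex^('m::finite)) set"
  assumes "A 0 = {0}" "\<And>i. i \<le> m \<Longrightarrow> vec.subspace (A i) \<and> vec.dim (A i) = i" "\<And>i. i < m \<Longrightarrow> A i \<subseteq> A (Suc i)"
  shows "\<exists>a. \<forall>k\<le>m. A k = vec.span (a ` {..<k})"
proof -
  have "\<exists>v. v \<in> A (Suc k) \<and> v \<notin> A k" if "k < m" for k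
  proof -
    have "A k \<noteq> A (Suc k)" using assms(2)[of k] assms(2)[of "Suc k"] that by auto
    then show ?thesis using assms(3)[OF that] by auto
  qed
  then have "\<forall>k. \<exists>v. k < m \<longrightarrow> v \<in> A (Suc k) \<and> v \<notin> A k" by blast
  from choice[OF this] obtain a where a: "\<And>k. k < m \<Longrightarrow> a k \<in> A (Suc k) \<and> a k \<notin> A k" by blast
  have "A k = vec.span (a ` {..<k})" if "k \<le> m" for k
    using that
  proof (induction k)
    case 0
    then show ?case using assms(1) by simp
  next
    case (Suc k)
    have k: "k < m" using Suc.prems by simp
    have Ak: "vec.span (a ` {..<k}) = A k" using Suc by simp
    have im: "a ` {..<Suc k} = insert (a k) (a ` {..<k})" by (auto simp: less_Suc_eq)
    have sub: "vec.span (a ` {..<Suc k}) \<subseteq> A (Suc k)"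
    proof (rule vec.span_minimal)
      show "a ` {..<Suc k} \<subseteq> A (Suc k)"
        unfolding im using a[OF k] assms(3)[OF k] Ak vec.span_superset[of "a ` {..<k}"] by auto
    qed (use assms(2) Suc.prems in auto)
    have "vec.dim (vec.span (a ` {..<Suc k})) = Suc (vec.dim (a ` {..<k}))"
      unfolding im using a[OF k] Ak by (simp add: vec.dim_insert vec.dim_span)
    also have "vec.dim (a ` {..<k}) = k" using Ak assms(2)[of k] k by (metis less_imp_le vec.dim_span)
    finally have "vec.dim (A (Suc k)) \<le> vec.dim (vec.span (a ` {..<Suc k}))"
      using assms(2) Suc.prems by simp
    then show ?case using vec.subspace_dim_equal[OF vec.subspace_span _ sub] assms(2) Suc.prems by metis
  qed
  then show ?thesis by blast
qed

text \<open>The partial flag is padded to a complete one, with a flag of \<open>F 0\<close> below it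
  and a flag from \<open>F r\<close> to \<open>T\<close> above it.\<close>

lemma adapted_basis:
  fixes F :: "nat \<Rightarrow> (complex^('m::finite)) set"
  assumes F: "\<And>i. i \<le> r \<Longrightarrow> vec.subspace (F i) \<and> vec.dim (F i) = p + i" "\<And>i. i < r \<Longrightarrow> F i \<subseteq> F (Suc i)"
    and T: "vec.subspace T" "vec.dim T = m" "F r \<subseteq> T"
  shows "\<exists>a. (\<forall>i\<le>r. F i = vec.span (a ` {..<p + i})) \<and> T = vec.span (a ` {..<m})"
proof -
  have le: "p + r \<le> m" using F(1)[of r] T vec.dim_subset[of "F r" T] by simp
  obtain A1 where A1: "A1 0 = {0}" "A1 p = F 0" "\<And>i. i \<le> p \<Longrightarrow> vec.subspace (A1 i) \<and> vec.dim (A1 i) = i"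
      "\<And>i. i < p \<Longrightarrow> A1 i \<subseteq> A1 (Suc i)"
    using flag_between[of "{0}" "F 0" p] F(1)[of 0] vec.subspace_0[of "F 0"] by auto
  obtain A2 where A2: "A2 0 = F r" "A2 (m - p - r) = T"
      "\<And>i. i \<le> m - p - r \<Longrightarrow> vec.subspace (A2 i) \<and> vec.dim (A2 i) = p + r + i"
      "\<And>i. i < m - p - r \<Longrightarrow> A2 i \<subseteq> A2 (Suc i)"
    using flag_between[of "F r" T "m - p - r"] F(1)[of r] T le by auto
  define A where "A k = (if k \<le> p then A1 k else if k \<le> p + r then F (k - p) else A2 (k - p - r))" for k
  have AF: "A (p + i) = F i" if "i \<le> r" for i using that A1(2) by (cases i) (auto simp: A_def)
  have A2A: "A (p + r + i) = A2 i" for i using AF[of r] A2(1) by (cases i) (auto simp: A_def)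
  have "A 0 = {0}" by (simp add: A_def A1)
  moreover have "vec.subspace (A i) \<and> vec.dim (A i) = i" if "i \<le> m" for i
  proof (cases "i \<le> p + r")
    case True
    then show ?thesis using A1(3)[of i] F(1)[of "i - p"] by (auto simp: A_def)
  next
    case False
    then show ?thesis using A2(3)[of "i - p - r"] that by (auto simp: A_def)
  qed
  moreover have "A i \<subseteq> A (Suc i)" if "i < m" for i
  proof -
    consider "i < p" | "p \<le> i" "i < p + r" | "p + r \<le> i" by linarith
    then show ?thesis
    proof cases
      case 1
      then show ?thesis using A1(4) by (simp add: A_def)
    next
      case 2
      then show ?thesis using F(2)[of "i - p"] AF[of "i - p"] AF[of "Suc (i - p)"] by auto
    next
      case 3
      then show ?thesis using A2(4)[of "i - p - r"] A2A[of "i - p - r"] A2A[of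
        "Suc (i - p - r)"] that by auto
    qed
  qed
  ultimately obtain a where a: "\<And>k. k \<le> m \<Longrightarrow> A k = vec.span (a ` {..<k})"
    using complete_flag_basis[of A m] by auto
  have "F i = vec.span (a ` {..<p + i})" if "i \<le> r" for i using AF[OF that] a[of "p + i"] that le
    by simp
  moreover have "T = vec.span (a ` {..<m})" using a[of m] A2A[of "m - p - r"] A2(2) le by simp
  ultimately show ?thesis by blast
qed

lemma basis_matrix:
  fixes c :: "'m::finite \<Rightarrow> complex^'m"
  assumes "vec.span (range c) = UNIV"
  obtains g where "invertible g" "\<And>j. g *v axis j 1 = c j"
proof -
  define g where "g = (\<chi> i j. c j $ i)"
  have col: "column j g = c j" for j by (simp add: column_def g_def vec_eq_iff)
  have "columns g = range c" using col by (auto simp: columns_def)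
  then have "invertible g" using assms matrix_right_invertible_span_columns[of g]
    invertible_right_inverse by metis
  moreover have "g *v axis j 1 = c j" for j
    by (simp add: vec_eq_iff matrix_vector_axis g_def)
  ultimately show ?thesis by (rule that)
qed

text \<open>The entry at \<open>(i, j)\<close> is the coefficient of \<open>c i\<close> in
  \<open>z *v c j\<close>.\<close>

lemma basis_matrix_coord:
  fixes g :: "complex^('m::finite)^'m"
  assumes g: "invertible g" "\<And>j. g *v axis j 1 = c j" and "z *v c j \<in> vec.span (c ` I)" "i \<notin> I"
  shows "(matrix_inv g ** z ** g) $ i $ j = 0"
proof -
  have inv: "matrix_inv g *v c j = axis j 1" for j
    using g by (metis matrix_inv_mul(1) matrix_vector_mul_assoc matrix_vector_mul_lid)
  have "matrix_inv g *v v \<in> {u. u $ i = 0}" if "v \<in> vec.span (c ` I)" for v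
  proof -
    have "vec.span (c ` I) \<subseteq> {v. (matrix_inv g *v v) $ i = 0}"
    proof (rule vec.span_minimal)
      show "c ` I \<subseteq> {v. (matrix_inv g *v v) $ i = 0}" using assms(4) by (auto simp: inv axis_def)
      show "vec.subspace {v. (matrix_inv g *v v) $ i = 0}"
        by (auto simp: vec.subspace_def matrix_vector_right_distrib vector_scalar_commute)
    qed
    then show ?thesis using that by auto
  qed
  from this[OF assms(3)] have "(matrix_inv g *v (z *v (g *v axis j 1))) $ i = 0" using g by simp
  then show ?thesis by (simp only: matrix_vector_mul_assoc matrix_vector_axis matrix_mul_assoc)
qed

lemma V_sum: "v = (\<chi> i. if sg i = Plus then v $ i else 0) + (\<chi> i. if sg i
  = Minus then v $ i else (0 :: complex))"
  by (simp add: vec_eq_iff) (metis sign.exhaust sign.distinct(1))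

lemma card_sg: "card {j :: ('n::finite) + 'n. sg j = s} = CARD('n)"
proof -
  have "{j :: 'n + 'n. sg j = s} = (if s = Plus then range Inl else range Inr)"
  proof (intro set_eqI)
    fix i :: "'n + 'n"
    show "i \<in> {j. sg j = s} \<longleftrightarrow> i \<in> (if s = Plus then range Inl else range Inr)"
      by (cases i; cases s) auto
  qed
  also have "card \<dots> = CARD('n)" by (auto simp: card_image)
  finally show ?thesis .
qed

lemma dim_V: "vec.dim (V s :: ('n::finite) bvec set) = CARD('n)"
proof -
  have "V s = {v :: 'n bvec. \<forall>i. i \<notin> {i. sg i = s} \<longrightarrow> v $ i = 0}" by (auto simp: V_sg)
  then show ?thesis by (simp only: dim_substandard_cart card_sg)
qed

text \<open>Translates inclusions between flags into vanishing matrix entries. Each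
  \<open>V s\<close> is spanned by as many vectors as its dimension, so together they form a basis,
  and its compatibility with the signs puts the base change into \<open>K\<close>.\<close>

lemma graded_basis:
  fixes a :: "sign \<Rightarrow> nat \<Rightarrow> ('n::finite) bvec"
  assumes a: "\<And>s. V s = vec.span (a s ` {..<CARD('n)})"
  shows "\<exists>g\<in>K. (\<forall>j. g *v axis j 1 = a (sg j) (num j)) \<and>
    (\<forall>z i j l t. z *v a (sg j) (num j) \<in> vec.span (a t ` {..<l}) \<longrightarrow> l \<le> CARD('n) \<longrightarrow>
       conj_by (matrix_inv g) z $ i $ j \<noteq> 0 \<longrightarrow> sg i = t \<and> num i < l)"
proof -
  define c where "c j = a (sg j) (num j)" for j :: "'n + 'n"
  have aV: "a s k \<in> V s" if "k < CARD('n)" for s k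
    using a[of s] that vec.span_base[of "a s k" "a s ` {..<CARD('n)}"] by auto
  have im: "a t ` {..<l} = c ` {j. sg j = t \<and> num j < l}" if "l \<le> CARD('n)" for t l
  proof -
    have "a t k \<in> c ` {j. sg j = t \<and> num j < l}" if "k < l" for k
      using that \<open>l \<le> CARD('n)\<close> idx[of k t, where 'n = 'n]
        by (intro image_eqI[of _ _ "idx t k"]) (auto simp: c_def)
    then show ?thesis by (auto simp: c_def)
  qed
  have "v \<in> vec.span (range c)" for v
  proof -
    have "V s \<subseteq> vec.span (range c)" for s 
      using a[of s] im[of "CARD('n)" s] vec.span_mono[of "c ` {j. sg j = s \<and>
        num j < CARD('n)}" "range c"] by auto
    moreover have "(\<chi> i. if sg i = Plus then v $ i else 0) \<in> V Plus"
      "(\<chi> i. if sg i = Minus then v $ i else 0) \<in> V Minus"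
      by (auto simp: V_sg)
    ultimately have "(\<chi> i. if sg i = Plus then v $ i else 0) + (\<chi> i. if sg i = Minus then v $ i else 0)
      \<in> vec.span (range c)" by (intro vec.span_add) blast+
    then show ?thesis using V_sum[of v] by simp
  qed
  then have "vec.span (range c) = UNIV" by auto
  then obtain g where g: "invertible g" "\<And>j. g *v axis j 1 = c j" using basis_matrix by blast
  have "g \<in> lie_k" unfolding lie_k_sg
  proof (intro CollectI allI impI)
    fix i j :: "'n + 'n" assume "sg i \<noteq> sg j"
    moreover have "g *v axis j 1 \<in> V (sg j)" using g(2)[of j] aV[OF num_less[of j]] by (simp add: c_def)
    ultimately have "(g *v axis j 1) $ i = 0" by (simp add: V_sg)
    then show "g $ i $ j = 0" by (simp add: matrix_vector_axis)
  qed
  then have "g \<in> K" using g(1) by (simp add: K_iff)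
  moreover have "sg i = t \<and> num i < l"
    if "z *v a (sg j) (num j) \<in> vec.span (a t ` {..<l})" "l \<le> CARD('n)"
      "conj_by (matrix_inv g) z $ i $ j \<noteq> 0" for z i j l t
    using basis_matrix_coord[OF g, of z j "{j. sg j = t \<and>
      num j < l}" i] that im[OF that(2)] matrix_inv_inv[OF g(1)]
    by (auto simp: conj_by_def c_def)
  ultimately show ?thesis using g(2) unfolding c_def by blast
qed

lemma nilpotent_lie_k_triangular:
  fixes z :: "('n::finite) bmat"
  assumes z: "z \<in> lie_k" "nilpotent_matrix z"
  obtains g where "g \<in> K" "conj_by (matrix_inv g) z \<in> lie_k" "lowers num 1 (conj_by (matrix_inv g) z)"
proof -
  have "\<exists>a. V s = vec.span (a ` {..<CARD('n)}) \<and> (\<forall>k<CARD('n). z *v a k \<in> vec.span (a ` {..<k}))" for s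
  proof -
    have "vec.dim (V s :: 'n bvec set) = vec.dim {0 :: 'n bvec} + CARD('n)" by (simp add: dim_V)
    moreover have "0 \<in> (V s :: 'n bvec set)" using vec.subspace_0[OF subspace_V] .
    ultimately obtain A :: "nat \<Rightarrow> 'n bvec set"
      where A: "A 0 = {0}" "A CARD('n) = V s"
        "\<And>i. i \<le> CARD('n) \<Longrightarrow> vec.subspace (A i) \<and> vec.dim (A i) = i"
       "\<And>i. i < CARD('n) \<Longrightarrow> A i \<subseteq> A (Suc i)" "\<And>i v. i < CARD('n) \<Longrightarrow> v \<in> A (Suc i) \<Longrightarrow> z *v v \<in> A i"
      using nilpotent_flag[OF subspace_V lie_k_vec[OF z(1)] z(2) vec.subspace_single_0, of s
        "CARD('n)"] by auto
    obtain a where a: "\<And>k. k \<le> CARD('n) \<Longrightarrow> A k = vec.span (a ` {..<k})"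
      using complete_flag_basis[OF A(1,3,4)] by blast
    have "z *v a k \<in> vec.span (a ` {..<k})" if "k < CARD('n)" for k
      using A(5)[OF that, of "a k"] a[of k] a[of "Suc k"] that vec.span_base[of "a k"
        "a ` {..<Suc k}"] by auto
    then show ?thesis using a[of "CARD('n)"] A(2) by auto
  qed
  then obtain a where a: "\<And>s. V s = vec.span (a s ` {..<CARD('n)})"
    "\<And>s k. k < CARD('n) \<Longrightarrow> z *v a s k \<in> vec.span (a s ` {..<k})"
    by metis
  obtain g where g: "g \<in> K" and "\<And>j. g *v axis j 1 = a (sg j) (num j)"
    and co: "\<And>z i j l t. z *v a (sg j) (num j) \<in> vec.span (a t ` {..<l}) \<Longrightarrow> l \<le> CARD('n) \<Longrightarrow>
       conj_by (matrix_inv g) z $ i $ j \<noteq> 0 \<Longrightarrow> sg i = t \<and> num i < l"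
    using graded_basis[OF a(1)] by blast
  have "lowers num 1 (conj_by (matrix_inv g) z)"
    unfolding lowers_def
  proof (intro allI impI)
    fix i j assume "conj_by (matrix_inv g) z $ i $ j \<noteq> 0"
    from co[OF a(2)[OF num_less] _ this] num_less[of j] show "num i + 1 \<le> num j" by simp
  qed
  then show ?thesis using that[OF g] conj_by_lie_k[OF K_inv[OF g] z(1)] by blast
qed


subsection \<open>Nilradicals and Borel subalgebras\<close>

definition mat_unit :: "'m \<Rightarrow> 'm \<Rightarrow> complex^'m^'m" where
  "mat_unit a b = (\<chi> i j. if i = a \<and> j = b then 1 else 0)"

lemma mat_unit_nth: "mat_unit a b $ i $ j = (if i = a \<and> j = b then 1 else 0)"
  by (simp add: mat_unit_def)

lemma mat_unit_mult_left: "(mat_unit a b ** x) $ i $ j = (if i = a then x $ b $ j else 0)"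
  by (simp add: matrix_mult_nth mat_unit_nth if_distrib if_distribR cong: if_cong)

lemma mat_unit_mult_right: "(x ** mat_unit a b) $ i $ j = (if j = b then x $ i $ a else 0)"
  by (simp add: matrix_mult_nth mat_unit_nth if_distrib if_distribR cong: if_cong)

lemma csubspace_scale: "csubspace A \<Longrightarrow> x \<in> A \<Longrightarrow> (\<chi> i j. c * x $ i $ j) \<in> A"
  and csubspace_add: "csubspace A \<Longrightarrow> x \<in> A \<Longrightarrow> y \<in> A \<Longrightarrow> x + y \<in> A"
  and csubspace_0: "csubspace A \<Longrightarrow> 0 \<in> A"
  by (auto simp: csubspace_def)

lemma csubspace_diff: 
  assumes "csubspace A" "x \<in> A" "y \<in> A"
  shows "x - y \<in> A"
proof -
  have "x - y = x + (\<chi> i j. - 1 * y $ i $ j)" by (simp add: vec_eq_iff)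
  then show ?thesis using csubspace_add[OF assms(1,2) csubspace_scale[OF assms(1,3), of "- 1"]] by metis
qed

lemma csubspace_conj_by: "csubspace A \<Longrightarrow> csubspace (conj_by g ` (A :: ('n::finite) bmat set))"
  unfolding csubspace_def
  by (auto simp: conj_by_add[symmetric] conj_by_scale[symmetric] intro: rev_image_eqI[of 0])

lemma conj_by_bracket: "invertible g \<Longrightarrow>
  conj_by g (bracket x y) = bracket (conj_by g x) (conj_by g (y :: ('n::finite) bmat))"
  by (simp add: bracket_def conj_by_diff conj_by_mult)

lemma lie_ideal_conj_by:
  "invertible g \<Longrightarrow> lie_ideal I A \<Longrightarrow> lie_ideal (conj_by g ` I) (conj_by g ` (A :: ('n::finite) bmat set))"
  unfolding lie_ideal_def by (auto simp: csubspace_conj_by conj_by_bracket[symmetric])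

lemma nilrad_conj_by_mem:
  "invertible g \<Longrightarrow> x \<in> nilrad A \<Longrightarrow> conj_by g x \<in> nilrad (conj_by g ` (A :: ('n::finite) bmat set))"
proof -
  assume g: "invertible g" and "x \<in> nilrad A"
  then obtain I where "lie_ideal I A" "\<forall>x\<in>I. nilpotent_matrix x" "x \<in> I" unfolding nilrad_def by auto
  then show ?thesis unfolding nilrad_def using g
    by (intro UnionI[of "conj_by g ` I"]) (auto intro: lie_ideal_conj_by nilpotent_conj_by)
qed

lemma conj_by_image_inv: "invertible g \<Longrightarrow>
  conj_by (matrix_inv g) ` conj_by g ` A = (A :: ('n::finite) bmat set)"
  by (simp add: image_image conj_by_inv)

section \<open>The nilradical of a parabolic subalgebra and matrices of square zero\<close>

lemma nilpotent_eigenvalue: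
  assumes "nilpotent_matrix x" "x *v v = c *s v" "v \<noteq> 0"
  shows "c = 0"
proof -
  obtain k where k: "mpow x k = 0" using assms(1) nilpotent_matrix_mpow by blast
  have "mpow x k *v v = c ^ k *s v" for k
    by (induction k) (simp_all add: mpow_Suc matrix_vector_mul_assoc[symmetric]
      vector_scalar_commute assms(2) mult.commute)
  from this[of k] k assms(3) show ?thesis by auto
qed

lemma lie_P_S_iff: "(x :: ('n::finite) bmat) \<in> lie_P_S \<longleftrightarrow> (\<forall>i j. sg i = Minus \<longrightarrow> sg j
  = Plus \<longrightarrow> x $ i $ j = 0)"
proof
  assume x: "x \<in> lie_P_S"
  show "\<forall>i j. sg i = Minus \<longrightarrow> sg j = Plus \<longrightarrow> x $ i $ j = 0"
  proof (intro allI impI)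
    fix i j :: "'n + 'n" assume "sg i = Minus" "sg j = Plus"
    moreover from this have "x *v axis j 1 \<in> V Plus" using x axis_mem_V unfolding lie_P_S_def by blast
    ultimately have "(x *v axis j 1) $ i = 0" unfolding V_sg by simp
    then show "x $ i $ j = 0" by (simp add: matrix_vector_axis)
  qed
next
  assume x: "\<forall>i j. sg i = Minus \<longrightarrow> sg j = Plus \<longrightarrow> x $ i $ j = 0"
  have "x $ i $ k * v $ k = 0" if "v \<in> V Plus" "sg i \<noteq> Plus" for v i k
    using x that by (cases "sg i"; cases "sg k") (auto simp: V_sg)
  then show "x \<in> lie_P_S" unfolding lie_P_S_def V_sg[of Plus]
    by (auto simp: matrix_vector_nth intro!: sum.neutral)
qed

text \<open>For \<open>m = E\<^sub>j\<^sub>i\<close> in the ambient algebra, \<open>[m, [m, x]] = - 2 x\<^sub>i\<^sub>j E\<^sub>j\<^sub>i\<close>, and then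
  \<open>[E\<^sub>i\<^sub>j, E\<^sub>j\<^sub>i] = E\<^sub>i\<^sub>i - E\<^sub>j\<^sub>j\<close> would be a non-nilpotent element of the ideal.\<close>
lemma nilpotent_ideal_entry_zero:
  assumes I: "lie_ideal I A" "\<And>x. x \<in> I \<Longrightarrow> nilpotent_matrix x" and x: "x \<in> I"
    and units: "mat_unit i j \<in> A" "mat_unit j i \<in> A" and "i \<noteq> j"
  shows "x $ i $ j = 0"
proof (rule ccontr)
  assume nz: "x $ i $ j \<noteq> 0"
  let ?m = "mat_unit j i"
  have sub: "csubspace I" and br: "\<And>a b. a \<in> A \<Longrightarrow> b \<in> I \<Longrightarrow> bracket a b \<in> I"
    using I(1) by (auto simp: lie_ideal_def)
  have "bracket ?m (bracket ?m x) = (\<chi> a b. - 2 * x $ i $ j * mat_unit j i $ a $ b)"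
    using \<open>i \<noteq> j\<close>
    by (auto simp: bracket_def vec_eq_iff mat_unit_mult_left mat_unit_mult_right mat_unit_nth)
  moreover have "bracket ?m (bracket ?m x) \<in> I" using br units x by blast
  ultimately have "(\<chi> a b. (- 1 / (2 * x $ i $ j)) * (\<chi> a b. - 2 * x $ i $ j * mat_unit j i $ a $ b)
    $ a $ b) \<in> I"
    using csubspace_scale[OF sub] by metis
  also have "(\<chi> a b. (- 1 / (2 * x $ i $ j)) * (\<chi> a b. - 2 * x $ i $ j * mat_unit j i $ a $ b) $ a $
    b) = ?m"
    using nz by (simp add: vec_eq_iff)
  finally have "bracket (mat_unit i j) ?m \<in> I" using br units by blast
  then have "nilpotent_matrix (bracket (mat_unit i j) ?m)" by (rule I(2))
  moreover have "bracket (mat_unit i j) ?m *v axis i 1 = 1 *s axis i 1"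
    using \<open>i \<noteq> j\<close>
    by (auto simp: vec_eq_iff matrix_vector_axis bracket_def mat_unit_mult_left mat_unit_nth)
      (auto simp: axis_def)
  ultimately show False using nilpotent_eigenvalue[of _ "axis i 1" 1] by (auto simp: axis_eq_0_iff)
qed

text \<open>The off-diagonal entries of the two diagonal blocks vanish because both
  \<open>E_ij\<close> and \<open>E_ji\<close> lie in the parabolic. What is left is triangular, so
  nilpotency kills the diagonal.\<close>

lemma nilrad_lie_P_S: "nilrad (lie_P_S :: ('n::finite) bmat set) = {x. \<forall>i j. x $ i $ j \<noteq> 0 \<longrightarrow> sg i
  = Plus \<and> sg j = Minus}"
  (is "_ = ?N")
proof (intro equalityI subsetI)
  fix x :: "'n bmat" assume "x \<in> nilrad lie_P_S"
  then obtain I where I: "lie_ideal I lie_P_S" "\<And>x. x \<in> I \<Longrightarrow> nilpotent_matrix x" "x \<in> I"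
    unfolding nilrad_def by auto
  have low: "x $ i $ j = 0" if "sg i = Minus" "sg j = Plus" for i j
    using I(1,3) that lie_P_S_iff[of x] unfolding lie_ideal_def by blast
  have off: "x $ i $ j = 0" if "sg i = sg j" "i \<noteq> j" for i j
    by (rule nilpotent_ideal_entry_zero[OF I]) (use that in \<open>auto simp: lie_P_S_iff mat_unit_nth\<close>)
  \<comment> \<open>For sign \<open>Plus\<close> the column at \<open>i\<close> is zero off the
    diagonal and gives an eigenvector. For sign \<open>Minus\<close> the same holds for the row,
    which determines the diagonal entries of all powers.\<close>
  have diag: "x $ i $ i = 0" for i
  proof (cases "sg i")
    case Plus
    have "x $ k $ i = 0" if "k \<noteq> i" for k using that low[of k i] off[of k i] Plus by (cases "sg k") auto
    then have "x *v axis i 1 = x $ i $ i *s axis i 1"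
      by (simp add: vec_eq_iff matrix_vector_axis) (simp add: axis_def)
    then show ?thesis using nilpotent_eigenvalue I(2,3) by (metis axis_eq_0_iff zero_neq_one)
  next
    case Minus
    have row: "x $ i $ k = 0" if "k \<noteq> i" for k using that low off Minus by (metis sign.exhaust)
    have "mpow x k $ i $ i = x $ i $ i ^ k" for k
    proof (induction k)
      case 0
      then show ?case by (simp add: mat_1_nth)
    next
      case (Suc k)
      have "mpow x (Suc k) $ i $ i = (\<Sum>l\<in>{i}. x $ i $ l * mpow x k $ l $ i)"
        unfolding mpow_Suc matrix_mult_nth by (rule sum.mono_neutral_right) (use row in auto)
      then show ?case using Suc by simp
    qed
    moreover obtain k where "mpow x k = 0" using I(2,3) nilpotent_matrix_mpow by blast
    ultimately show ?thesis by (metis power_eq_0_iff zero_index)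
  qed
  show "x \<in> ?N"
    using low off diag by (auto) (metis sign.exhaust)+
next
  fix x :: "'n bmat" assume "x \<in> ?N"
  have nil: "nilpotent_matrix x" if "x \<in> ?N" for x :: "'n bmat"
    by (rule lowers_nilpotent[of
      "\<lambda>i. if sg i = Plus then 0 else 1"]) (use that in \<open>auto simp: lowers_def\<close>)
  have "bracket a b \<in> ?N" if "a \<in> lie_P_S" "b \<in> ?N" for a b :: "'n bmat"
  proof -
    have a: "\<And>i j. sg i = Minus \<Longrightarrow> sg j = Plus \<Longrightarrow> a $ i $ j = 0" using that(1) lie_P_S_iff by blast
    have b: "\<And>i j. sg i = Minus \<or> sg j = Plus \<Longrightarrow> b $ i $ j = 0" using that(2) by force
    have "a $ i $ k * b $ k $ j = 0" "b $ i $ k * a $ k $ j = 0"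
      if "sg i = Minus \<or> sg j = Plus" for i j k
      using a b that by (cases "sg k"; auto)+
    then have "bracket a b $ i $ j = 0" if "sg i = Minus \<or> sg j = Plus" for i j
    proof -
      have "(a ** b) $ i $ j = 0" "(b ** a) $ i $ j = 0"
        unfolding matrix_mult_nth using that \<open>\<And>k j i. sg i = Minus \<or> sg j = Plus \<Longrightarrow>
          a $ i $ k * b $ k $ j = 0\<close>
          \<open>\<And>k j i. sg i = Minus \<or> sg j = Plus \<Longrightarrow> b $ i $ k * a $ k $ j = 0\<close>
        by (intro sum.neutral ballI; simp)+
      then show ?thesis by (simp add: bracket_def)
    qed
    then show ?thesis by (auto) (metis sign.exhaust)+
  qed
  moreover have "csubspace ?N" 
  proof -
    have "?N = {x. \<forall>i j. sg i = Minus \<or> sg j = Plus \<longrightarrow> x $ i $ j = 0}"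
      by (intro Collect_cong iff_allI) (metis sign.exhaust sign.distinct(1))
    then show ?thesis by (simp add: csubspace_def)
  qed
  moreover have "?N \<subseteq> lie_P_S" by (auto simp: lie_P_S_iff) (metis sign.distinct(1))
  ultimately have "lie_ideal ?N lie_P_S" unfolding lie_ideal_def by (intro conjI ballI)
  then show "x \<in> nilrad lie_P_S" unfolding nilrad_def using nil \<open>x \<in> ?N\<close> by blast
qed

text \<open>The image lies in the kernel and their dimensions add up to 2n, so dimension n occurs
  between them.\<close>

lemma square_zero_subspace:
  fixes x :: "('n::finite) bmat"
  assumes x: "x ** x = 0"
  obtains W where "vec.subspace W" "vec.dim W = CARD('n)" "range ((*v) x) \<subseteq> W" "W \<subseteq> {w. x *v w = 0}"
proof -
  let ?R = "range ((*v) x)" and ?N = "{w. x *v w = 0}"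
  have R: "vec.subspace ?R" by (intro vec.subspace_image matrix_vector_mul_linear_gen) simp
  have N: "vec.subspace ?N" by (auto simp: vec.subspace_def matrix_vector_right_distrib
    vector_scalar_commute)
  have sub: "?R \<subseteq> ?N" using x by (auto simp: matrix_vector_mul_assoc)
  have sum: "vec.dim ?R + vec.dim ?N = 2 * CARD('n)"
    using rank_nullity[of UNIV x] by (simp add: card_cart_basis)
  then have le: "vec.dim ?R \<le> CARD('n)" "CARD('n) \<le> vec.dim ?N" using vec.dim_subset[OF sub] by auto
  obtain A where A: "A 0 = ?R" "A (vec.dim ?N - vec.dim ?R) = ?N"
      "\<forall>i\<le>vec.dim ?N - vec.dim ?R. vec.subspace (A i) \<and> vec.dim (A i) = vec.dim ?R + i"
      "\<forall>i<vec.dim ?N - vec.dim ?R. A i \<subseteq> A (Suc i)"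
    using flag_between[OF R N sub, of "vec.dim ?N - vec.dim ?R"] le by auto
  define W where "W = A (CARD('n) - vec.dim ?R)"
  have mono: "A i \<subseteq> A j" if "i \<le> j" "j \<le> vec.dim ?N - vec.dim ?R" for i j
    using that A(4) by (induction j rule: dec_induct) (auto dest!: spec[of _
      "_ :: nat"] simp: subset_iff)
  have W: "vec.subspace W" "vec.dim W = CARD('n)" "?R \<subseteq> W" "W \<subseteq> ?N"
    using A(1-3) mono[of 0 "CARD('n) - vec.dim ?R"] mono[of "CARD('n) - vec.dim ?R"
      "vec.dim ?N - vec.dim ?R"] le
    by (auto simp: W_def)
  then show ?thesis using that by blast
qed

text \<open>The nilradical of the stabilizer of an n-dimensional \<open>W\<close> consists of the
  matrices that kill \<open>W\<close> and have image in \<open>W\<close>.\<close>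

lemma square_zero_nilrad_parabolic:
  fixes x :: "('n::finite) bmat"
  shows "x ** x = 0 \<longleftrightarrow> (\<exists>g. invertible g \<and> x \<in> nilrad (conj_by g ` lie_P_S))"
proof
  assume "\<exists>g. invertible g \<and> x \<in> nilrad (conj_by g ` lie_P_S)"
  then obtain g where g: "invertible g" "x \<in> nilrad (conj_by g ` lie_P_S)" by blast
  define x' where "x' = conj_by (matrix_inv g) x"
  have "x' \<in> nilrad lie_P_S"
    using nilrad_conj_by_mem[OF invertible_matrix_inv[OF g(1)] g(2)] g(1)
      by (simp add: conj_by_image_inv x'_def)
  then have x': "x' $ i $ j = 0" if "\<not> (sg i = Plus \<and> sg j = Minus)" for i j
    using that by (auto simp: nilrad_lie_P_S)
  have "x' $ i $ k * x' $ k $ j = 0" for i j k using x'[of i k] x'[of k j] by (cases "sg k") auto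
  then have "x' ** x' = 0" by (simp only: vec_eq_iff matrix_mult_nth zero_index) simp
  then have "conj_by g x' ** conj_by g x' = 0" using g(1) by (simp add: conj_by_mult[symmetric])
  then show "x ** x = 0" using g(1) by (simp add: x'_def conj_by_inv)
next
  assume x: "x ** x = 0"
  let ?R = "range ((*v) x)" and ?N = "{w. x *v w = 0}"
  obtain W where W: "vec.subspace W" "vec.dim W = CARD('n)" "?R \<subseteq> W" "W \<subseteq> ?N"
    by (rule square_zero_subspace[OF x])
  obtain a where a: "W = vec.span (a ` {..<CARD('n)})"
    "(UNIV :: 'n bvec set) = vec.span (a ` {..<2 * CARD('n)})"
    using adapted_basis[of 0 "\<lambda>_. W" "CARD('n)" UNIV "2 * CARD('n)"] W by (auto simp: card_cart_basis)
  \<comment> \<open>The n vectors spanning \<open>W\<close> receive the indices of sign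
    \<open>Plus\<close>, so the base change carries the standard n-dimensional subspace to
    \<open>W\<close>.\<close>
  define c where "c j = a (if sg j = Plus then num j else CARD('n) + num j)" for j :: "'n + 'n"
  have im: "a k \<in> range c" if "k < 2 * CARD('n)" for k
  proof (cases "k < CARD('n)")
    case True
    then show ?thesis using idx[OF True, of Plus]
      by (intro range_eqI[of _ _ "idx Plus k"]) (simp add: c_def)
  next
    case False
    then have "k - CARD('n) < CARD('n)" using that by simp
    then show ?thesis using idx[of "k - CARD('n)" Minus, where 'n = 'n] False
      by (intro range_eqI[of _ _ "idx Minus (k - CARD('n))"]) (simp add: c_def)
  qed
  have "vec.span (a ` {..<2 * CARD('n)}) \<subseteq> vec.span (range c)" using im by (intro vec.span_mono) auto
  then have "vec.span (range c) = UNIV" using a(2) by auto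
  then obtain g where g: "invertible g" "\<And>j. g *v axis j 1 = c j" using basis_matrix by blast
  have WI: "W \<subseteq> vec.span (c ` {j. sg j = Plus})" unfolding a(1)
  proof (intro vec.span_mono image_subsetI)
    fix k assume "k \<in> {..<CARD('n)}"
    then show "a k \<in> c ` {j. sg j = Plus}"
      using idx[of k Plus, where 'n = 'n] by (intro image_eqI[of _ _ "idx Plus k"]) (auto simp: c_def)
  qed
  define x' where "x' = conj_by (matrix_inv g) x"
  have x'_eq: "x' = matrix_inv g ** x ** g" using g(1) by (simp add: x'_def conj_by_def matrix_inv_inv)
  have "x' \<in> nilrad lie_P_S" unfolding nilrad_lie_P_S
  proof (intro CollectI allI impI)
    fix i j assume nz: "x' $ i $ j \<noteq> 0"
    have "sg i = Plus"
    proof (rule ccontr)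
      assume "sg i \<noteq> Plus"
      moreover have "x *v c j \<in> vec.span (c ` {j. sg j = Plus})" using W(3) WI by blast
      ultimately show False using basis_matrix_coord[OF g, of x j "{j. sg j = Plus}" i] nz
        by (simp add: x'_eq)
    qed
    moreover have "sg j = Minus"
    proof (rule ccontr)
      assume "sg j \<noteq> Minus"
      then have "sg j = Plus" by (cases "sg j") auto
      then have "c j \<in> W" unfolding a(1) c_def by (auto intro: vec.span_base simp: num_less)
      then have "x *v c j = 0" using W(4) by auto
      then show False using basis_matrix_coord[OF g, of x j "{}" i] nz by (simp add: x'_eq)
    qed
    ultimately show "sg i = Plus \<and> sg j = Minus" by simp
  qed
  from nilrad_conj_by_mem[OF g(1) this] show "\<exists>g. invertible g \<and> x \<in> nilrad (conj_by g ` lie_P_S)"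
    using g(1) by (auto simp: x'_def conj_by_inv)
qed

text \<open>In each diagonal block only entries on or above the \<open>d\<close>-th superdiagonal
  are allowed: \<open>strip 0\<close> is the standard Borel subalgebra and \<open>strip 1\<close>
  its strictly triangular part.\<close>

definition strip :: "nat \<Rightarrow> ('n::finite) bmat set" where
  "strip d = {x \<in> lie_k. lowers num d x}"

lemma csubspace_strip: "csubspace (strip d)"
  unfolding csubspace_def strip_def lie_k_sg lowers_def
  by auto (metis add.right_neutral)+

lemma bracket_strip: "x \<in> strip d \<Longrightarrow> y \<in> strip e \<Longrightarrow> bracket x y \<in> strip (d + e)"
proof -
  assume "x \<in> strip d" "y \<in> strip e"
  then have "x ** y \<in> strip (d + e)" "y ** x \<in> strip (d + e)"
    using lowers_mult[of num d x e y] lowers_mult[of num e y d x]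
      by (auto simp: strip_def lie_k_mult add.commute)
  then show ?thesis unfolding bracket_def by (rule csubspace_diff[OF csubspace_strip])
qed

lemma strip_mono: "d \<le> e \<Longrightarrow> strip e \<subseteq> strip d"
  using lowers_mono by (auto simp: strip_def)

text \<open>The diagonal of a product of triangular matrices is the product of the diagonals, so it
  cancels in the bracket.\<close>

lemma bracket_strip_0:
  assumes "x \<in> strip 0" "y \<in> strip 0"
  shows "bracket x y \<in> strip 1"
proof -
  have br: "bracket x y \<in> strip 0" using bracket_strip[OF assms] by simp
  have tri: "i = k" if "u \<in> strip 0" "u $ i $ k \<noteq> 0" "num k \<le> num i" for u i k
    using that index_eqI[of i k] lowersD[of num 0 u i k] by (auto simp: strip_def dest: lie_k_mult_nz)
  have "bracket x y $ i $ i = 0" for i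
  proof -
    have "u $ i $ k * w $ k $ i = (if k = i then u $ i $ i * w $ i $ i else 0)"
      if "u \<in> strip 0" "w \<in> strip 0" for u w k
      using tri[OF that(1), of i k] that(2) lowersD[of num 0 w k i] by (auto simp: strip_def)
    then have "(u ** w) $ i $ i = (\<Sum>k\<in>UNIV. if k = i then u $ i $ i * w $ i $ i else 0)"
      if "u \<in> strip 0" "w \<in> strip 0" for u w
      unfolding matrix_mult_nth using that by (intro sum.cong) auto
    then show ?thesis using assms by (simp add: bracket_def)
  qed
  moreover have "num i \<noteq> num j" if "bracket x y $ i $ j \<noteq> 0" "i \<noteq> j" for i j
    using tri[OF br that(1)] that(2) by auto
  ultimately show ?thesis using br unfolding strip_def lowers_def
    by simp (metis Suc_leI le_neq_implies_less)
qed

lemma csubspace_hull: "csubspace (csubspace hull S)"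
  by (rule hull_in) (auto simp: csubspace_def)

lemma derived_algebra_subset:
  "csubspace D \<Longrightarrow> (\<And>x y. x \<in> A \<Longrightarrow> y \<in> A \<Longrightarrow> bracket x y \<in> D) \<Longrightarrow> derived_algebra A \<subseteq> D"
  unfolding derived_algebra_def by (rule hull_minimal) auto

lemma bracket_in_derived: "x \<in> A \<Longrightarrow> y \<in> A \<Longrightarrow> bracket x y \<in> derived_algebra A"
  unfolding derived_algebra_def by (rule hull_inc) auto

lemma derived_algebra_conj_by:
  assumes g: "invertible g"
  shows "derived_algebra (conj_by g ` A) = conj_by g ` derived_algebra (A :: ('n::finite) bmat set)"
proof -
  have sub: "derived_algebra (conj_by g ` A) \<subseteq> conj_by g ` derived_algebra A"
    if "invertible g" for g and A :: "'n bmat set"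
  proof (rule derived_algebra_subset)
    show "csubspace (conj_by g ` derived_algebra A)"
      unfolding derived_algebra_def by (intro csubspace_conj_by csubspace_hull)
    show "bracket x y \<in> conj_by g ` derived_algebra A"
      if "x \<in> conj_by g ` A" "y \<in> conj_by g ` A" for x y
      using that \<open>invertible g\<close>
        by (auto simp: conj_by_bracket[symmetric] intro!: imageI bracket_in_derived)
  qed
  have "derived_algebra A \<subseteq> conj_by (matrix_inv g) ` derived_algebra (conj_by g ` A)"
    using sub[OF invertible_matrix_inv[OF g], of "conj_by g ` A"] by (simp add: conj_by_image_inv[OF g])
  then have "conj_by g ` derived_algebra A \<subseteq> conj_by g ` conj_by (matrix_inv g) ` derived_algebra
    (conj_by g ` A)"
    by (rule image_mono)
  then have "conj_by g ` derived_algebra A \<subseteq> derived_algebra (conj_by g ` A)"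
    by (simp add: image_image conj_by_inv g)
  then show ?thesis using sub[OF g] by blast
qed

lemma solvable_conj_by:
  assumes g: "invertible g" and "solvable_lie A"
  shows "solvable_lie (conj_by g ` (A :: ('n::finite) bmat set))"
proof -
  have "(derived_algebra ^^ k) (conj_by g ` A) = conj_by g ` (derived_algebra ^^ k) A" for k
    by (induction k) (simp_all add: derived_algebra_conj_by g)
  then show ?thesis using assms(2) unfolding solvable_lie_def
    by (metis conj_by_0 image_empty image_insert)
qed

lemma lie_subalgebra_conj_by:
  "invertible g \<Longrightarrow> lie_subalgebra A \<Longrightarrow> lie_subalgebra (conj_by g ` (A :: ('n::finite) bmat set))"
  unfolding lie_subalgebra_def by (auto simp: csubspace_conj_by conj_by_bracket[symmetric])

lemma borel_conj_by:
  assumes g: "g \<in> K" and b: "borel_subalgebra b lie_k"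
  shows "borel_subalgebra (conj_by g ` b) lie_k"
  unfolding borel_subalgebra_def
proof (intro conjI allI impI)
  have inv: "invertible g" and inv': "invertible (matrix_inv g)"
    using g K_invertible invertible_matrix_inv by blast+
  show "lie_subalgebra (conj_by g ` b)" "solvable_lie (conj_by g ` b)" "conj_by g ` b \<subseteq> lie_k"
    using b lie_subalgebra_conj_by[OF inv] solvable_conj_by[OF inv] conj_by_lie_k[OF g]
    unfolding borel_subalgebra_def by auto
  fix b' assume b': "lie_subalgebra b' \<and> solvable_lie b' \<and> conj_by g ` b \<subseteq> b' \<and> b' \<subseteq> lie_k"
  have "b \<subseteq> conj_by (matrix_inv g) ` b'"
    using b' conj_by_image_inv[OF inv, of b] by (metis image_mono)
  moreover have "conj_by (matrix_inv g) ` b' \<subseteq> lie_k" using b' conj_by_lie_k[OF K_inv[OF g]] by auto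
  ultimately have "conj_by (matrix_inv g) ` b' = b"
    using b b' lie_subalgebra_conj_by[OF inv'] solvable_conj_by[OF inv']
      unfolding borel_subalgebra_def by blast
  then show "b' = conj_by g ` b" using inv by (auto simp: image_image conj_by_inv)
qed

lemma mat_unit_strip: "sg i = sg j \<Longrightarrow> num i \<le> num j \<Longrightarrow> mat_unit i j \<in> strip 0"
  by (auto simp: strip_def lie_k_sg lowers_def mat_unit_nth)

text \<open>A Lie algebra strictly containing the triangular one contains a copy of \<open>sl\<^sub>2\<close>.\<close>
lemma borel_strip: "borel_subalgebra (strip 0 :: ('n::finite) bmat set) lie_k"
  unfolding borel_subalgebra_def
proof (intro conjI allI impI)
  show "lie_subalgebra (strip 0 :: 'n bmat set)"
    unfolding lie_subalgebra_def using csubspace_strip bracket_strip[of _ 0 _ 0] by auto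
  show "solvable_lie (strip 0 :: 'n bmat set)"
  proof -
    have der: "(derived_algebra ^^ k) (strip 0) \<subseteq> (strip k :: 'n bmat set)" for k
    proof (induction k)
      case (Suc k)
      have "bracket x y \<in> strip (Suc k)"
        if "x \<in> (derived_algebra ^^ k) (strip 0)" "y \<in> (derived_algebra ^^ k) (strip 0)"
        for x y :: "'n bmat"
      \<comment> \<open>The first step is gained because diagonals commute. For positive
        \<open>k\<close> the brackets lie in degree \<open>k + k\<close>, which is at least
        \<open>Suc k\<close>.\<close>
      proof (cases k)
        case 0
        then show ?thesis using that bracket_strip_0 by simp
      next
        case (Suc l)
        have "bracket x y \<in> strip (k + k)" using Suc.IH that bracket_strip by blast
        then show ?thesis using strip_mono[of "Suc k" "k + k"] Suc by auto
      qed
      then show ?case by (simp add: derived_algebra_subset csubspace_strip)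
    qed simp
    have "strip CARD('n) \<subseteq> {0 :: 'n bmat}"
      using lowers_eq_0[of num "CARD('n)"] num_less by (auto simp: strip_def)
    moreover have "0 \<in> (derived_algebra ^^ CARD('n)) (strip 0 :: 'n bmat set)"
    proof -
      obtain l where "CARD('n) = Suc l" by (metis not0_implies_Suc zero_less_card_finite less_irrefl)
      then show ?thesis using csubspace_0[OF csubspace_hull] by (simp add: derived_algebra_def)
    qed
    ultimately have "(derived_algebra ^^ CARD('n)) (strip 0) = {0 :: 'n bmat}"
      using der[of "CARD('n)"] by blast
    then show ?thesis unfolding solvable_lie_def by blast
  qed
  show "strip 0 \<subseteq> (lie_k :: 'n bmat set)" by (auto simp: strip_def)
  fix b :: "'n bmat set" assume b: "lie_subalgebra b \<and> solvable_lie b \<and> strip 0 \<subseteq> b \<and> b \<subseteq> lie_k"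
  then have cb: "csubspace b" and br: "\<And>x y. x \<in> b \<Longrightarrow> y \<in> b \<Longrightarrow> bracket x y \<in> b"
    by (auto simp: lie_subalgebra_def)
  show "b = strip 0"
  proof (rule ccontr)
    assume "b \<noteq> strip 0"
    then obtain x where x: "x \<in> b" "x \<notin> strip 0" using b by blast
    then obtain i j where ij: "x $ i $ j \<noteq> 0" "num j < num i" using b
      by (auto simp: strip_def lowers_def not_le)
    have s: "sg i = sg j" using ij x b lie_k_mult_nz by blast
    have neq: "i \<noteq> j" using ij by auto
    have un: "mat_unit i i \<in> b" "mat_unit j j \<in> b" "mat_unit j i \<in> b"
      using mat_unit_strip[of i i] mat_unit_strip[of j j] mat_unit_strip[of j i] b s ij by auto
    have Eij: "mat_unit i j \<in> b"
    proof -
      \<comment> \<open>These two brackets leave only the entries at \<open>(i, j)\<close> and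
        \<open>(j, i)\<close> of \<open>x\<close>. The latter is removed with
        \<open>mat_unit j i\<close>, which is already in \<open>b\<close>.\<close>
      have "bracket (bracket (mat_unit i i) x) (mat_unit j j) =
        (\<chi> a b. x $ i $ j * mat_unit i j $ a $ b) + (\<chi> a b. x $ j $ i * mat_unit j i $ a $ b)"
        using neq by (auto simp: bracket_def vec_eq_iff mat_unit_mult_left mat_unit_mult_right
          mat_unit_nth)
      moreover have "bracket (bracket (mat_unit i i) x) (mat_unit j j) \<in> b" using br un x by blast
      ultimately have "(\<chi> a b. x $ i $ j * mat_unit i j $ a $ b) + (\<chi> a b. x $ j $ i * mat_unit j i
        $ a $ b) \<in> b"
        by simp
      from csubspace_diff[OF cb this csubspace_scale[OF cb un(3), of "x $ j $ i"]]
      have "(\<chi> a b. x $ i $ j * mat_unit i j $ a $ b) \<in> b" by simp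
      from csubspace_scale[OF cb this, of "1 / x $ i $ j"] show ?thesis using ij(1)
        by (simp add: vec_lambda_eta)
    qed
    let ?H = "mat_unit i i - mat_unit j j"
    \<comment> \<open>The three matrices span a copy of sl_2, which equals its own derived algebra
      and hence survives in the whole derived series.\<close>
    have "{mat_unit i j, mat_unit j i, ?H} \<subseteq> (derived_algebra ^^ k) b" for k
    proof (induction k)
      case 0
      then show ?case using Eij un csubspace_diff[OF cb] by simp
    next
      case (Suc k)
      let ?D = "derived_algebra ((derived_algebra ^^ k) b)"
      have cD: "csubspace ?D" unfolding derived_algebra_def by (rule csubspace_hull)
      have "bracket (mat_unit i j) (mat_unit j i) \<in> ?D" "bracket ?H (mat_unit i j) \<in> ?D"
        "bracket ?H (mat_unit j i) \<in> ?D"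
        using Suc by (auto intro!: bracket_in_derived)
      moreover have "bracket (mat_unit i j) (mat_unit j i) = ?H"
        using neq by (auto simp: bracket_def vec_eq_iff mat_unit_mult_left mat_unit_nth)
      moreover have "(\<chi> a b. 1/2 * bracket ?H (mat_unit i j) $ a $ b) = mat_unit i j"
        "(\<chi> a b. - 1/2 * bracket ?H (mat_unit j i) $ a $ b) = mat_unit j i"
        using neq by (auto simp: bracket_def vec_eq_iff mat_unit_mult_left mat_unit_mult_right
          mat_unit_nth)
      ultimately have "?H \<in> ?D" "mat_unit i j \<in> ?D" "mat_unit j i \<in> ?D"
        using csubspace_scale[OF cD \<open>bracket ?H (mat_unit i j) \<in> ?D\<close>, of "1/2"]
          csubspace_scale[OF cD \<open>bracket ?H (mat_unit j i) \<in> ?D\<close>, of "- 1/2"] by simp_all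
      then show ?case by simp
    qed
    moreover obtain k where "(derived_algebra ^^ k) b = {0}" using b unfolding solvable_lie_def by blast
    ultimately have "mat_unit i j = (0 :: 'n bmat)" by blast
    then have "mat_unit i j $ i $ j = (0 :: 'n bmat) $ i $ j" by simp
    then show False by (simp add: mat_unit_nth)
  qed
qed

lemma strip_subset_nilrad: "(strip 1 :: ('n::finite) bmat set) \<subseteq> nilrad (strip 0)"
proof -
  have "lie_ideal (strip 1) (strip 0 :: 'n bmat set)"
    unfolding lie_ideal_def using csubspace_strip strip_mono[of 0 1] bracket_strip[of _ 0 _ 1] by auto
  moreover have "\<forall>x\<in>strip 1. nilpotent_matrix (x :: 'n bmat)" using lowers_nilpotent
    by (auto simp: strip_def)
  ultimately show ?thesis unfolding nilrad_def by blast
qed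

text \<open>A nilpotent \<open>z\<close> becomes strictly triangular in each block after conjugation
  in \<open>K\<close>, that is, an element of \<open>strip 1\<close>.\<close>

lemma nilpotent_nilrad_borel:
  fixes z :: "('n::finite) bmat"
  assumes "z \<in> lie_k"
  shows "nilpotent_matrix z \<longleftrightarrow> (\<exists>b. borel_subalgebra b lie_k \<and> z \<in> nilrad b)"
proof
  assume "nilpotent_matrix z"
  then obtain g where g: "g \<in> K" "conj_by (matrix_inv g) z \<in> lie_k"
    "lowers num 1 (conj_by (matrix_inv g) z)"
    using nilpotent_lie_k_triangular assms by blast
  then have "conj_by (matrix_inv g) z \<in> nilrad (strip 0)" using strip_subset_nilrad
    by (auto simp: strip_def)
  from nilrad_conj_by_mem[OF K_invertible[OF g(1)] this] have "z \<in> nilrad (conj_by g ` strip 0)"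
    using g(1) by (simp add: conj_by_inv K_invertible)
  then show "\<exists>b. borel_subalgebra b lie_k \<and> z \<in> nilrad b" using borel_conj_by[OF g(1) borel_strip]
    by blast
qed (auto simp: nilrad_def)

definition square_zero :: "('n::finite) bmat set" where
  "square_zero = {x. x ** x = 0 \<and> nilpotent_matrix (diag_part x)}"

lemma conormal_images:
  "pi_k ` conormal = diag_part ` square_zero" "pi_s ` conormal = offdiag_part ` square_zero"
proof -
  have "(\<exists>b p. (b, p, x) \<in> conormal) \<longleftrightarrow> x \<in> square_zero" for x :: "('n::finite) bmat"
    unfolding conormal_def double_flag_def square_zero_def square_zero_nilrad_parabolic
      nilpotent_nilrad_borel[OF diag_part_in] by auto
  then show "pi_k ` conormal = diag_part ` square_zero" "pi_s ` conormal = offdiag_part ` square_zero"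
    unfolding pi_k_def pi_s_def by (force simp: image_iff)+
qed

subsection \<open>Normal forms of level-lowering matrices\<close>

text \<open>The shift \<open>\<delta>\<close> slides the numbering of one sign against that of the
  other, which lets a single notion of lowering describe the different relative positions of the two
  flags.\<close>

definition lev :: "(sign \<Rightarrow> nat) \<Rightarrow> ('n::finite) + 'n \<Rightarrow> nat" where
  "lev \<delta> j = num j + \<delta> (sg j)"

definition offset :: "sign \<Rightarrow> nat \<Rightarrow> sign \<Rightarrow> nat" where
  "offset s d = (\<lambda>t. if t = s then 0 else d)"

definition homog :: "bool \<Rightarrow> ('n::finite) bmat \<Rightarrow> bool" where
  "homog \<tau> x \<longleftrightarrow> (\<forall>i j. x $ i $ j \<noteq> 0 \<longrightarrow> (sg i = sg j) = \<tau>)"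

definition nxt :: "bool \<Rightarrow> (sign \<Rightarrow> nat) \<Rightarrow> ('n::finite) + 'n \<Rightarrow> 'n + 'n \<Rightarrow> bool" where
  "nxt \<tau> \<delta> i j \<longleftrightarrow> (sg i = sg j) = \<tau> \<and> lev \<delta> j = Suc (lev \<delta> i)"

text \<open>For \<open>\<tau> = True\<close> and \<open>\<delta> = 0\<close> a full Jordan block on
  each of \<open>V Plus\<close> and \<open>V Minus\<close>; for \<open>\<tau> = False\<close> the
  representative of an orbit, with chains of alternating signs.\<close>

definition std :: "bool \<Rightarrow> (sign \<Rightarrow> nat) \<Rightarrow> ('n::finite) bmat" where
  "std \<tau> \<delta> = (\<chi> i j. if nxt \<tau> \<delta> i j then 1 else 0)"

lemma homog_True: "homog True x \<longleftrightarrow> x \<in> lie_k" and homog_False: "homog False x \<longleftrightarrow> x \<in> space_s"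
  by (auto simp: homog_def lie_k_sg space_s_sg)

lemma std_nth: "std \<tau> \<delta> $ i $ j = (if nxt \<tau> \<delta> i j then 1 else 0)"
  by (simp add: std_def)

lemma homog_std: "homog \<tau> (std \<tau> \<delta>)" and lowers_std: "lowers (lev \<delta>) 1 (std \<tau> \<delta>)"
  by (auto simp: homog_def lowers_def std_nth nxt_def)

lemma lev_eqI: "sg i = sg j \<Longrightarrow> lev \<delta> i = lev \<delta> j \<Longrightarrow> i = j"
  by (rule index_eqI) (auto simp: lev_def)

lemma sign_eq_cases: "((s = t) = \<tau>) \<Longrightarrow> ((u = t) = \<tau>) \<Longrightarrow> s = (u :: sign)"
  by (cases s; cases t; cases u; cases \<tau>) auto

lemma nxt_unique1: "nxt \<tau> \<delta> i j \<Longrightarrow> nxt \<tau> \<delta> i j' \<Longrightarrow> j = j'"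
  using sign_eq_cases[of "sg j" "sg i" \<tau> "sg j'"] lev_eqI[of j j' \<delta>]
  unfolding nxt_def by (simp only: eq_commute[of "sg i"])

lemma nxt_unique2: "nxt \<tau> \<delta> i j \<Longrightarrow> nxt \<tau> \<delta> i' j \<Longrightarrow> i = i'"
  using sign_eq_cases[of "sg i" "sg j" \<tau> "sg i'"] lev_eqI[of i i' \<delta>]
  unfolding nxt_def by (simp only: nat.inject)

lemma lev_le: "\<forall>s. \<delta> s \<le> 1 \<Longrightarrow> lev \<delta> (j :: ('n::finite) + 'n) \<le> CARD('n)"
proof -
  assume "\<forall>s. \<delta> s \<le> 1"
  then have "\<delta> (sg j) \<le> 1" ..
  then show ?thesis using num_less[of j] unfolding lev_def by linarith
qed

lemma ex_lev:
  assumes "\<delta> s \<le> m" "m < CARD('n::finite) + \<delta> s"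
  obtains i :: "('n::finite) + 'n" where "sg i = s" "lev \<delta> i = m"
  using idx[of "m - \<delta> s" s, where 'n = 'n] assms
    by (intro that[of "idx s (m - \<delta> s)"]) (auto simp: lev_def)

text \<open>For \<open>\<delta> \<le> 1\<close> the levels of either sign form an interval reaching
  at least n - 1, while no level exceeds n. So one step below \<open>j\<close> the sign of
  \<open>k\<close> can only be missing at the bottom, and \<open>k\<close> excludes this.\<close>

lemma ex_lower:
  fixes j k :: "('n::finite) + 'n"
  assumes "\<forall>s. \<delta> s \<le> 1" "lev \<delta> k < lev \<delta> j"
  obtains i :: "'n + 'n" where "sg i = sg k" "lev \<delta> j = Suc (lev \<delta> i)"
proof -
  have "\<delta> (sg k) \<le> lev \<delta> j - 1" using assms(2) by (auto simp: lev_def)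
  moreover have "lev \<delta> j - 1 < CARD('n) + \<delta> (sg k)" using lev_le[OF assms(1), of j] assms(2) by linarith
  ultimately obtain i :: "'n + 'n" where "sg i = sg k" "lev \<delta> i = lev \<delta> j - 1" by (rule ex_lev)
  then have "lev \<delta> j = Suc (lev \<delta> i)" using assms(2) by linarith
  then show ?thesis using that \<open>sg i = sg k\<close> by blast
qed

text \<open>Column \<open>i\<close> of the matrix conjugating \<open>std\<close> to \<open>y\<close>: the vector obtained by applying powers of
  \<open>y\<close> to the top of the chain through \<open>i\<close>.\<close>
function chain_col :: "('n::finite) bmat \<Rightarrow> bool \<Rightarrow> (sign \<Rightarrow> nat) \<Rightarrow> 'n + 'n \<Rightarrow> 'n bvec" where
  "chain_col y \<tau> \<delta> i
    = (if \<exists>j. nxt \<tau> \<delta> i j then y *v chain_col y \<tau> \<delta> (SOME j. nxt \<tau> \<delta> i j) else axis i 1)"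
  by pat_completeness auto
termination
proof (relation "Wellfounded.measure (\<lambda>(y, \<tau>, \<delta>, i). Max (lev \<delta> ` insert i UNIV) - lev \<delta> i)",
  goal_cases)
  case (2 y \<tau> \<delta> i)
  let ?j = "SOME j. nxt \<tau> \<delta> i j"
  have "nxt \<tau> \<delta> i ?j" using 2 by (rule someI_ex)
  moreover have "lev \<delta> ?j \<le> Max (lev \<delta> ` insert i UNIV)" by (intro Max_ge) auto
  ultimately have "Max (lev \<delta> ` insert i UNIV) - lev \<delta> ?j < Max (lev \<delta> ` insert i UNIV) - lev \<delta> i"
    unfolding nxt_def by linarith
  then show ?case by simp
qed simp

declare chain_col.simps [simp del]

lemma chain_col_nxt: "nxt \<tau> \<delta> i j \<Longrightarrow> chain_col y \<tau> \<delta> i = y *v chain_col y \<tau> \<delta> j"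
proof -
  assume "nxt \<tau> \<delta> i j"
  then have "(SOME j. nxt \<tau> \<delta> i j) = j" "\<exists>j. nxt \<tau> \<delta> i j" using nxt_unique1 by blast+
  then show ?thesis by (subst chain_col.simps) simp
qed

lemma chain_col_top: "\<nexists>j. nxt \<tau> \<delta> i j \<Longrightarrow> chain_col y \<tau> \<delta> i = axis i 1"
  by (subst chain_col.simps) auto

text \<open>Going down from the top of a chain, each application of \<open>y\<close> multiplies the
  leading coefficient by an entry of \<open>y\<close> that \<open>reg\<close> makes nonzero; every
  other contribution has lower level.\<close>

lemma chain_col_triangular:
  fixes y :: "('n::finite) bmat"
  assumes y: "homog \<tau> y" "lowers (lev \<delta>) 1 y" and reg: "\<forall>i j. nxt \<tau> \<delta> i j \<longrightarrow> y $ i $ j \<noteq> 0"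
  shows "chain_col y \<tau> \<delta> i $ i \<noteq> 0 \<and>
    (\<forall>k. chain_col y \<tau> \<delta> i $ k \<noteq> 0 \<longrightarrow> k = i \<or> sg k = sg i \<and> lev \<delta> k < lev \<delta> i)"
proof (induction "Max (range (lev \<delta> :: 'n + 'n \<Rightarrow> nat)) - lev \<delta> i" arbitrary: i rule: less_induct)
  case less
  show ?case
  proof (cases "\<exists>j. nxt \<tau> \<delta> i j")
    case False
    then show ?thesis by (simp add: chain_col_top axis_def)
  next
    case True
    then obtain j where j: "nxt \<tau> \<delta> i j" by blast
    let ?c = "chain_col y \<tau> \<delta> j"
    have "lev \<delta> j \<le> Max (range (lev \<delta> :: 'n + 'n \<Rightarrow> nat))" by simp
    then have "Max (range (lev \<delta> :: 'n + 'n \<Rightarrow> nat)) - lev \<delta> j < Max (range (lev \<delta> :: 'n + 'n \<Rightarrow> nat))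
      - lev \<delta> i"
      using j unfolding nxt_def by linarith
    from less.hyps[OF this] have c: "?c $ j \<noteq> 0"
      "\<And>l. ?c $ l \<noteq> 0 \<Longrightarrow> l = j \<or> sg l = sg j \<and> lev \<delta> l < lev \<delta> j" by auto
    have col: "chain_col y \<tau> \<delta> i $ k = (\<Sum>l\<in>UNIV. y $ k $ l * ?c $ l)" for k
      by (simp add: chain_col_nxt[OF j] matrix_vector_nth)
    have nz_term: "l = j \<and> k = i \<or> sg k = sg i \<and> lev \<delta> k < lev \<delta> i" if "y $ k $ l * ?c $ l \<noteq> 0" for k l
    proof -
      have nz: "y $ k $ l \<noteq> 0" "?c $ l \<noteq> 0" using that by auto
      have l: "l = j \<or> sg l = sg j \<and> lev \<delta> l < lev \<delta> j" by (rule c(2)[OF nz(2)])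
      then have "sg l = sg j" by auto
      moreover have "(sg k = sg l) = \<tau>" using y(1) nz(1) by (simp add: homog_def)
      ultimately have s: "sg k = sg i" using j by (metis nxt_def sign_eq_cases)
      have "lev \<delta> k < lev \<delta> l" using lowersD[OF y(2) nz(1)] by simp
      moreover have "lev \<delta> j = Suc (lev \<delta> i)" using j by (simp add: nxt_def)
      ultimately show ?thesis using l s lev_eqI[OF s, of \<delta>] by (cases "lev \<delta> k = lev \<delta> i") auto
    qed
    have "chain_col y \<tau> \<delta> i $ i = (\<Sum>l\<in>{j}. y $ i $ l * ?c $ l)"
      unfolding col by (rule sum.mono_neutral_right) (use nz_term in auto)
    then have "chain_col y \<tau> \<delta> i $ i \<noteq> 0" using reg j c(1) by simp
    moreover have "k = i \<or> sg k = sg i \<and> lev \<delta> k < lev \<delta> i" if nz: "chain_col y \<tau> \<delta> i $ k \<noteq> 0" for k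
    proof -
      obtain l where "y $ k $ l * ?c $ l \<noteq> 0" using nz unfolding col
        by (meson sum.not_neutral_contains_not_neutral)
      then show ?thesis using nz_term by blast
    qed
    ultimately show ?thesis by blast
  qed
qed

lemma normal_form:
  fixes y :: "('n::finite) bmat"
  assumes \<delta>: "\<forall>s. \<delta> s \<le> 1"
    and y: "homog \<tau> y" "lowers (lev \<delta>) 1 y" and reg: "\<forall>i j. nxt \<tau> \<delta> i j \<longrightarrow> y $ i $ j \<noteq> 0"
  shows "\<exists>g\<in>K. conj_by g (std \<tau> \<delta>) = y"
proof -
  note tri = chain_col_triangular[OF y reg]
  define g where "g = (\<chi> k i. chain_col y \<tau> \<delta> i $ k)"
  have gn: "g $ k $ i = chain_col y \<tau> \<delta> i $ k" for k i by (simp add: g_def)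
  have "invertible g"
    by (rule triangular_invertible[of _ "lev \<delta>"]) (use tri in \<open>auto simp: gn\<close>)
  moreover have "g \<in> lie_k" unfolding lie_k_sg
    using tri by (auto simp: gn)
  ultimately have gK: "g \<in> K" by (simp add: K_iff)
  have "(g ** std \<tau> \<delta>) $ k $ j = (y ** g) $ k $ j" for k j
  proof -
    have yg: "(y ** g) $ k $ j = (y *v chain_col y \<tau> \<delta> j) $ k"
      by (simp add: matrix_mult_nth matrix_vector_nth gn)
    show ?thesis
    proof (cases "\<exists>i. nxt \<tau> \<delta> i j")
      case True
      then obtain i where i: "nxt \<tau> \<delta> i j" by blast
      have "(g ** std \<tau> \<delta>) $ k $ j = (\<Sum>l\<in>{i}. g $ k $ l * std \<tau> \<delta> $ l $ j)"
        unfolding matrix_mult_nth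
        by (rule sum.mono_neutral_right) (use nxt_unique2[OF i] in \<open>auto simp: std_nth\<close>)
      then show ?thesis using i by (simp add: yg gn std_nth chain_col_nxt)
    next
      case False
      then have "(g ** std \<tau> \<delta>) $ k $ j = 0" by (simp add: matrix_mult_nth std_nth)
      \<comment> \<open>A nonzero coordinate would occupy a level below \<open>j\<close> with the
        sign that a predecessor of \<open>j\<close> must have, and \<open>ex_lower\<close> would
        then produce this predecessor.\<close>
      moreover have "(y *v chain_col y \<tau> \<delta> j) $ k = 0"
      proof (rule ccontr)
        assume "(y *v chain_col y \<tau> \<delta> j) $ k \<noteq> 0"
        then obtain l where l: "y $ k $ l * chain_col y \<tau> \<delta> j $ l \<noteq> 0"
          unfolding matrix_vector_nth by (meson sum.not_neutral_contains_not_neutral)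
        then have nz: "y $ k $ l \<noteq> 0" "chain_col y \<tau> \<delta> j $ l \<noteq> 0" by auto
        have "l = j \<or> sg l = sg j \<and> lev \<delta> l < lev \<delta> j" using tri[of j] nz(2) by blast
        then have lj: "sg l = sg j" "lev \<delta> l \<le> lev \<delta> j" by auto
        have "(sg k = sg l) = \<tau>" "lev \<delta> k < lev \<delta> l" using y nz(1) lowersD[OF y(2) nz(1)]
          by (auto simp: homog_def)
        then obtain i :: "'n + 'n" where "sg i = sg k" "lev \<delta> j = Suc (lev \<delta> i)"
          using ex_lower[OF \<delta>, of k j] lj by auto
        then have "nxt \<tau> \<delta> i j" using \<open>(sg k = sg l) = \<tau>\<close> lj by (simp add: nxt_def)
        then show False using False by blast
      qed
      ultimately show ?thesis by (simp add: yg)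
    qed
  qed
  then have "g ** std \<tau> \<delta> = y ** g" by (simp add: vec_eq_iff)
  then show ?thesis using gK K_invertible conj_by_eq_iff by blast
qed

text \<open>A level-lowering matrix is a limit, along a line, of regular ones.\<close>
lemma closure_normal_form:
  fixes y :: "('n::finite) bmat"
  assumes \<delta>: "\<forall>s. \<delta> s \<le> 1" and y: "homog \<tau> y" "lowers (lev \<delta>) 1 y"
    and S: "\<And>g. g \<in> K \<Longrightarrow> conj_by g (std \<tau> \<delta>) \<in> S"
  shows "y \<in> zariski closure_of S"
proof (rule zariski_closure_line)
  let ?F = "(\<lambda>(i, j). - y $ i $ j) ` UNIV"
  show "finite ?F" by simp
  fix c assume c: "c \<notin> ?F"
  let ?y = "line y (std \<tau> \<delta>) c"
  have nz: "y $ i $ j \<noteq> 0 \<or> std \<tau> \<delta> $ i $ j \<noteq> (0 :: complex)" if "?y $ i $ j \<noteq> 0" for i j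
    using that by auto
  have "homog \<tau> ?y" unfolding homog_def using nz y(1) homog_std[of \<tau> \<delta>] unfolding homog_def by metis
  moreover have "lowers (lev \<delta>) 1 ?y"
    unfolding lowers_def using nz y(2) lowers_std[of \<delta> \<tau>] unfolding lowers_def by metis
  moreover have "\<forall>i j. nxt \<tau> \<delta> i j \<longrightarrow> ?y $ i $ j \<noteq> 0"
    using c by (auto simp: std_nth image_iff add_eq_0_iff)
  ultimately obtain g where "g \<in> K" "conj_by g (std \<tau> \<delta>) = ?y" using normal_form[OF \<delta>] by blast
  then show "?y \<in> zariski closure_of S" using S subset_zariski_closure by (metis subsetD)
qed

subsection \<open>Orbits in the image of the conormal variety\<close>

definition orb :: "(sign \<Rightarrow> nat) \<Rightarrow> ('n::finite) bmat set" where
  "orb \<delta> = {conj_by g (std False \<delta>) | g. g \<in> K}"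

lemma std_in_orb: "std False \<delta> \<in> orb \<delta>"
  unfolding orb_def using K_1 by (force intro: exI[of _ "mat 1"])

lemma conj_by_orb: 
  assumes "g \<in> K" "x \<in> orb \<delta>"
  shows "conj_by g x \<in> orb \<delta>"
proof -
  obtain h where "h \<in> K" "x = conj_by h (std False \<delta>)" using assms(2) by (auto simp: orb_def)
  then show ?thesis using assms(1)
    by (auto simp: orb_def conj_by_conj_by K_invertible intro!: exI[of _ "g ** h"] K_mult)
qed

text \<open>\<open>lift\<close> adds to \<open>std False\<close> a block diagonal shift, scaled by the imaginary unit and its
  negative so that the sum squares to zero.\<close>
definition lift :: "(sign \<Rightarrow> nat) \<Rightarrow> ('n::finite) bmat" where
  "lift \<delta> = (\<chi> i j. if lev \<delta> j = Suc (lev \<delta> i) then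
     (if sg i \<noteq> sg j then 1 else if sg i = Plus then \<i> else - \<i>) else 0)"

lemma lift_nth: "lift \<delta> $ i $ j = (if lev \<delta> j = Suc (lev \<delta> i) then
     (if sg i \<noteq> sg j then 1 else if sg i = Plus then \<i> else - \<i>) else 0)"
  by (simp add: lift_def)

text \<open>From \<open>j\<close> to \<open>i\<close>, two levels lower, there are exactly two
  paths, through an intermediate index of either sign; \<open>\<delta> \<le> 1\<close> makes both
  exist. For equal end signs they contribute -1 and 1, otherwise \<open>\<i>\<close> and
  \<open>- \<i>\<close>.\<close>

lemma lift_square_zero:
  assumes \<delta>: "\<forall>s. \<delta> s \<le> 1"
  shows "lift \<delta> \<in> (square_zero :: ('n::finite) bmat set)"
proof -
  have "(lift \<delta> ** lift \<delta> :: 'n bmat) $ i $ j = 0" for i j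
  proof (cases "lev \<delta> j = Suc (Suc (lev \<delta> i))")
    case False
    then have "(lift \<delta> :: 'n bmat) $ i $ k * lift \<delta> $ k $ j = 0" for k by (auto simp: lift_nth)
    then show ?thesis by (simp only: matrix_mult_nth) simp
  next
    case True
    have ex: "\<exists>k :: 'n + 'n. sg k = s \<and> lev \<delta> k = Suc (lev \<delta> i)" for s
    proof -
      have "\<delta> s \<le> Suc (lev \<delta> i)" using \<delta>[rule_format, of s] by simp
      moreover have "Suc (lev \<delta> i) < CARD('n) + \<delta> s" using lev_le[OF \<delta>, of j] True by simp
      ultimately show ?thesis by (metis ex_lev)
    qed
    obtain p :: "'n + 'n" where p: "sg p = Plus" "lev \<delta> p = Suc (lev \<delta> i)" using ex by blast
    obtain m :: "'n + 'n" where m: "sg m = Minus" "lev \<delta> m = Suc (lev \<delta> i)" using ex by blast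
    have "(lift \<delta> ** lift \<delta> :: 'n bmat) $ i $ j = (\<Sum>k\<in>{p, m}. lift \<delta> $ i $ k * lift \<delta> $ k $ j)"
      unfolding matrix_mult_nth
    proof (rule sum.mono_neutral_right)
      show "\<forall>k\<in>UNIV - {p, m}. (lift \<delta> :: 'n bmat) $ i $ k * lift \<delta> $ k $ j = 0"
      proof
        fix k assume "k \<in> UNIV - {p, m}"
        then have "lev \<delta> k \<noteq> Suc (lev \<delta> i)" using p m lev_eqI[of k p \<delta>] lev_eqI[of k m \<delta>]
          by (cases "sg k") auto
        then show "(lift \<delta> :: 'n bmat) $ i $ k * lift \<delta> $ k $ j = 0" by (simp add: lift_nth)
      qed
    qed auto
    also have "\<dots> = lift \<delta> $ i $ p * lift \<delta> $ p $ j + lift \<delta> $ i $ m * lift \<delta> $ m $ j"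
      using p m by (subst sum.insert) auto
    also have "\<dots> = 0" using p m True by (cases "sg i"; cases "sg j") (auto simp: lift_nth)
    finally show ?thesis .
  qed
  then have "lift \<delta> ** lift \<delta> = (0 :: 'n bmat)" by (simp add: vec_eq_iff)
  moreover have "nilpotent_matrix (diag_part (lift \<delta> :: 'n bmat))"
    by (rule lowers_nilpotent[of
      "lev \<delta>"]) (auto simp: lowers_def diag_part_nth lift_nth split: if_splits)
  ultimately show ?thesis by (simp add: square_zero_def)
qed

lemma offdiag_lift: "offdiag_part (lift \<delta>) = std False \<delta>"
  by (auto simp: vec_eq_iff offdiag_part_nth lift_nth std_nth nxt_def)

lemma conj_by_square_zero: "g \<in> K \<Longrightarrow> x \<in> square_zero \<Longrightarrow> conj_by g x \<in> square_zero"
  by (simp add: square_zero_def diag_part_conj_by conj_by_mult[symmetric] K_invertible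
    nilpotent_conj_by)

lemma orb_subset_pi_s: "(\<forall>s. \<delta> s \<le> 1) \<Longrightarrow> orb \<delta> \<subseteq> offdiag_part ` square_zero"
proof
  fix x assume "\<forall>s. \<delta> s \<le> 1" "x \<in> orb \<delta>"
  then obtain g where "g \<in> K" "x = conj_by g (std False \<delta>)" by (auto simp: orb_def)
  then have "x = offdiag_part (conj_by g (lift \<delta>))" by (simp add: offdiag_part_conj_by offdiag_lift)
  then show "x \<in> offdiag_part ` square_zero"
    using conj_by_square_zero[OF \<open>g \<in> K\<close> lift_square_zero] \<open>\<forall>s. \<delta> s \<le> 1\<close> by blast
qed

section \<open>Closedness of the nilpotent cones and the image in the block diagonal
  matrices\<close>

lemma closedin_nilpotent: "closedin zariski {x :: ('n::finite) bmat. homog \<tau> x \<and> nilpotent_matrix x}"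
proof -
  let ?N = "{x :: 'n bmat. homog \<tau> x \<and> nilpotent_matrix x}"
  have nil: "nilpotent_matrix x \<longleftrightarrow> mpow x CARD('n + 'n) = 0" for x :: "'n bmat"
    using nilpotent_mpow_card nilpotent_matrix_mpow by blast
  have "x \<in> ?N" if x: "x \<in> zariski closure_of ?N" for x :: "'n bmat"
  proof -
    have "x $ i $ j = 0" if "(sg i = sg j) \<noteq> \<tau>" for i j
      by (rule poly_fun_vanish_closure[OF poly_funs.coord _ x]) (use that in \<open>auto simp: homog_def\<close>)
    moreover have "mpow s CARD('n + 'n) = 0" if "s \<in> ?N" for s :: "'n bmat" using that nil by blast
    then have "mpow x CARD('n + 'n) $ i $ j = 0" for i j
      by (intro poly_fun_vanish_closure[OF poly_funs_mpow _ x]) (simp only: zero_index)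
    then have "mpow x CARD('n + 'n) = 0" by (simp only: vec_eq_iff zero_index simp_thms)
    ultimately have "homog \<tau> x" "nilpotent_matrix x" by (auto simp: homog_def nil)
    then show ?thesis by simp
  qed
  then have "zariski closure_of ?N = ?N" using subset_zariski_closure[of ?N] by blast
  then show ?thesis using closedin_zariski_closure[of ?N] by simp
qed

lemma closedin_N_k: "closedin zariski N_k" and closedin_N_s: "closedin zariski N_s"
  using closedin_nilpotent[of True] closedin_nilpotent[of False]
  by (simp_all add: N_k_def N_s_def homog_True homog_False)

text \<open>The block diagonal part of \<open>lift\<close> at \<open>\<delta> = 0\<close> is regular
  nilpotent in both blocks. Its conjugates lie in the image, and every nilpotent block diagonal
  matrix, once triangular, is a limit of them.\<close>

lemma N_Xk_eq: "N_Xk = (N_k :: ('n::finite) bmat set)"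
proof (rule antisym)
  have "diag_part ` square_zero \<subseteq> (N_k :: 'n bmat set)" by (auto simp: square_zero_def N_k_def)
  then show "N_Xk \<subseteq> (N_k :: 'n bmat set)"
    unfolding N_Xk_def conormal_images using closedin_N_k by (rule closure_of_minimal)
  let ?\<delta> = "\<lambda>_ :: sign. 0 :: nat" and ?z0 = "diag_part (lift (\<lambda>_. 0)) :: 'n bmat"
  have lev0: "lev ?\<delta> = num" by (simp add: lev_def fun_eq_iff)
  have "lowers (lev ?\<delta>) 1 ?z0" by (auto simp: lowers_def diag_part_nth lift_nth split: if_splits)
  moreover have "\<forall>i j. nxt True ?\<delta> i j \<longrightarrow> ?z0 $ i $ j \<noteq> 0"
    by (auto simp: nxt_def diag_part_nth lift_nth)
  ultimately obtain g0 where g0: "g0 \<in> K" "conj_by g0 (std True ?\<delta>) = ?z0"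
    using normal_form[of ?\<delta> True ?z0] by (auto simp: homog_True)
  show "(N_k :: 'n bmat set) \<subseteq> N_Xk"
  proof
    fix z :: "'n bmat" assume z: "z \<in> N_k"
    then obtain g where g: "g \<in> K" "conj_by (matrix_inv g) z \<in> lie_k"
      "lowers num 1 (conj_by (matrix_inv g) z)"
      using nilpotent_lie_k_triangular unfolding N_k_def by blast
    have orb: "conj_by h (std True ?\<delta>) \<in> diag_part ` square_zero" if "h \<in> K" for h :: "'n bmat"
    proof -
      have h': "h ** matrix_inv g0 \<in> K" using that g0(1) by (intro K_mult K_inv)
      have "std True ?\<delta> = conj_by (matrix_inv g0) ?z0" using g0 by (metis K_invertible conj_by_inv(2))
      then have "conj_by h (std True ?\<delta>) = conj_by (h ** matrix_inv g0) ?z0"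
        using that g0(1) by (simp add: conj_by_conj_by K_invertible K_inv)
      also have "\<dots> = diag_part (conj_by (h ** matrix_inv g0) (lift ?\<delta>))"
        using h' by (simp add: diag_part_conj_by)
      finally show ?thesis using conj_by_square_zero[OF h' lift_square_zero[of ?\<delta>]] by auto
    qed
    have "conj_by (matrix_inv g) z \<in> zariski closure_of (diag_part ` square_zero)"
      by (rule closure_normal_form[of ?\<delta> True]) (use g orb in \<open>auto simp: homog_True lev0\<close>)
    then have "conj_by g (conj_by (matrix_inv g) z) \<in> zariski closure_of (diag_part ` square_zero)"
    proof (rule closure_conj_by)
      fix s :: "'n bmat" assume "s \<in> diag_part ` square_zero"
      then have "conj_by g s \<in> diag_part ` square_zero"
        using g(1) by (auto simp: diag_part_conj_by[symmetric] intro!: imageI conj_by_square_zero)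
      then show "conj_by g s \<in> zariski closure_of (diag_part ` square_zero)"
        using subset_zariski_closure by (metis subsetD)
    qed
    then show "z \<in> N_Xk" using g(1) by (simp add: N_Xk_def conormal_images conj_by_inv K_invertible)
  qed
qed

section \<open>Orbits as images of rational maps\<close>

lemma det_matrix_inv_poly:
  "\<exists>P\<in>poly_funs. \<forall>h :: complex^('m::finite)^'m. det h \<noteq> 0 \<longrightarrow> det h * matrix_inv h $ i $ j = P h"
proof (intro bexI allI impI)
  let ?M = "\<lambda>h :: complex^'m^'m. \<chi> a b. if b = i then (axis j 1 :: complex^'m) $ a else h $ a $ b"
  show "(\<lambda>h. det (?M h)) \<in> poly_funs"
  proof (rule poly_funs_det)
    fix a b show "(\<lambda>h. ?M h $ a $ b) \<in> poly_funs" by (cases "b = i") (simp_all add: poly_funs.intros)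
  qed
  fix h :: "complex^'m^'m" assume "det h \<noteq> 0"
  then have "h *v (matrix_inv h *v axis j 1) = axis j 1"
    by (simp add: matrix_vector_mul_assoc matrix_inv_mul invertible_det_nz)
  \<comment> \<open>Cramer's rule: the numerator is the determinant with column \<open>i\<close>
    replaced by a unit vector.\<close>
  with cramer_lemma[of i h "matrix_inv h *v axis j 1"]
  have "det (?M h) = (matrix_inv h *v axis j 1) $ i * det h" by (simp only:)
  then show "det h * matrix_inv h $ i $ j = det (?M h)" by (simp add: matrix_vector_axis)
qed

lemma rational_map_conj:
  fixes y0 :: "('n::finite) bmat" and D :: "'n bmat set"
  assumes "\<And>u v c. u \<in> D \<Longrightarrow> v \<in> D \<Longrightarrow> line u (v - u) c \<in> D"
  shows "rational_map D det (\<lambda>h. matrix_inv h ** y0 ** h)"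
proof
  show "det \<in> poly_funs" using poly_funs_det[OF poly_funs.coord] by (simp add: eta_contract_eq)
  fix i j
  have "\<forall>k. \<exists>P\<in>poly_funs. \<forall>h :: 'n bmat. det h \<noteq> 0 \<longrightarrow> det h * matrix_inv h $ i $ k = P h"
    using det_matrix_inv_poly by blast
  then obtain P where P: "\<And>k. P k \<in> poly_funs"
    "\<And>k h :: 'n bmat. det h \<noteq> 0 \<Longrightarrow> det h * matrix_inv h $ i $ k = P k h"
    by metis
  show "\<exists>Q\<in>poly_funs. \<forall>h\<in>D. det h \<noteq> 0 \<longrightarrow> det h * (matrix_inv h ** y0 ** h) $ i $ j = Q h"
  proof (intro bexI ballI impI)
    show "(\<lambda>h. \<Sum>k\<in>UNIV. (\<Sum>l\<in>UNIV. P l h * y0 $ l $ k) * h $ k $ j) \<in> poly_funs"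
      by (intro poly_funs_intros P)
    fix h :: "'n bmat" assume "det h \<noteq> 0"
    then show "det h * (matrix_inv h ** y0 ** h) $ i $ j
      = (\<Sum>k\<in>UNIV. (\<Sum>l\<in>UNIV. P l h * y0 $ l $ k) * h $ k $ j)"
      by (simp add: matrix_mult_nth sum_distrib_left sum_distrib_right P(2)[symmetric] mult_ac)
  qed
qed (rule assms)

text \<open>Parametrizing by the inverse \<open>h\<close> of the conjugating matrix turns membership
  into the relation \<open>h ** y = std False \<delta> ** h\<close>, which is linear in
  \<open>h\<close>.\<close>

lemma orb_image: "(orb \<delta> :: ('n::finite) bmat set)
  = (\<lambda>h. matrix_inv h ** std False \<delta> ** h) ` {h \<in> lie_k. det h \<noteq> 0}"
proof -
  have K: "(K :: 'n bmat set) = {h \<in> lie_k. det h \<noteq> 0}" by (auto simp: K_iff invertible_det_nz)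
  have conj: "matrix_inv h ** x ** h = conj_by (matrix_inv h) x" if "h \<in> K" for h x :: "'n bmat"
    using that by (simp add: conj_by_def matrix_inv_inv K_invertible)
  show ?thesis unfolding K[symmetric]
  proof (intro equalityI subsetI)
    fix x :: "'n bmat" assume "x \<in> orb \<delta>"
    then obtain g where g: "g \<in> K" "x = conj_by g (std False \<delta>)" by (auto simp: orb_def)
    then have "x = matrix_inv (matrix_inv g) ** std False \<delta> ** matrix_inv g"
      by (simp add: conj_by_def matrix_inv_inv K_invertible)
    then show "x \<in> (\<lambda>h. matrix_inv h ** std False \<delta> ** h) ` K" using K_inv[OF g(1)] by (rule image_eqI)
  next
    fix x :: "'n bmat" assume "x \<in> (\<lambda>h. matrix_inv h ** std False \<delta> ** h) ` K"
    then show "x \<in> orb \<delta>" using K_inv by (auto simp: orb_def conj)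
  qed
qed

lemma irreducible_orb: "irreducible_in zariski (orb \<delta> :: ('n::finite) bmat set)"
proof -
  interpret rational_map "lie_k :: 'n bmat set" det "\<lambda>h. matrix_inv h ** std False \<delta> ** h"
    by (rule rational_map_conj) (simp add: lie_k_sg)
  show ?thesis unfolding orb_image
    by (rule irreducible_image) (use K_1 in \<open>auto simp: K_iff invertible_det_nz\<close>)
qed

subsection \<open>Flags attached to the elements of the image\<close>

declare V.simps [simp del]

text \<open>In the notation above, \<open>r = n - p - q\<close>, and \<open>A\<close>, \<open>B\<close> are flags between the intersections of
  \<open>W\<close> with \<open>V\<^sup>+\<close>, \<open>V\<^sup>-\<close> and the projections of \<open>W\<close> to them.\<close>
definition is_flag :: "sign \<Rightarrow> nat \<Rightarrow> nat \<Rightarrow> nat \<Rightarrow> ('n::finite) bmat \<Rightarrow> (nat \<Rightarrow> 'n bvec set) \<Rightarrow> (nat \<Rightarrow> 'n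
  bvec set) \<Rightarrow> bool" where
  "is_flag s p q r y A B \<longleftrightarrow>
    (\<forall>i\<le>r. vec.subspace (A i) \<and> vec.dim (A i) = p + i) \<and> A r \<subseteq> V s \<and>
    (\<forall>i\<le>r. vec.subspace (B i) \<and> vec.dim (B i) = q + i) \<and> B r \<subseteq> V (flip_sign s) \<and>
    (\<forall>i<r. A i \<subseteq> A (Suc i) \<and> B i \<subseteq> B (Suc i)) \<and>
    (\<forall>v\<in>A 0 \<union> B 0. y *v v = 0) \<and>
    (\<forall>i<r. \<forall>v\<in>A (Suc i). y *v v \<in> B i) \<and> (\<forall>i<r. \<forall>v\<in>B (Suc i). y *v v \<in> A i) \<and>
    (\<forall>v\<in>V s. y *v v \<in> B r) \<and> (\<forall>v\<in>V (flip_sign s). y *v v \<in> A r)"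

text \<open>The same condition in terms of matrix entries, for coordinate flags.\<close>
definition entry :: "sign \<Rightarrow> nat \<Rightarrow> nat \<Rightarrow> nat \<Rightarrow> ('n::finite) bmat \<Rightarrow> bool" where
  "entry s p q r y \<longleftrightarrow> homog False y \<and> (\<forall>i j. y $ i $ j \<noteq> 0 \<longrightarrow>
     (if sg j = s then p \<le> num j \<and> num i + p < q + num j \<and> num i < q + r
      else q \<le> num j \<and> num i + q < p + num j \<and> num i < p + r))"

lemma entry_flip: "entry s p q r y \<longleftrightarrow> entry (flip_sign s) q p r y"
proof -
  have "sg j = flip_sign s \<longleftrightarrow> sg j \<noteq> s" for j :: "'a + 'a" using neq_sign_iff by metis
  then show ?thesis by (auto simp: entry_def)
qed

definition proj :: "sign \<Rightarrow> ('n::finite) bmat" where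
  "proj s = (\<chi> i j. if i = j \<and> sg i = s then 1 else 0)"

lemma proj_nth: "(proj s *v v) $ i = (if sg i = s then v $ i else 0)"
proof -
  have "(proj s *v v) $ i = (\<Sum>k\<in>UNIV. if k = i then (if sg i = s then v $ i else 0) else 0)"
    unfolding matrix_vector_nth by (rule sum.cong) (auto simp: proj_def)
  then show ?thesis by simp
qed

lemma proj_V: "proj s *v v \<in> V s"
  by (auto simp: V_sg proj_nth vec_eq_iff)

lemma proj_sum: "v = proj s *v v + proj (flip_sign s) *v v"
  by (auto simp: vec_eq_iff proj_nth) (metis neq_sign_iff)+

lemma proj_parts:
  assumes "v \<in> V s"
  shows "proj s *v (x *v v) = diag_part x *v v" "proj (flip_sign s) *v (x *v v) = offdiag_part x *v v"
proof -
  have *: "x $ i $ k * v $ k = (if sg i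
    = s then diag_part x else offdiag_part x) $ i $ k * v $ k" for i k
    using assms by (auto simp: V_sg diag_part_nth offdiag_part_nth)
  have "(diag_part x *v v) $ i = 0" if "sg i \<noteq> s" for i
    using lie_k_vec[OF diag_part_in assms] that by (simp add: V_sg)
  moreover have "(offdiag_part x *v v) $ i = 0" if "sg i = s" for i
    using space_s_vec[OF offdiag_part_in assms, of x] that by (auto simp: V_sg)
  moreover have "(x *v v) $ i = ((if sg i = s then diag_part x else offdiag_part x) *v v) $ i" for i
    unfolding matrix_vector_nth by (rule sum.cong) (auto simp: * split: if_splits)
  ultimately show "proj s *v (x *v v) = diag_part x *v v"
    "proj (flip_sign s) *v (x *v v) = offdiag_part x *v v"
    by (auto simp: vec_eq_iff proj_nth neq_sign_iff)
qed

lemma square_zero_flag: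
  fixes x :: "('n::finite) bmat"
  assumes x: "x \<in> square_zero"
  shows "\<exists>p q r A B. p + q + r = CARD('n) \<and> is_flag Plus p q r (offdiag_part x) A B"
proof -
  let ?z = "diag_part x" and ?y = "offdiag_part x"
  let ?P = "proj Plus :: 'n bmat" and ?M = "proj Minus :: 'n bmat"
  have xx: "x ** x = 0" and nil: "nilpotent_matrix ?z" using x by (auto simp: square_zero_def)
  obtain W where W: "vec.subspace W" "vec.dim W = CARD('n)" "range ((*v) x) \<subseteq> W" "W \<subseteq> {w. x *v w = 0}"
    by (rule square_zero_subspace[OF xx])
  have xW: "x *v v \<in> W" for v using W(3) by auto
  have kerW: "x *v w = 0" if "w \<in> W" for w using W(4) that by auto
  have Pz: "?P *v (x *v v) = ?z *v v" "?M *v (x *v v) = ?y *v v" if "v \<in> V Plus" for v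
    using proj_parts[OF that, of x] by simp_all
  have Pm: "?P *v (x *v v) = ?y *v v" "?M *v (x *v v) = ?z *v v" if "v \<in> V Minus" for v
    using proj_parts[OF that, of x] by simp_all
  have psum: "w = ?P *v w + ?M *v w" for w using proj_sum[of w Plus] by simp
  define A0 where "A0 = {w \<in> W. ?M *v w = 0}"
  define Ar where "Ar = (*v) ?P ` W"
  define q where "q = vec.dim {w \<in> W. ?P *v w = 0}"
  have sub_ker: "vec.subspace {w \<in> U. m *v w = 0}" if "vec.subspace U" for U and m :: "'n bmat"
    using that by (auto simp: vec.subspace_def matrix_vector_right_distrib vector_scalar_commute)
  have A0: "vec.subspace A0" unfolding A0_def by (rule sub_ker[OF W(1)])
  have Ar: "vec.subspace Ar" unfolding Ar_def
    by (intro vec.subspace_image matrix_vector_mul_linear_gen W)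
  have A0_P: "?P *v w = w" if "w \<in> A0" for w using that psum[of w] by (simp add: A0_def)
  have A0Ar: "A0 \<subseteq> Ar" using A0_P by (force simp: A0_def Ar_def image_iff)
  have ArV: "Ar \<subseteq> V Plus" using proj_V by (auto simp: Ar_def)
  have zAr: "?z *v v \<in> Ar" if "v \<in> V Plus" for v
    using xW[of v] Pz(1)[OF that] unfolding Ar_def by (metis imageI)
  have zA0: "?z *v v = 0" "?y *v v = 0" if "v \<in> A0" for v
  proof -
    have v: "v \<in> V Plus" "v \<in> W" using that A0Ar ArV by (auto simp: A0_def)
    then show "?z *v v = 0" "?y *v v = 0" using Pz[OF v(1)] kerW[OF v(2)] by simp_all
  qed
  define r where "r = vec.dim Ar - vec.dim A0"
  have d: "vec.dim Ar = vec.dim A0 + r" using vec.dim_subset[OF A0Ar] by (simp add: r_def)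
  obtain A where A: "A 0 = A0" "A r = Ar"
    "\<And>i. i \<le> r \<Longrightarrow> vec.subspace (A i) \<and> vec.dim (A i) = vec.dim A0 + i \<and> A i \<subseteq> Ar"
     "\<And>i. i < r \<Longrightarrow> A i \<subseteq> A (Suc i)" "\<And>i v. i < r \<Longrightarrow> v \<in> A (Suc i) \<Longrightarrow> ?z *v v \<in> A i"
  proof -
    have "?z *v v \<in> Ar" if "v \<in> Ar" for v using that zAr ArV by blast
    moreover have "?z *v v \<in> A0" if "v \<in> A0" for v using zA0(1)[OF that] vec.subspace_0[OF A0] by simp
    ultimately obtain A where "A 0 = A0 \<and> A r = Ar \<and>
      (\<forall>i\<le>r. vec.subspace (A i) \<and> vec.dim (A i) = vec.dim A0 + i \<and> A i \<subseteq> Ar) \<and>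
      (\<forall>i<r. A i \<subseteq> A (Suc i) \<and> (\<forall>v\<in>A (Suc i). ?z *v v \<in> A i))"
      using nilpotent_flag[OF Ar _ nil A0 A0Ar _ d] by blast
    then show ?thesis by (intro that[of A]) auto
  qed
  \<comment> \<open>The lift of the flag through \<open>W\<close>: for \<open>v\<close> in
    \<open>A (Suc i)\<close> the vector \<open>x *v v\<close> lies in \<open>W\<close> and its
    \<open>Plus\<close> component \<open>?z *v v\<close> lies in \<open>A i\<close>, so
    \<open>?y *v v\<close> falls into \<open>B i\<close>.\<close>
  define W' where "W' i = {w \<in> W. ?P *v w \<in> A i}" for i
  define B where "B i = (*v) ?M ` W' i" for i
  have A0A: "A0 \<subseteq> A i" if "i \<le> r" for i
    using that
  proof (induction i)
    case (Suc i)
    then show ?case using A(4)[of i] by auto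
  qed (simp add: A(1))
  have W': "vec.subspace (W' i)" if "i \<le> r" for i
    using W(1) A(3)[OF that] unfolding W'_def
    by (auto simp: vec.subspace_def matrix_vector_right_distrib vector_scalar_commute)
  \<comment> \<open>Rank-nullity for both projections of \<open>W' i\<close>: onto
    \<open>A i\<close> with kernel of dimension \<open>q\<close>, and onto \<open>B i\<close> with
    kernel \<open>A0\<close>.\<close>
  have dimB: "vec.dim (B i) = q + i" if "i \<le> r" for i
  proof -
    have "(*v) ?P ` W' i = A i" using A(3)[OF that] by (auto simp: W'_def Ar_def)
    moreover have "{w \<in> W' i. ?P *v w = 0} = {w \<in> W. ?P *v w = 0}"
      using A(3)[OF that] vec.subspace_0[of "A i"] by (auto simp: W'_def)
    ultimately have "vec.dim (W' i) = vec.dim A0 + i + q"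
      using rank_nullity[OF W'[OF that], of ?P] A(3)[OF that] by (simp add: q_def)
    moreover have "{w \<in> W' i. ?M *v w = 0} = A0"
    proof (intro equalityI subsetI)
      fix w assume w: "w \<in> A0"
      then have "?P *v w \<in> A i" using A0_P[OF w] A0A[OF that] by auto
      then show "w \<in> {w \<in> W' i. ?M *v w = 0}" using w by (simp add: W'_def A0_def)
    qed (auto simp: W'_def A0_def)
    ultimately show ?thesis using rank_nullity[OF W'[OF that], of ?M] by (simp add: B_def)
  qed
  have card: "vec.dim A0 + q + r = CARD('n)"
    using rank_nullity[OF W(1), of ?P] W(2) d by (simp add: q_def Ar_def)
  have BV: "B i \<subseteq> V Minus" for i using proj_V by (auto simp: B_def)
  have xM: "x *v (?M *v w) = - (x *v (?P *v w))" if "w \<in> W" for w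
  proof -
    have "x *v (?P *v w + ?M *v w) = 0" using psum[of w] kerW[OF that] by simp
    then show ?thesis by (simp add: matrix_vector_right_distrib add_eq_0_iff)
  qed
  \<comment> \<open>Since \<open>x\<close> kills \<open>W\<close>, the images of the two components
    of \<open>w\<close> cancel. Their \<open>Plus\<close> components are \<open>?y\<close> on the
    \<open>Minus\<close> side and \<open>?z\<close> on the \<open>Plus\<close> side, so the action
    of \<open>?y\<close> on \<open>B\<close> is controlled by \<open>?z\<close> on
    \<open>A\<close>.\<close>
  have yB: "?y *v (?M *v w) = - (?z *v (?P *v w))" if "w \<in> W" for w
  proof -
    have "?y *v (?M *v w) = ?P *v (x *v (?M *v w))" using Pm(1)[OF proj_V] by simp
    also have "\<dots> = ?P *v (- (x *v (?P *v w)))" using xM[OF that] by simp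
    also have "\<dots> = - (?P *v (x *v (?P *v w)))" by (simp add: matrix_vector_mult_def vec_eq_iff sum_negf)
    also have "\<dots> = - (?z *v (?P *v w))" using Pz(1)[OF proj_V] by simp
    finally show ?thesis .
  qed
  have neg: "- v \<in> A i" if "v \<in> A i" "i \<le> r" for v i using that A(3)[OF that(2)] vec.subspace_neg
    by blast
  have "is_flag Plus (vec.dim A0) q r ?y A B"
    unfolding is_flag_def
  proof (intro conjI allI impI ballI)
    show "vec.subspace (A i)" "vec.dim (A i) = vec.dim A0 + i" if "i \<le> r" for i using A(3)[OF that]
      by auto
    show "A r \<subseteq> V Plus" using A(2) ArV by simp
    show "vec.subspace (B i)" "vec.dim (B i) = q + i" if "i \<le> r" for i
      using dimB[OF that] W'[OF that]
        by (auto simp: B_def intro!: vec.subspace_image matrix_vector_mul_linear_gen)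
    show "B r \<subseteq> V (flip_sign Plus)" using BV by simp
    show "A i \<subseteq> A (Suc i)" "B i \<subseteq> B (Suc i)" if "i < r" for i
      using A(4)[OF that] by (auto simp: B_def W'_def)
    show "?y *v v = 0" if v: "v \<in> A 0 \<union> B 0" for v
    proof (cases "v \<in> A0")
      case True
      then show ?thesis by (rule zA0(2))
    next
      case False
      then obtain w where w: "w \<in> W" "?P *v w \<in> A0" "v = ?M *v w" using v
        by (auto simp: A(1) B_def W'_def)
      then show ?thesis using yB[OF w(1)] zA0(1)[OF w(2)] by simp
    qed
    show "?y *v v \<in> B i" if "i < r" "v \<in> A (Suc i)" for i v
    proof -
      have v: "v \<in> V Plus" using that A(3)[of "Suc i"] ArV by auto
      have "x *v v \<in> W' i" using xW Pz(1)[OF v] A(5)[OF that] by (simp add: W'_def)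
      then show ?thesis unfolding B_def using Pz(2)[OF v] by (metis imageI)
    qed
    show "?y *v v \<in> A i" if i: "i < r" and v: "v \<in> B (Suc i)" for i v
    proof -
      obtain w where w: "w \<in> W" "?P *v w \<in> A (Suc i)" "v = ?M *v w" using v by (auto simp: B_def W'_def)
      then show ?thesis using yB[OF w(1)] A(5)[OF i w(2)] neg i by simp
    qed
    show "?y *v v \<in> B r" if "v \<in> V Plus" for v
    proof -
      have "x *v v \<in> W' r" using xW Pz(1)[OF that] zAr[OF that] A(2) by (simp add: W'_def)
      then show ?thesis unfolding B_def using Pz(2)[OF that] by (metis imageI)
    qed
    show "?y *v v \<in> A r" if "v \<in> V (flip_sign Plus)" for v
      using Pm(1)[of v] that xW[of v] unfolding A(2) Ar_def by (metis flip_sign.simps(1) imageI)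
  qed
  then show ?thesis using card by blast
qed

text \<open>In bases adapted to both flags the flag conditions become the inequalities between
  indices that \<open>entry\<close> records.\<close>

lemma flag_entry:
  fixes y :: "('n::finite) bmat"
  assumes fl: "is_flag s p q r y A B" and n: "p + q + r = CARD('n)" and y: "y \<in> space_s"
  shows "\<exists>g\<in>K. entry s p q r (conj_by (matrix_inv g) y)"
proof -
  have A: "\<And>i. i \<le> r \<Longrightarrow> vec.subspace (A i) \<and> vec.dim (A i) = p + i"
    "\<And>i. i < r \<Longrightarrow> A i \<subseteq> A (Suc i)" "A r \<subseteq> V s"
    and B: "\<And>i. i \<le> r \<Longrightarrow> vec.subspace (B i) \<and> vec.dim (B i) = q + i"
      "\<And>i. i < r \<Longrightarrow> B i \<subseteq> B (Suc i)" "B r \<subseteq> V (flip_sign s)"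
    and y0: "\<And>v. v \<in> A 0 \<Longrightarrow> y *v v = 0" "\<And>v. v \<in> B 0 \<Longrightarrow> y *v v = 0"
    and yA: "\<And>i v. i < r \<Longrightarrow> v \<in> A (Suc i) \<Longrightarrow> y *v v \<in> B i" and yB:
      "\<And>i v. i < r \<Longrightarrow> v \<in> B (Suc i) \<Longrightarrow> y *v v \<in> A i"
    and yV: "\<And>v. v \<in> V s \<Longrightarrow> y *v v \<in> B r" "\<And>v. v \<in> V (flip_sign s) \<Longrightarrow> y *v v \<in> A r"
    using fl unfolding is_flag_def by blast+
  obtain a where a: "\<And>i. i \<le> r \<Longrightarrow> A i = vec.span (a ` {..<p + i})" "V s = vec.span (a ` {..<CARD('n)})"
    using adapted_basis[of r A p "V s" "CARD('n)"] A subspace_V dim_V by blast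
  obtain b where b: "\<And>i. i \<le> r \<Longrightarrow>
    B i = vec.span (b ` {..<q + i})" "V (flip_sign s) = vec.span (b ` {..<CARD('n)})"
    using adapted_basis[of r B q "V (flip_sign s)" "CARD('n)"] B subspace_V dim_V by blast
  define c where "c t = (if t = s then a else b)" for t
  have "V t = vec.span (c t ` {..<CARD('n)})" for t
    using a(2) b(2) neq_sign_iff[of t s] by (auto simp: c_def)
  from graded_basis[OF this] obtain g where g: "g \<in> K"
    and co: "\<And>z i j l t. z *v c (sg j) (num j) \<in> vec.span (c t ` {..<l}) \<Longrightarrow> l \<le> CARD('n) \<Longrightarrow>
       conj_by (matrix_inv g) z $ i $ j \<noteq> 0 \<Longrightarrow> sg i = t \<and> num i < l" by blast
  have span: "e k \<in> vec.span (e ` {..<m})" if "k < m" for e k m using that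
    by (auto intro: vec.span_base)
  have main: "P \<le> num j \<and> num i + P < Q + num j \<and> num i < Q + r"
    if nz: "conj_by (matrix_inv g) y $ i $ j \<noteq> 0" and t: "sg j = t" "t' = flip_sign t"
      and n': "P + Q + r = CARD('n)"
      and F: "\<And>i. i \<le> r \<Longrightarrow> F i = vec.span (c t ` {..<P + i})" and F':
        "\<And>i. i \<le> r \<Longrightarrow> F' i = vec.span (c t' ` {..<Q + i})"
      and z: "\<And>v. v \<in> F 0 \<Longrightarrow> y *v v = 0" and yF: "\<And>i v. i < r \<Longrightarrow> v \<in> F (Suc i) \<Longrightarrow> y *v v \<in> F' i"
      and yVt: "\<And>v. v \<in> V t \<Longrightarrow> y *v v \<in> F' r" and Vt: "V t = vec.span (c t ` {..<CARD('n)})"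
    for i j t t' P Q F F'
  proof -
    have cj: "y *v c (sg j) (num j) \<in> vec.span (c t' ` {..<l}) \<Longrightarrow> l \<le> CARD('n) \<Longrightarrow> num i < l" for l
      using co[of y j t' l i] nz by blast
    have 1: "P \<le> num j"
    proof (rule ccontr)
      assume "\<not> P \<le> num j"
      then have "c t (num j) \<in> F 0" using span[of "num j" P "c t"] F[of 0] by simp
      then have "y *v c (sg j) (num j) \<in> vec.span (c t' ` {..<0})" using z t by simp
      from cj[OF this] show False by simp
    qed
    have "c t (num j) \<in> V t" using span[OF num_less[of j], of "c t"] Vt by simp
    then have "y *v c (sg j) (num j) \<in> vec.span (c t' ` {..<Q + r})" using yVt t F'[of r] by auto
    from cj[OF this] have 2: "num i < Q + r" using n' by simp
    have "num i + P < Q + num j"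
    \<comment> \<open>Inside the flag the basis vector lies in some \<open>F (Suc k)\<close> and
      drops to \<open>F' k\<close>. Beyond its end the bound by \<open>Q + r\<close> is already
      enough.\<close>
    proof (cases "num j < P + r")
      case True
      define k where "k = num j - P"
      have k: "num j = P + k" "k < r" using True 1 by (auto simp: k_def)
      have "c t (num j) \<in> F (Suc k)" using span[of "num j" "P + Suc k" "c t"] F[of "Suc k"] k by simp
      then have "y *v c (sg j) (num j) \<in> vec.span (c t' ` {..<Q + k})"
        using yF[OF k(2)] t F'[of k] k by auto
      from cj[OF this] k n' show ?thesis by simp
    next
      case False
      then show ?thesis using 2 by simp
    qed
    with 1 2 show ?thesis by simp
  qed
  have ys: "conj_by (matrix_inv g) y \<in> space_s" using conj_by_space_s[OF K_inv[OF g] y] .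
  have "entry s p q r (conj_by (matrix_inv g) y)"
    unfolding entry_def homog_False
  proof (intro conjI allI impI ys)
    fix i j assume nz: "conj_by (matrix_inv g) y $ i $ j \<noteq> 0"
    show "if sg j = s then p \<le> num j \<and> num i + p < q + num j \<and> num i < q + r
      else q \<le> num j \<and> num i + q < p + num j \<and> num i < p + r"
    proof (cases "sg j = s")
      case True
      have "p \<le> num j \<and> num i + p < q + num j \<and> num i < q + r"
        by (rule main[of i j s "flip_sign s" p q A B, OF nz True refl n])
          (use a b y0 yA yV in \<open>auto simp: c_def\<close>)
      then show ?thesis using True by simp
    next
      case False
      then have s: "sg j = flip_sign s" using neq_sign_iff by blast
      have "q \<le> num j \<and> num i + q < p + num j \<and> num i < p + r"
        by (rule main[of i j "flip_sign s" s q p B A, OF nz s])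
          (use a b y0 yB yV n in \<open>auto simp: c_def\<close>)
      then show ?thesis using False by simp
    qed
  qed
  then show ?thesis using g by blast
qed

section \<open>Coordinate flags and their refinement\<close>

definition coord_space :: "sign \<Rightarrow> nat \<Rightarrow> ('n::finite) bvec set" where
  "coord_space s m = {v. \<forall>j. v $ j \<noteq> 0 \<longrightarrow> sg j = s \<and> num j < m}"

lemma subspace_coord_space: "vec.subspace (coord_space s m)"
proof (rule vec.subspaceI)
  fix x y :: "'a bvec" assume "x \<in> coord_space s m" "y \<in> coord_space s m"
  then show "x + y \<in> coord_space s m" unfolding coord_space_def by auto (metis add.right_neutral)+
qed (auto simp: coord_space_def)

lemma dim_coord_space: "m \<le> CARD('n::finite) \<Longrightarrow> vec.dim (coord_space s m :: 'n bvec set) = m"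
proof -
  assume m: "m \<le> CARD('n)"
  have "(coord_space s m :: 'n bvec set) = {v. \<forall>i. i \<notin> {j. sg j = s \<and> num j < m} \<longrightarrow> v $ i = 0}"
    by (auto simp: coord_space_def)
  then have "vec.dim (coord_space s m :: 'n bvec set) = card {j :: 'n + 'n. sg j = s \<and> num j < m}"
    by (simp only: dim_substandard_cart)
  also have "{j :: 'n + 'n. sg j = s \<and> num j < m} = idx s ` {..<m}"
  proof (intro equalityI subsetI)
    fix j :: "'n + 'n" assume "j \<in> {j. sg j = s \<and> num j < m}"
    then show "j \<in> idx s ` {..<m}" using idx_unique[of j] by (intro image_eqI[of _ _ "num j"]) auto
  next
    fix j :: "'n + 'n" assume "j \<in> idx s ` {..<m}"
    then obtain k where "j = idx s k" "k < m" by auto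
    then show "j \<in> {j. sg j = s \<and> num j < m}" using idx[of k s, where 'n = 'n] m by simp
  qed
  also have "card \<dots> = m"
    using idx(2)[where 'n = 'n and s = s] m
      by (subst card_image) (auto intro!: inj_on_inverseI[of _ num])
  finally show ?thesis .
qed

lemma coord_space_mono: "m \<le> m' \<Longrightarrow> coord_space s m \<subseteq> coord_space s m'"
  by (auto simp: coord_space_def)

lemma coord_space_V: "coord_space s m \<subseteq> V s"
  by (auto simp: coord_space_def V_sg)

text \<open>The way back from entries to coordinate flags. At \<open>i = 0\<close> the truncated
  \<open>q + i - 1\<close> is harmless, since \<open>y\<close> kills
  \<open>coord_space s p\<close>.\<close>

lemma entry_maps:
  fixes y :: "('n::finite) bmat"
  assumes e: "entry s p q r y"
  shows "v \<in> coord_space s (p + i) \<Longrightarrow> y *v v \<in> coord_space (flip_sign s) (q + i - 1)"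
    "v \<in> coord_space s p \<Longrightarrow> y *v v = 0"
    "v \<in> V s \<Longrightarrow> y *v v \<in> coord_space (flip_sign s) (q + r)"
proof -
  have key: "\<exists>j. y $ k $ j \<noteq> 0 \<and> v $ j \<noteq> 0" if "(y *v v) $ k \<noteq> 0" for v k
  proof (rule ccontr)
    assume "\<nexists>j. y $ k $ j \<noteq> 0 \<and> v $ j \<noteq> 0"
    then have "(y *v v) $ k = 0" unfolding matrix_vector_nth by (intro sum.neutral) auto
    then show False using that by simp
  qed
  have sgn: "sg k = flip_sign (sg j)" if "y $ k $ j \<noteq> 0" for k j
    using e that neq_sign_iff by (auto simp: entry_def homog_def)
  have ent: "p \<le> num j \<and> num k + p < q + num j \<and> num k < q + r" if "y $ k $ j \<noteq> 0" "sg j = s" for k j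
    using e that by (auto simp: entry_def)
  show "v \<in> coord_space s (p + i) \<Longrightarrow> y *v v \<in> coord_space (flip_sign s) (q + i - 1)"
    unfolding coord_space_def using key[of v] sgn ent by (fastforce)
  show "v \<in> coord_space s p \<Longrightarrow> y *v v = 0"
    unfolding vec_eq_iff coord_space_def using key[of v] ent by fastforce
  show "v \<in> V s \<Longrightarrow> y *v v \<in> coord_space (flip_sign s) (q + r)"
    unfolding coord_space_def V_sg using key[of v] sgn ent by fastforce
qed


text \<open>For 0 < k < r the basis vector q + k of the opposite sign goes to the vector p + k - 1
  of sign \<open>s\<close>. Nonzero entries of \<open>y\<close> at these places make it an
  isomorphism from the k-th step of the \<open>B\<close> flag, B_(k+1) / B_k, to A_k /
  A_(k-1).\<close>

definition regularizer :: "sign \<Rightarrow> nat \<Rightarrow> nat \<Rightarrow> nat \<Rightarrow> ('n::finite) bmat" where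
  "regularizer s p q r = (\<chi> i j. if sg i = s \<and> sg j \<noteq> s \<and> q < num j \<and> num j < q + r \<and>
    num i + q + 1 = num j + p
     then 1 else 0)"

lemma regularizer_nth: "regularizer s p q r $ i $ j =
    (if sg i = s \<and> sg j \<noteq> s \<and> q < num j \<and> num j < q + r \<and> num i + q + 1 = num j + p then 1 else 0)"
  by (simp add: regularizer_def)

lemma entry_line_regularizer:
  assumes "entry s p q r y"
  shows "entry s p q r (line y (regularizer s p q r) c)"
proof -
  have "entry s p q r (regularizer s p q r)"
    by (auto simp: entry_def homog_def regularizer_nth)
  then show ?thesis using assms unfolding entry_def homog_def line_nth
    by (metis add.right_neutral mult_zero_right)
qed

text \<open>The key vector: for regular \<open>y\<close> the flag can be refined by a vector outside \<open>B\<^sub>r\<close> that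
  \<open>y\<close> maps into \<open>A\<^sub>0\<close>.\<close>
lemma refining_vector:
  fixes y :: "('n::finite) bmat"
  assumes e: "entry s p q r y" and n: "p + q + r = CARD('n)" and p: "2 \<le> p"
    and reg: "\<And>i j. regularizer s p q r $ i $ j \<noteq> (0 :: complex) \<Longrightarrow> y $ i $ j \<noteq> 0"
  shows "\<exists>f\<in>V (flip_sign s). f \<notin> coord_space (flip_sign s) (q + r) \<and> y *v f \<in> coord_space s p"
proof -
  let ?t = "flip_sign s"
  have e': "entry ?t q p r y" using e entry_flip by blast
  have yV: "y *v v \<in> coord_space s (p + r)" if "v \<in> V ?t" for v using entry_maps(3)[OF e' that] by simp
  have shrink: "u \<in> coord_space s m"
    if "u \<in> coord_space s (Suc m)" "u $ idx s m = 0" "m < CARD('n)" for u :: "'n bvec" and m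
  proof -
    have "sg j = s \<and> num j < m" if "u $ j \<noteq> 0" for j
    proof -
      have j: "sg j = s" "num j < Suc m" using \<open>u \<in> coord_space s (Suc m)\<close> that
        by (auto simp: coord_space_def)
      have "num j \<noteq> m" using that \<open>u $ idx s m = 0\<close> idx_unique[of j] j(1) by auto
      then show ?thesis using j by simp
    qed
    then show ?thesis by (simp add: coord_space_def)
  qed
  \<comment> \<open>\<open>f\<close> is corrected until its image has descended from the top of the
    \<open>A\<close> flag to its bottom, one step for each \<open>k\<close>.\<close>
  have "\<exists>f\<in>V ?t. f \<notin> coord_space ?t (q + r) \<and> y *v f \<in> coord_space s (p + (r - k))" if "k \<le> r" for k
    using that
  proof (induction k)
    case 0
    have "q + r < CARD('n)" using n p by simp
    then have "(axis (idx ?t (q + r)) 1 :: 'n bvec) \<in> V ?t"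
      "(axis (idx ?t (q + r)) 1 :: 'n bvec) \<notin> coord_space ?t (q + r)"
      using idx[of "q + r" ?t, where 'n = 'n]
        by (simp add: axis_mem_V, simp add: coord_space_def axis_def)
    then show ?case using yV by (intro bexI[of _ "axis (idx ?t (q + r)) 1"]) auto
  next
    case (Suc k)
    define m where "m = p + (r - Suc k)"
    have m: "Suc m = p + (r - k)" "m < CARD('n)" using Suc.prems n p by (auto simp: m_def)
    let ?i = "idx s m :: 'n + 'n"
    obtain f where f: "f \<in> V ?t" "f \<notin> coord_space ?t (q + r)" "y *v f \<in> coord_space s (Suc m)"
      using Suc m by auto
    have comb: "f - c *s b \<in> V ?t \<and> y *v (f - c *s b) = y *v f - c *s (y *v b)" if "b \<in> V ?t" for b c
      using vec.subspace_diff[OF subspace_V f(1) vec.subspace_scale[OF subspace_V that]]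
      by (simp add: matrix_vector_mult_diff_distrib vector_scalar_commute)
    have diff: "u - c *s w \<in> coord_space s (Suc m)"
      if "u \<in> coord_space s (Suc m)" "w \<in> coord_space s (Suc m)" for u w :: "'n bvec" and c
      using vec.subspace_diff[OF subspace_coord_space that(1) vec.subspace_scale[OF
        subspace_coord_space that(2)]] .
    have fin: ?case if b: "b \<in> V ?t" "y *v b \<in> coord_space s (Suc m)" "(y *v b) $ ?i \<noteq> 0"
      and nb: "\<And>c. f - c *s b \<notin> coord_space ?t (q + r)" for b
    proof -
      let ?c = "(y *v f) $ ?i / (y *v b) $ ?i"
      have "y *v f - ?c *s (y *v b) \<in> coord_space s m"
        by (rule shrink[OF diff[OF f(3) b(2)] _ m(2)]) (use b(3) in simp)
      then show ?thesis using comb[OF b(1), of ?c] nb[of ?c]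
        by (intro bexI[of _ "f - ?c *s b"]) (auto simp: m_def)
    qed
    show ?case
    proof (cases "k = 0")
      case True
      then have r: "0 < r" "Suc m = p + r" using Suc.prems m(1) by auto
      \<comment> \<open>The top coefficient cannot be corrected by elements of
        \<open>coord_space ?t (q + r)\<close>, since \<open>y\<close> maps this space one step
        lower. Its codimension in \<open>V ?t\<close> is \<open>p\<close>, so
        \<open>2 \<le> p\<close> supplies two vectors independent modulo it.\<close>
      obtain f1 f2 :: "'n bvec" where ff: "f1 \<in> V ?t" "f2 \<in> V ?t"
        "\<And>a. f1 - a *s f2 \<notin> coord_space ?t (q + r)" "f2 \<notin> coord_space ?t (q + r)"
      proof
        let ?a = "idx ?t (q + r) :: 'n + 'n" and ?b = "idx ?t (Suc (q + r)) :: 'n + 'n"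
        have ab: "sg ?a = ?t" "num ?a = q + r" "sg ?b = ?t" "num ?b = Suc (q + r)"
          using idx[of "q + r" ?t, where 'n = 'n] idx[of "Suc (q + r)" ?t, where 'n = 'n] n p by auto
        then have "?a \<noteq> ?b" by auto
        show "axis ?a 1 \<in> V ?t" "axis ?b 1 \<in> V ?t" using ab by (auto simp: axis_mem_V)
        show "(axis ?a 1 :: 'n bvec) - a *s axis ?b 1 \<notin> coord_space ?t (q + r)" for a
        proof -
          have "((axis ?a 1 :: 'n bvec) - a *s axis ?b 1) $ ?a \<noteq> 0" using \<open>?a \<noteq> ?b\<close>
            by (simp add: axis_def)
          then have "num ?a < q + r"
            if "(axis ?a 1 :: 'n bvec) - a *s axis ?b 1 \<in> coord_space ?t (q + r)"
            using that unfolding coord_space_def by blast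
          then show ?thesis using ab by auto
        qed
        have "(axis ?b 1 :: 'n bvec) $ ?b \<noteq> 0" by (simp add: axis_def)
        then have "num ?b < q + r" if "(axis ?b 1 :: 'n bvec) \<in> coord_space ?t (q + r)"
          using that unfolding coord_space_def by blast
        then show "(axis ?b 1 :: 'n bvec) \<notin> coord_space ?t (q + r)" using ab by auto
      qed
      show ?thesis
      proof (cases "(y *v f2) $ ?i = 0")
        case True
        have "y *v f2 \<in> coord_space s m"
          by (rule shrink[OF _ True m(2)]) (use yV[OF ff(2)] r in simp)
        then show ?thesis using ff by (intro bexI[of _ f2]) (auto simp: m_def)
      next
        case False
        let ?c = "(y *v f1) $ ?i / (y *v f2) $ ?i"
        have "y *v f1 - ?c *s (y *v f2) \<in> coord_space s m"
          by (rule shrink[OF diff _ m(2)]) (use yV[OF ff(1)] yV[OF ff(2)] r False in simp_all)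
        moreover have "f1 - ?c *s f2 \<in> V ?t" 
          using vec.subspace_diff[OF subspace_V ff(1) vec.subspace_scale[OF subspace_V ff(2)]] .
        ultimately show ?thesis using ff(3)[of ?c]
          by (intro bexI[of _ "f1 - ?c *s f2"]) (auto simp: m_def matrix_vector_mult_diff_distrib
            vector_scalar_commute)
      qed
    next
      case False
      \<comment> \<open>Below the top the correcting vector is a basis vector inside
        \<open>coord_space ?t (q + r)\<close>, so \<open>f\<close> stays outside. Regularity makes
        the relevant coefficient of its image nonzero.\<close>
      define j where "j = (idx ?t (q + (r - k)) :: 'n + 'n)"
      have j: "sg j = ?t" "num j = q + (r - k)"
        using idx[of "q + (r - k)" ?t, where 'n = 'n] n p by (auto simp: j_def)
      have i: "sg ?i = s" "num ?i = m" using idx[OF m(2), of s] by auto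
      have "y $ ?i $ j \<noteq> 0"
        by (rule reg) (use i j m False Suc.prems in \<open>auto simp: regularizer_nth m_def\<close>)
      then have nz: "(y *v axis j 1) $ ?i \<noteq> 0" by (simp add: matrix_vector_axis)
      have jB: "axis j 1 \<in> coord_space ?t (q + (r - k + 1))" "axis j 1 \<in> coord_space ?t (q + r)"
        using j False Suc.prems by (auto simp: coord_space_def axis_def split: if_splits)
      have "y *v axis j 1 \<in> coord_space s (p + (r - k))" using entry_maps(1)[OF e' jB(1)] by simp
      moreover have "f - c *s axis j 1 \<notin> coord_space ?t (q + r)" for c
      proof
        assume "f - c *s axis j 1 \<in> coord_space ?t (q + r)"
        then have "(f - c *s axis j 1) + c *s axis j 1 \<in> coord_space ?t (q + r)"
          using jB(2) by (intro vec.subspace_add[OF subspace_coord_space] vec.subspace_scale[OF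
            subspace_coord_space])
        then show False using f(2) by simp
      qed
      ultimately show ?thesis using nz j m(1) by (intro fin[of "axis j 1"]) (auto simp: axis_mem_V)
    qed
  qed
  from this[of r] show ?thesis by simp
qed

text \<open>A hyperplane of \<open>A 0\<close> containing \<open>y *v f\<close> becomes the new
  bottom of the \<open>A\<close> flag. \<open>f\<close> is adjoined to every \<open>B i\<close>,
  with the old \<open>B 0\<close> kept as bottom. Thus \<open>p\<close> drops by 1, \<open>q\<close>
  stays and \<open>r\<close> grows by 1.\<close>

lemma refine_flag:
  fixes y :: "('n::finite) bmat"
  assumes e: "entry s p q r y" and n: "p + q + r = CARD('n)" and p: "2 \<le> p"
    and f: "f \<in> V (flip_sign s)" "f \<notin> coord_space (flip_sign s) (q + r)" "y *v f \<in> coord_space s p"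
  shows "\<exists>A B. is_flag s (p - 1) q (Suc r) y A B"
proof -
  let ?t = "flip_sign s"
  have e': "entry ?t q p r y" using e entry_flip by blast
  note mA = entry_maps[OF e] and mB = entry_maps[OF e', unfolded flip_flip]
  define A where "A i = (coord_space s (p + i) :: 'n bvec set)" for i
  define B where "B i = (coord_space ?t (q + i) :: 'n bvec set)" for i
  have A: "vec.subspace (A i)" "A i \<subseteq> A (Suc i)" "A i \<subseteq> V s" and B: "vec.subspace (B i)"
    "B i \<subseteq> B (Suc i)" "B i \<subseteq> V ?t" for i
    by (auto simp: A_def B_def subspace_coord_space intro: subsetD[OF coord_space_V] subsetD[OF
      coord_space_mono, rotated])
  have dimA: "vec.dim (A i) = p + i" and dimB: "vec.dim (B i) = q + i" if "i \<le> r" for i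
    using that n by (simp_all add: A_def B_def dim_coord_space)
  have A0_mono: "A 0 \<subseteq> A i" and B0_mono: "B i \<subseteq> B r" if "i \<le> r" for i
    using that by (auto simp: A_def B_def intro: subsetD[OF coord_space_mono, rotated])
  let ?L = "vec.span {y *v f}"
  have "?L \<subseteq> A 0" using f(3) by (intro vec.span_minimal A) (simp add: A_def)
  have Ldim: "vec.dim ?L \<le> 1" using vec.dim_le_card[of ?L "{y *v f}"] by simp
  obtain C where C: "C 0 = ?L" "C (p - vec.dim ?L) = A 0"
      "\<forall>i\<le>p - vec.dim ?L. vec.subspace (C i) \<and>
        vec.dim (C i) = vec.dim ?L + i" "\<forall>i<p - vec.dim ?L. C i \<subseteq> C (Suc i)"
    using flag_between[OF vec.subspace_span A(1) \<open>?L \<subseteq> A 0\<close>, of "p - vec.dim ?L"] dimA[of 0] Ldim p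
      by auto
  \<comment> \<open>The span \<open>?L\<close> of \<open>y *v f\<close> has dimension 0 or 1, so the
    index of the hyperplane in the flag starting at \<open>?L\<close> depends on it;
    \<open>2 \<le> p\<close> leaves room for \<open>?L\<close> inside.\<close>
  define A0 where "A0 = C (p - 1 - vec.dim ?L)"
  have "C 0 \<subseteq> C i" if "i \<le> p - vec.dim ?L" for i
    using that
  proof (induction i)
    case (Suc i)
    then show ?case using C(4) by (meson Suc_leD Suc_le_lessD order_trans)
  qed simp
  then have "?L \<subseteq> A0" using C(1) by (simp add: A0_def diff_le_mono)
  then have "y *v f \<in> A0" using vec.span_base[of "y *v f" "{y *v f}"] by auto
  have A0: "vec.subspace A0" "vec.dim A0 = p - 1" "A0 \<subseteq> A 0"
  proof -
    have *: "p - 1 - vec.dim ?L \<le> p - vec.dim ?L" "Suc (p - 1 - vec.dim ?L) = p - vec.dim ?L"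
      using Ldim p by auto
    then show "vec.subspace A0" "vec.dim A0 = p - 1" using C(3)[rule_format, OF *(1)] Ldim p
      by (auto simp: A0_def)
    show "A0 \<subseteq> A 0" using C(4)[rule_format, of "p - 1 - vec.dim ?L"] * C(2) by (simp add: A0_def)
  qed
  define B' where "B' i = vec.span (insert f (B i))" for i
  have B': "vec.subspace (B' i)" "B i \<subseteq> B' i" "B' i \<subseteq> B' (Suc i)" "f \<in> B' i" for i
    using B(2)[of i] vec.span_mono[of "insert f (B i)" "insert f (B (Suc i))"]
    by (auto simp: B'_def intro: vec.span_base)
  have spanB: "vec.span (B i) = B i" for i using B(1) by (simp add: vec.span_eq_iff)
  have dimB': "vec.dim (B' i) = Suc (q + i)" if "i \<le> r" for i
  proof -
    have "f \<notin> B i" using f(2) B0_mono[OF that] by (auto simp: B_def)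
    then show ?thesis using dimB[OF that] by (simp add: B'_def vec.dim_span vec.dim_insert spanB)
  qed
  have B'V: "B' i \<subseteq> V ?t" for i unfolding B'_def using f(1) B(3)
    by (intro vec.span_minimal subspace_V) auto
  have yB': "y *v w \<in> S" if "vec.subspace S" "y *v f \<in> S"
    "\<And>b. b \<in> B i \<Longrightarrow> y *v b \<in> S" and w: "w \<in> B' i" for w i S
  proof -
    obtain c where c: "w - c *s f \<in> B i" using w unfolding B'_def vec.span_insert spanB by blast
    have "y *v (w - c *s f) + c *s (y *v f) \<in> S"
      using that c by (intro vec.subspace_add[OF that(1)] vec.subspace_scale[OF that(1)]) auto
    then show ?thesis by (simp add: matrix_vector_mult_diff_distrib vector_scalar_commute)
  qed
  have yf: "y *v f \<in> A i" if "i \<le> r" for i using f(3) A0_mono[OF that] by (auto simp: A_def)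
  have yA: "y *v v \<in> B i" if "v \<in> A (Suc i)" for v i using mA(1)[of v "Suc i"] that
    by (simp add: A_def B_def)
  have yB: "y *v v \<in> A i" if "v \<in> B (Suc i)" for v i using mB(1)[of v "Suc i"] that
    by (simp add: A_def B_def)
  have y0: "v \<in> A 0 \<Longrightarrow> y *v v = 0" "v \<in> B 0 \<Longrightarrow> y *v v = 0" for v using mA(2) mB(2)
    by (auto simp: A_def B_def)
  have "is_flag s (p - 1) q (Suc r) y (case_nat A0 A) (case_nat (B 0) B')"
    unfolding is_flag_def
  proof (intro conjI allI impI ballI)
    show "vec.subspace (case_nat A0 A i)" "vec.dim (case_nat A0 A i) = p - 1 + i" if "i \<le> Suc r" for i
      using that A0 A dimA p by (cases i; auto)+
    show "vec.subspace (case_nat (B 0) B' i)" "vec.dim (case_nat (B 0) B' i) = q + i"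
      if "i \<le> Suc r" for i
      using that B(1) dimB[of 0] B'(1) dimB' by (cases i; auto)+
    show "case_nat A0 A (Suc r) \<subseteq> V s" "case_nat (B 0) B' (Suc r) \<subseteq> V ?t" using A(3) B'V by simp_all
    show "case_nat A0 A i \<subseteq> case_nat A0 A (Suc i)"
      "case_nat (B 0) B' i \<subseteq> case_nat (B 0) B' (Suc i)" for i
      using A0(3) A(2) B'(2)[of 0] B'(3) by (cases i; simp)+
    show "y *v v = 0" if "v \<in> case_nat A0 A 0 \<union> case_nat (B 0) B' 0" for v
      using that y0 A0(3) by auto
    show "y *v v \<in> case_nat (B 0) B' i" if v: "v \<in> case_nat A0 A (Suc i)" for v i
    proof (cases i)
      case 0
      then show ?thesis using y0(1)[of v] v vec.subspace_0[OF B(1)[of 0]] by simp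
    next
      case (Suc k)
      then show ?thesis using yA[of v k] v B'(2)[of k] by auto
    qed
    show "y *v v \<in> case_nat A0 A i" if i: "i < Suc r" and v: "v \<in> case_nat (B 0) B' (Suc i)" for v i
    proof (cases i)
      case 0
      have "y *v b \<in> A0" if "b \<in> B 0" for b using y0(2)[OF that] vec.subspace_0[OF A0(1)] by simp
      then show ?thesis using yB'[OF A0(1) \<open>y *v f \<in> A0\<close>, of 0 v] v 0 by simp
    next
      case (Suc k)
      then show ?thesis using yB'[OF A(1) yf[of k] yB, of "Suc k" v] v i by simp
    qed
    show "y *v v \<in> case_nat (B 0) B' (Suc r)" if "v \<in> V s" for v
      using mA(3)[OF that] B'(2)[of r] by (auto simp: B_def)
    show "y *v v \<in> case_nat A0 A (Suc r)" if "v \<in> V ?t" for v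
      using mB(3)[OF that] by (simp add: A_def)
  qed
  then show ?thesis by blast
qed

section \<open>The closure of the three orbits is the whole image\<close>

definition orbits :: "('n::finite) bmat set" where
  "orbits = orb (offset Plus 1) \<union> orb (offset Plus 0) \<union> orb (offset Minus 1)"

lemma conj_by_closure_orbits:
  assumes "g \<in> K" "x \<in> zariski closure_of orbits"
  shows "conj_by g x \<in> zariski closure_of orbits"
proof (rule closure_conj_by[OF assms(2)])
  fix y :: "'a bmat" assume "y \<in> orbits"
  then have "conj_by g y \<in> orbits" using conj_by_orb[OF assms(1)] by (auto simp: orbits_def)
  then show "conj_by g y \<in> zariski closure_of orbits" using subset_zariski_closure by (metis subsetD)
qed

text \<open>If \<open>2 \<le> p\<close>, all but finitely many points of the line through
  \<open>y\<close> in the direction of \<open>regularizer\<close> admit a refined flag, and a basis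
  adapted to it brings them back to \<open>entry\<close> with smaller \<open>p\<close>. The case of
  \<open>q\<close> follows by exchanging the signs.\<close>

lemma entry_in_closure_orbits:
  fixes y :: "('n::finite) bmat"
  assumes "entry s p q r y" "p + q + r = CARD('n)"
  shows "y \<in> zariski closure_of orbits"
  using assms
proof (induction "p + q" arbitrary: s p q r y rule: less_induct)
  case less
  have big: "y \<in> zariski closure_of orbits" if e: "entry s p q r y" and n:
    "p + q + r = CARD('n)" and p: "2 \<le> p"
    and IH: "\<And>z :: 'n bmat. entry s (p - 1) q (Suc r) z \<Longrightarrow>
      z \<in> zariski closure_of orbits" for s p q and y :: "'n bmat"
  proof (rule zariski_closure_line)
    let ?F = "(\<lambda>(i, j). - y $ i $ j) ` UNIV" and ?E = "regularizer s p q r"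
    show "finite ?F" by simp
    fix c assume c: "c \<notin> ?F"
    let ?y = "line y ?E c"
    have e': "entry s p q r ?y" by (rule entry_line_regularizer[OF e])
    have "?y $ i $ j \<noteq> 0" if "?E $ i $ j \<noteq> (0 :: complex)" for i j
      using c that by (auto simp: regularizer_nth image_iff add_eq_0_iff split: if_splits)
    then obtain f where "f \<in> V (flip_sign s)" "f \<notin> coord_space (flip_sign s) (q + r)"
      "?y *v f \<in> coord_space s p"
      using refining_vector[OF e' n p] by blast
    then obtain A B where AB: "is_flag s (p - 1) q (Suc r) ?y A B" using refine_flag[OF e' n p] by blast
    have "?y \<in> space_s" using e' by (simp add: entry_def homog_False)
    moreover have "p - 1 + q + Suc r = CARD('n)" using n p by simp
    ultimately obtain g where g: "g \<in> K" "entry s (p - 1) q (Suc r) (conj_by (matrix_inv g) ?y)"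
      using flag_entry[OF AB] by blast
    have "conj_by g (conj_by (matrix_inv g) ?y) \<in> zariski closure_of orbits"
      by (rule conj_by_closure_orbits[OF g(1) IH[OF g(2)]])
    then show "?y \<in> zariski closure_of orbits" using g(1) by (simp add: conj_by_inv K_invertible)
  qed
  consider "2 \<le> p" | "2 \<le> q" | "p \<le> 1" "q \<le> 1" by linarith
  then show ?case
  proof cases
    case 1
    show ?thesis
      by (rule big[OF less.prems 1]) (rule less.hyps[of "p - 1" q s "Suc r"], use 1 less.prems in auto)
  next
    case 2
    have "entry (flip_sign s) q p r y" using less.prems entry_flip by blast
    then show ?thesis
    proof (rule big[OF _ _ 2])
      fix z :: "'n bmat" assume "entry (flip_sign s) (q - 1) p (Suc r) z"
      then show "z \<in> zariski closure_of orbits"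
        by (intro less.hyps[of "q - 1" p "flip_sign s" "Suc r"]) (use 2 less.prems in auto)
    qed (use less.prems in simp)
  next
    case 3
    have final: "y \<in> zariski closure_of orbits"
      if e: "entry s p q r y" and "q \<le> p" "p \<le> 1" "p + q + r = CARD('n)" for s p q
    proof -
      \<comment> \<open>Now \<open>p - q\<close> is 0 or 1, and this difference is the shift of
        levels that turns \<open>entry\<close> into lowering by one level.\<close>
      define \<delta> where "\<delta> = (if p = q then offset Plus 0 else offset s 1)"
      have "orb \<delta> \<subseteq> (orbits :: 'n bmat set)" unfolding orbits_def \<delta>_def by (cases s) auto
      then have orb: "conj_by g (std False \<delta>) \<in> (orbits :: 'n bmat set)" if "g \<in> K" for g
        using that unfolding orb_def by blast
      have "lowers (lev \<delta>) 1 y" unfolding lowers_def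
      proof (intro allI impI)
        fix i j assume nz: "y $ i $ j \<noteq> 0"
        then have "if sg j = s then p \<le> num j \<and>
          num i + p < q + num j else num i + q < p + num j" "sg i \<noteq> sg j"
          using e by (auto simp: entry_def homog_def split: if_splits)
        moreover have "p = q \<or> p = 1 \<and> q = 0" using that by linarith
        ultimately show "lev \<delta> i + 1 \<le> lev \<delta> j"
          using neq_sign_iff[of "sg i" "sg j"] neq_sign_iff[of "sg j" s]
          by (auto simp: lev_def \<delta>_def offset_def split: if_splits)
      qed
      moreover have "\<forall>t. \<delta> t \<le> 1" by (simp add: \<delta>_def offset_def)
      moreover have "homog False y" using e by (simp add: entry_def)
      ultimately show ?thesis using orb by (intro closure_normal_form) auto
    qed
    show ?thesis
    proof (cases "q \<le> p")
      case True
      then show ?thesis using final[of s p q] less.prems 3 by blast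
    next
      case False
      have "entry (flip_sign s) q p r y" using less.prems entry_flip by blast
      then show ?thesis using final[of "flip_sign s" q p] False 3 less.prems by (simp add: add.commute)
    qed
  qed
qed

theorem N_Xs_eq: "(N_Xs :: ('n::finite) bmat set) = zariski closure_of orbits"
proof (rule antisym)
  have "offdiag_part ` square_zero \<subseteq> zariski closure_of (orbits :: 'n bmat set)"
  proof
    fix y :: "'n bmat" assume "y \<in> offdiag_part ` square_zero"
    then obtain x where x: "x \<in> square_zero" "y = offdiag_part x" by blast
    then obtain p q r A B where fl: "is_flag Plus p q r y A B" "p + q + r = CARD('n)"
      using square_zero_flag by blast
    obtain g where g: "g \<in> K" "entry Plus p q r (conj_by (matrix_inv g) y)"
      using flag_entry[OF fl] x(2) offdiag_part_in by blast
    have "conj_by g (conj_by (matrix_inv g) y) \<in> zariski closure_of orbits"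
      by (rule conj_by_closure_orbits[OF g(1) entry_in_closure_orbits[OF g(2) fl(2)]])
    then show "y \<in> zariski closure_of orbits" using g(1) by (simp add: conj_by_inv K_invertible)
  qed
  then show "(N_Xs :: 'n bmat set) \<subseteq> zariski closure_of orbits"
    unfolding N_Xs_def conormal_images by (intro closure_of_minimal closedin_zariski_closure)
  have "d \<le> 1 \<Longrightarrow> \<forall>t. offset s d t \<le> 1" for s d by (simp add: offset_def)
  then have "orbits \<subseteq> offdiag_part ` (square_zero :: 'n bmat set)"
    unfolding orbits_def by (intro Un_least orb_subset_pi_s) simp_all
  then show "zariski closure_of orbits \<subseteq> (N_Xs :: 'n bmat set)"
    unfolding N_Xs_def conormal_images by (rule closure_of_mono)
qed

subsection \<open>Signed Young diagrams\<close>

text \<open>The chains of indices for the levels \<open>offset s d\<close> are the rows of a signed diagram with two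
  rows; \<open>box_row\<close> and \<open>box_col\<close> locate the box belonging to an index.\<close>
definition box_row :: "sign \<Rightarrow> nat \<Rightarrow> ('n::finite) + 'n \<Rightarrow> nat" where
  "box_row s d j = (lev (offset s d) j + (if sg j = s then 0 else 1)) mod 2"

definition box_col :: "sign \<Rightarrow> nat \<Rightarrow> ('n::finite) + 'n \<Rightarrow> nat" where
  "box_col s d j = lev (offset s d) j - d * box_row s d j"

text \<open>For \<open>d = 1\<close> the levels of sign \<open>s\<close> run from 0 to n - 1 and the
  others from 1 to n. If n is odd, the chain from level 0 ends at level n and the one from level 1
  at level n - 1; if n is even, these ends are exchanged and both have n boxes.\<close>

definition two_rows :: "nat \<Rightarrow> sign \<Rightarrow> nat \<Rightarrow> (nat \<times> sign) list" where
  "two_rows n s d = [(n + (if odd n then d else 0), s),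
     (n - (if odd n then d else 0), if d = 0 then flip_sign s else s)]"

lemma offset_le: "d \<le> 1 \<Longrightarrow> \<forall>t. offset s d t \<le> 1"
  by (simp add: offset_def)

lemma lev_offset:
  "(if sg j = s then 0 else d) \<le> lev (offset s d) (j :: ('n::finite) + 'n)"
  "lev (offset s d) j < CARD('n) + (if sg j = s then 0 else d)"
  using num_less[of j] by (auto simp: lev_def offset_def)

lemma d_cases: "d \<le> 1 \<Longrightarrow> d = 0 \<or> d = (1 :: nat)"
  by auto

lemma row_less: "box_row s d j < 2"
  by (simp add: box_row_def)

text \<open>The subtraction in \<open>box_col\<close> is never truncated: the chain in row 1 starts
  at level \<open>d\<close>.\<close>

lemma lev_col:
  assumes "d \<le> 1"
  shows "lev (offset s d) j = box_col s d j + d * box_row s d j"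
proof -
  have "d * box_row s d j \<le> lev (offset s d) j"
    using d_cases[OF assms] lev_offset(1)[of j s d]
      by (auto simp: box_row_def split: if_splits; presburger)
  then show ?thesis by (simp add: box_col_def)
qed

lemma box_inj:
  assumes "d \<le> 1" "box_row s d i = box_row s d j" "box_col s d i = box_col s d j"
  shows "i = j"
proof -
  have l: "lev (offset s d) i = lev (offset s d) j" using assms lev_col[OF assms(1)] by metis
  then have "(sg i = s) = (sg j = s)" using assms(2) unfolding box_row_def
    by (auto split: if_splits; presburger)
  then show ?thesis using lev_eqI[OF _ l] by (metis neq_sign_iff)
qed

lemma nxt_box:
  assumes d: "d \<le> 1"
  shows "nxt False (offset s d) i j \<longleftrightarrow> box_row s d i = box_row s d j \<and>
    box_col s d j = Suc (box_col s d i)"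
proof -
  have sgn: "sg i \<noteq> sg j \<longleftrightarrow> (sg i = s) \<noteq> (sg j = s)" using neq_sign_iff by metis
  show ?thesis
  proof
    assume "nxt False (offset s d) i j"
    then have *: "(sg i = s) \<noteq> (sg j = s)" "lev (offset s d) j = Suc (lev (offset s d) i)"
      using sgn by (auto simp: nxt_def)
    then have "box_row s d i = box_row s d j" unfolding box_row_def
      by (auto split: if_splits; presburger)
    then show "box_row s d i = box_row s d j \<and> box_col s d j = Suc (box_col s d i)"
      using lev_col[OF d, of s i] lev_col[OF d, of s j] * by simp
  next
    assume *: "box_row s d i = box_row s d j \<and> box_col s d j = Suc (box_col s d i)"
    then have l: "lev (offset s d) j = Suc (lev (offset s d) i)"
      using lev_col[OF d, of s i] lev_col[OF d, of s j] by simp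
    then have "(sg i = s) \<noteq> (sg j = s)" using * unfolding box_row_def
      by (auto split: if_splits; presburger)
    then show "nxt False (offset s d) i j" using l sgn by (simp add: nxt_def)
  qed
qed

lemma row_0_bound:
  fixes L n d :: nat
  assumes "d = 0 \<or> d = 1" "(if P then 0 else d) \<le> L" "L < n + (if P then 0 else d)"
    and "(L + (if P then 0 else 1)) mod 2 = 0"
  shows "L < n + (if odd n then d else 0)"
proof -
  have 1: "L < n" if "L < n + 1" "(L + 1) mod 2 = 0" "even n" for L n :: nat using that by presburger
  show ?thesis
  proof (cases P)
    case True
    then show ?thesis using assms(3) by simp
  next
    case False
    then show ?thesis using assms 1[of L n] by (cases "odd n") auto
  qed
qed

lemma row_1_bound:
  fixes L n d :: nat
  assumes "d = 0 \<or> d = 1" "(if P then 0 else d) \<le> L" "L < n + (if P then 0 else d)"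
    and "(L + (if P then 0 else 1)) mod 2 = 1"
  shows "L - d < n - (if odd n then d else 0)"
proof -
  have 1: "L - 1 < n - 1" if "L mod 2 = 1" "L < n" for L n :: nat using that by presburger
  have 2: "L - 1 < n - 1" if "(L + 1) mod 2 = 1" "1 \<le> L" "L < n + 1" "odd n" for L n :: nat
    using that by presburger
  show ?thesis
  proof (cases P)
    case True
    then show ?thesis using assms 1[of L n] by auto
  next
    case False
    then show ?thesis using assms 2[of L n] by (cases "odd n") auto
  qed
qed

text \<open>Injectivity together with the count of 2n boxes gives surjectivity.\<close>

lemma boxes_rows:
  assumes "d \<le> 1"
  shows "bij_betw (\<lambda>j :: ('n::finite) + 'n. (box_row s d j,
    box_col s d j)) UNIV (boxes (two_rows CARD('n) s d))"
proof -
  let ?b = "\<lambda>j :: 'n + 'n. (box_row s d j, box_col s d j)" and ?n = "CARD('n)"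
  let ?l0 = "?n + (if odd ?n then d else 0)" and ?l1 = "?n - (if odd ?n then d else 0)"
  have n: "?n > 0" by simp
  have boxes: "boxes (two_rows ?n s d) = {0} \<times> {..<?l0} \<union> {1} \<times> {..<?l1}"
    by (auto simp: boxes_def two_rows_def less_Suc_eq)
  have inj: "inj ?b" using box_inj[OF assms] by (auto simp: inj_def)
  have "?b j \<in> boxes (two_rows ?n s d)" for j
  proof -
    have r: "box_row s d j = 0 \<or> box_row s d j = 1" using row_less[of s d j] by auto
    have l: "(if sg j = s then 0 else d) \<le> lev (offset s d) j"
      "lev (offset s d) j < ?n + (if sg j = s then 0 else d)" by (rule lev_offset)+
    have "box_row s d j = 0 \<Longrightarrow> lev (offset s d) j < ?l0"
      using row_0_bound[OF d_cases[OF assms] l] unfolding box_row_def by simp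
    moreover have "box_row s d j = 1 \<Longrightarrow> lev (offset s d) j - d < ?l1"
      using row_1_bound[OF d_cases[OF assms] l] unfolding box_row_def by simp
    ultimately show ?thesis using r unfolding boxes by (auto simp: box_col_def)
  qed
  then have sub: "range ?b \<subseteq> boxes (two_rows ?n s d)" by blast
  have "card (boxes (two_rows ?n s d)) = ?l0 + ?l1"
    unfolding boxes by (subst card_Un_disjoint) (auto simp: card_cartesian_product)
  also have "\<dots> = 2 * ?n"
  proof -
    have "d \<le> ?n" using assms n by linarith
    then show ?thesis by simp
  qed
  finally have "card (range ?b) = card (boxes (two_rows ?n s d))" using inj by (simp add: card_image)
  moreover have "finite (boxes (two_rows ?n s d))" unfolding boxes by simp
  ultimately have "range ?b = boxes (two_rows ?n s d)" using sub card_subset_eq by blast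
  then show ?thesis using inj by (simp add: bij_betw_def)
qed

lemma flip_power: "(flip_sign ^^ c) s = (if even c then s else flip_sign s)"
  by (induction c) auto

lemma box_sign_rows:
  fixes j :: "('n::finite) + 'n"
  assumes "d \<le> 1"
  shows "box_sign (two_rows CARD('n) s d) (box_row s d j, box_col s d j) = sg j"
proof -
  have l: "lev (offset s d) j = box_col s d j + d * box_row s d j" by (rule lev_col[OF assms])
  have r: "box_row s d j = 0 \<or> box_row s d j = 1" using row_less[of s d j] by auto
  have par: "box_row s d j = (lev (offset s d) j + (if sg j = s then 0 else 1)) mod 2"
    by (simp add: box_row_def)
  have sg: "sg j = (if sg j = s then s else flip_sign s)" using neq_sign_iff by auto
  have "even (box_col s d j) \<longleftrightarrow> (sg j = s \<longleftrightarrow> box_row s d j = 0 \<or> d = 1)"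
    using r d_cases[OF assms] l par by (cases "sg j = s"; elim disjE; simp) presburger+
  then have "box_sign (two_rows CARD('n) s d) (box_row s d j, box_col s d j) = (if sg j
    = s then s else flip_sign s)"
    using r d_cases[OF assms] by (elim disjE) (auto simp: two_rows_def flip_power)
  then show ?thesis using sg by simp
qed

lemma mset_two: "mset xs = mset [a, b] \<Longrightarrow> xs = [a, b] \<or> xs = [b, a]"
proof -
  assume m: "mset xs = mset [a, b]"
  then have "length xs = 2" by (metis length_Cons list.size(3) numeral_2_eq_2 size_mset)
  then obtain c d where xs: "xs = [c, d]" by (auto simp: length_Suc_conv numeral_2_eq_2)
  with m show ?thesis by (auto simp: add_eq_conv_ex)
qed

lemma std_axis: "std \<tau> \<delta> *v axis j 1 = (if \<exists>i. nxt \<tau> \<delta> i j then axis (THE i. nxt \<tau> \<delta> i j) 1 else 0)"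
proof (cases "\<exists>i. nxt \<tau> \<delta> i j")
  case True
  then obtain i where i: "nxt \<tau> \<delta> i j" by blast
  then have "(THE i. nxt \<tau> \<delta> i j) = i" using nxt_unique2 by blast
  moreover have "nxt \<tau> \<delta> k j \<longleftrightarrow> k = i" for k using i nxt_unique2[OF i] by blast
  ultimately show ?thesis by (simp add: vec_eq_iff matrix_vector_axis std_nth) (simp add: axis_def)
qed (auto simp: vec_eq_iff matrix_vector_axis std_nth)

text \<open>The vectors attached to the boxes are the columns of a conjugating matrix. The sign
  condition places it in \<open>K\<close>, and the shift to the left neighbour is the action of
  \<open>std\<close>.\<close>

lemma signed_orbit_eq_orb:
  assumes d: "d \<le> 1"
  shows "signed_orbit (mset (two_rows CARD('n) s d)) = (orb (offset s d) :: ('n::finite) bmat set)"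
proof (intro equalityI subsetI)
  let ?rs = "two_rows CARD('n) s d" and ?b =
    "\<lambda>j :: 'n + 'n. (box_row s d j, box_col s d j)" and ?\<delta> = "offset s d"
  note bij = boxes_rows[OF d, of s, where 'n = 'n]
  have pred: "box_col s d j = 0 \<Longrightarrow> \<not> nxt False ?\<delta> i j" for i j :: "'n + 'n" by (simp add: nxt_box[OF d])
  have pred': "\<exists>i. nxt False ?\<delta> i j \<and> ?b i = (box_row s d j, box_col s d j - 1)"
    if "box_col s d j \<noteq> 0" for j
  proof -
    have "?b j \<in> boxes ?rs" using bij_betwE[OF bij] by blast
    then have "(box_row s d j, box_col s d j - 1) \<in> boxes ?rs" by (auto simp: boxes_def)
    then have "(box_row s d j, box_col s d j - 1) \<in> range ?b" using bij_betw_imp_surj_on[OF bij] by simp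
    then obtain i where "(box_row s d j, box_col s d j - 1) = ?b i" by (rule rangeE)
    then show ?thesis using that by (intro exI[of _ i]) (auto simp: nxt_box[OF d])
  qed
  {
    fix y :: "'n bmat" assume "y \<in> signed_orbit (mset ?rs)"
    then obtain rs and e :: "nat \<times> nat \<Rightarrow> 'n bvec" where rs: "mset rs = mset ?rs"
      and sp: "vec.span (e ` boxes rs) = UNIV" and sgn: "\<forall>b\<in>boxes rs. e b \<in> V (box_sign rs b)"
      and rel: "\<forall>r c. (r, c) \<in> boxes rs \<longrightarrow> y *v e (r, c) = (if c = 0 then 0 else e (r, c - 1))"
      unfolding signed_orbit_def by blast
    have "\<exists>e' :: nat \<times> nat \<Rightarrow> 'n bvec. vec.span (e' ` boxes ?rs) = UNIV \<and>
      (\<forall>b\<in>boxes ?rs. e' b \<in> V (box_sign ?rs b)) \<and>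
      (\<forall>r c. (r, c) \<in> boxes ?rs \<longrightarrow> y *v e' (r, c) = (if c = 0 then 0 else e' (r, c - 1)))"
    proof (cases "rs = ?rs")
      case True
      then show ?thesis using sp sgn rel by blast
    next
      case False
      obtain u v where uv: "?rs = [u, v]" by (simp add: two_rows_def)
      then have rs': "rs = [v, u]" using mset_two[of rs u v] rs False by auto
      \<comment> \<open>A multiset of rows can be enumerated in the opposite order; then the basis
        is relabelled by exchanging rows 0 and 1.\<close>
      define e' where "e' = (\<lambda>(r, c). e (1 - r, c))"
      have box: "(r, c) \<in> boxes [u, v] \<Longrightarrow> (1 - r, c) \<in> boxes [v, u]" for r c u v
        by (auto simp: boxes_def less_Suc_eq)
      have "e ` boxes rs \<subseteq> e' ` boxes ?rs"
      proof
        fix x assume "x \<in> e ` boxes rs"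
        then obtain r c where rc: "(r, c) \<in> boxes rs" "x = e (r, c)" by auto
        then have "r < 2" by (simp add: boxes_def rs')
        then have "x = e' (1 - r, c)" using rc by (auto simp: e'_def less_2_cases_iff)
        then show "x \<in> e' ` boxes ?rs" using box[of r c v u] rc(1) unfolding rs' uv by blast
      qed
      then have "vec.span (e' ` boxes ?rs) = UNIV" using sp vec.span_mono
        by (metis top.extremum_uniqueI)
      moreover have "box_sign [u, v] (r, c) = box_sign [v, u] (1 - r, c)"
        if "(r, c) \<in> boxes [u, v]" for r c
        using that by (auto simp: boxes_def less_Suc_eq)
      then have "\<forall>b\<in>boxes ?rs. e' b \<in> V (box_sign ?rs b)"
      proof (intro ballI)
        fix b assume "b \<in> boxes ?rs"
        moreover obtain r c where b: "b = (r, c)" by force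
        ultimately have rc: "(r, c) \<in> boxes [u, v]" by (simp add: uv)
        then have "e (1 - r, c) \<in> V (box_sign [v, u] (1 - r, c))" using sgn box[OF rc] unfolding rs'
          by blast
        then show "e' b \<in> V (box_sign ?rs b)"
          using \<open>\<And>r c. (r, c) \<in> boxes [u, v] \<Longrightarrow>
            box_sign [u, v] (r, c) = box_sign [v, u] (1 - r, c)\<close>[OF rc]
          unfolding b uv e'_def by simp
      qed
      moreover have "\<forall>r c. (r, c) \<in> boxes ?rs \<longrightarrow> y *v e' (r, c) = (if c = 0 then 0 else e' (r, c - 1))"
        using rel box unfolding uv rs' by (simp add: e'_def)
      ultimately show ?thesis by blast
    qed
    then obtain e' :: "nat \<times> nat \<Rightarrow> 'n bvec" where e': "vec.span (e' ` boxes ?rs) = UNIV"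
      "\<forall>b\<in>boxes ?rs. e' b \<in> V (box_sign ?rs b)"
      "\<forall>r c. (r, c) \<in> boxes ?rs \<longrightarrow> y *v e' (r, c) = (if c = 0 then 0 else e' (r, c - 1))" by blast
    define c where "c j = e' (?b j)" for j
    have "range c = e' ` boxes ?rs" unfolding c_def using bij_betw_imp_surj_on[OF bij]
      by (metis image_image)
    then obtain g where g: "invertible g" "\<And>j. g *v axis j 1 = c j" using basis_matrix e'(1) by metis
    have bm: "?b j \<in> boxes ?rs" for j using bij_betwE[OF bij] by blast
    have "c j \<in> V (sg j)" for j using e'(2) bm[of j] box_sign_rows[OF d, of s j] unfolding c_def
      by metis
    then have "(g *v axis j 1) $ i = 0" if "sg i \<noteq> sg j" for i j using g(2) that by (simp add: V_sg)
    then have gK: "g \<in> K" using g(1) by (simp add: K_iff lie_k_sg matrix_vector_axis)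
    have "(g ** std False ?\<delta>) *v axis j 1 = (y ** g) *v axis j 1" for j
    proof -
      have yc: "(y ** g) *v axis j 1 = (if box_col s d j
        = 0 then 0 else e' (box_row s d j, box_col s d j - 1))"
        using e'(3) bm[of j] by (simp add: matrix_vector_mul_assoc[symmetric] g c_def)
      show ?thesis
      proof (cases "box_col s d j = 0")
        case True
        then show ?thesis using pred[OF True] yc
          by (simp add: matrix_vector_mul_assoc[symmetric] std_axis)
      next
        case False
        then obtain i where i: "nxt False ?\<delta> i j" "?b i = (box_row s d j, box_col s d j - 1)"
          using pred' by blast
        then have "(THE i. nxt False ?\<delta> i j) = i" using nxt_unique2 by blast
        then have "std False ?\<delta> *v axis j 1 = axis i 1" using i(1) unfolding std_axis by auto
        then show ?thesis using yc False i(2)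
          by (simp add: matrix_vector_mul_assoc[symmetric] g c_def)
      qed
    qed
    then have "g ** std False ?\<delta> = y ** g"
      by (simp add: vec_eq_iff) (metis matrix_vector_axis)
    then have "conj_by g (std False ?\<delta>) = y" using conj_by_eq_iff[OF g(1)] by blast
    then show "y \<in> orb ?\<delta>" unfolding orb_def using gK by blast
  }
  fix y :: "'n bmat" assume "y \<in> orb ?\<delta>"
  then obtain g where g: "g \<in> K" "y = conj_by g (std False ?\<delta>)" by (auto simp: orb_def)
  have inv: "invertible g" using g(1) by (rule K_invertible)
  define e where "e b = g *v axis (inv_into UNIV ?b b) 1" for b
  have eb: "e (?b j) = g *v axis j 1" for j
    using bij_betw_inv_into_left[OF bij, of j] by (simp add: e_def)
  have box: "\<exists>j. x = ?b j" if "x \<in> boxes ?rs" for x using that bij_betw_imp_surj_on[OF bij] by auto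
  have im: "e ` boxes ?rs = (*v) g ` cart_basis"
  proof -
    have "e ` boxes ?rs = range (\<lambda>j. e (?b j))" using bij_betw_imp_surj_on[OF bij]
      by (metis image_image)
    then show ?thesis unfolding eb by (auto simp: cart_basis_def)
  qed
  have injg: "inj ((*v) g)" using inv
    by (metis invertible_left_inverse matrix_left_invertible_injective)
  have lin: "Vector_Spaces.linear (*s) (*s) ((*v) g)" by (rule matrix_vector_mul_linear_gen)
  have "inj_on e (boxes ?rs)"
  proof (rule inj_onI)
    fix a b assume ab: "a \<in> boxes ?rs" "b \<in> boxes ?rs" "e a = e b"
    then obtain i j where "a = ?b i" "b = ?b j" using box by blast
    then have "g *v axis i 1 = g *v axis j 1" using ab(3) eb by simp
    then have "axis i (1 :: complex) = axis j 1" using injg by (simp add: inj_eq)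
    then show "a = b" using \<open>a = ?b i\<close> \<open>b = ?b j\<close> by (simp add: axis_eq_axis)
  qed
  moreover have "vec.independent (e ` boxes ?rs)"
    unfolding im by (rule vec.linear_independent_injective_image[OF lin independent_cart_basis])
      (use injg in \<open>auto intro: inj_on_subset\<close>)
  moreover have "vec.span (e ` boxes ?rs) = UNIV"
  proof -
    have "surj ((*v) g)" using inv
      by (metis invertible_right_inverse matrix_right_invertible_surjective)
    then show ?thesis unfolding im using vec.linear_span_image[OF lin] by simp
  qed
  moreover have "\<forall>b\<in>boxes ?rs. e b \<in> V (box_sign ?rs b)"
  proof
    fix x assume "x \<in> boxes ?rs"
    then obtain j where j: "x = ?b j" using box by blast
    have "g *v axis j 1 \<in> V (sg j)" using g(1) axis_mem_V by (auto simp: K_iff intro!: lie_k_vec)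
    then show "e x \<in> V (box_sign ?rs x)" using eb[of j] box_sign_rows[OF d, of s j] unfolding j by simp
  qed
  moreover have "\<forall>r c. (r, c) \<in> boxes ?rs \<longrightarrow> y *v e (r, c) = (if c = 0 then 0 else e (r, c - 1))"
  proof (intro allI impI)
    fix r c assume "(r, c) \<in> boxes ?rs"
    then obtain j where j: "(r, c) = ?b j" using box by blast
    have yg: "y ** g = g ** std False ?\<delta>" using g(2) conj_by_eq_iff[OF inv] by metis
    have ye: "y *v e (r, c) = g *v (std False ?\<delta> *v axis j 1)"
      unfolding j eb by (simp add: matrix_vector_mul_assoc yg)
    show "y *v e (r, c) = (if c = 0 then 0 else e (r, c - 1))"
    proof (cases "c = 0")
      case True
      then show ?thesis using ye pred[of j] j by (simp add: std_axis)
    next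
      case False
      then obtain i where i: "nxt False ?\<delta> i j" "?b i = (r, c - 1)" using pred'[of j] j by auto
      then have "(THE i. nxt False ?\<delta> i j) = i" using nxt_unique2 by blast
      then have "std False ?\<delta> *v axis j 1 = axis i 1" using i(1) unfolding std_axis by auto
      then show ?thesis using ye False eb[of i] i(2) by simp
    qed
  qed
  moreover have "y \<in> N_s"
  proof -
    have "std False ?\<delta> \<in> (space_s :: 'n bmat set)" using homog_std[of False ?\<delta>]
      by (simp add: homog_False)
    then show ?thesis unfolding N_s_def g(2)
      using conj_by_space_s[OF g(1)] nilpotent_conj_by[OF inv lowers_nilpotent[OF lowers_std]] by blast
  qed
  ultimately show "y \<in> signed_orbit (mset ?rs)" unfolding signed_orbit_def by blast
qed

lemma orb_in_K_orbits: "orb \<delta> \<in> K_orbits (N_s :: ('n::finite) bmat set)"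
proof -
  have "std False \<delta> \<in> (N_s :: 'n bmat set)"
    using homog_std[of False \<delta>] lowers_nilpotent[OF lowers_std] by (auto simp: N_s_def homog_False)
  then show ?thesis unfolding K_orbits_def orb_def by blast
qed

subsection \<open>Rank conditions separating the orbits\<close>

lemma mpow_std:
  fixes i j :: "('n::finite) + 'n"
  assumes \<delta>: "\<forall>s. \<delta> s \<le> 1"
  shows "mpow (std False \<delta>) k $ i $ j = (if lev \<delta> j = lev \<delta> i + k \<and>
    (sg i = sg j) = even k then 1 else 0)"
proof (induction k arbitrary: i)
  case 0
  show ?case using lev_eqI[of i j \<delta>] by (auto simp: mat_1_nth)
next
  case (Suc k)
  let ?m = "mpow (std False \<delta>) k :: 'n bmat"
  have sum: "mpow (std False \<delta>) (Suc k) $ i $ j = (\<Sum>l\<in>UNIV. std False \<delta> $ i $ l * ?m $ l $ j)"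
    by (simp add: mpow_Suc matrix_mult_nth)
  show ?case
  proof (cases "lev \<delta> j = lev \<delta> i + Suc k \<and> (sg i = sg j) = even (Suc k)")
    case True
    \<comment> \<open>A chain cannot skip a level: for \<open>\<delta> \<le> 1\<close> both signs
      occur at each level strictly between \<open>i\<close> and \<open>j\<close>.\<close>
    have "\<exists>l. nxt False \<delta> i l"
    proof (cases "k = 0")
      case True
      then show ?thesis using \<open>lev \<delta> j = lev \<delta> i + Suc k \<and> _\<close> by (auto simp: nxt_def)
    next
      case False
      have "\<delta> (flip_sign (sg i)) \<le> Suc (lev \<delta> i)" using \<delta>[rule_format, of "flip_sign (sg i)"] by simp
      moreover have "Suc (lev \<delta> i) < CARD('n) + \<delta> (flip_sign (sg i))"
        using lev_le[OF \<delta>, of j] True False by simp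
      ultimately obtain l :: "'n + 'n" where "sg l = flip_sign (sg i)" "lev \<delta> l = Suc (lev \<delta> i)"
        by (rule ex_lev)
      then show ?thesis by (intro exI[of _ l]) (auto simp: nxt_def)
    qed
    then obtain l where l: "nxt False \<delta> i l" by blast
    have "mpow (std False \<delta>) (Suc k) $ i $ j = (\<Sum>l'\<in>{l}. std False \<delta> $ i $ l' * ?m $ l' $ j)"
      unfolding sum by (rule sum.mono_neutral_right) (use nxt_unique1[OF l] in \<open>auto simp: std_nth\<close>)
    moreover have "lev \<delta> j = lev \<delta> l + k \<and> (sg l = sg j) = even k"
      using l True by (cases "sg i"; cases "sg l"; cases "sg j") (auto simp: nxt_def)
    ultimately show ?thesis using True l Suc.IH[of l] by (simp add: std_nth)
  next
    case False
    have z: "std False \<delta> $ i $ l * ?m $ l $ j = 0" for l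
    proof (cases "nxt False \<delta> i l \<and> lev \<delta> j = lev \<delta> l + k \<and> (sg l = sg j) = even k")
      case True
      then have "lev \<delta> j = lev \<delta> i + Suc k \<and> (sg i = sg j) = even (Suc k)"
        by (cases "sg i"; cases "sg l"; cases "sg j") (auto simp: nxt_def)
      then show ?thesis using False by blast
    qed (auto simp: std_nth Suc.IH)
    show ?thesis unfolding sum by (simp only: z sum.neutral_const False if_False)
  qed
qed

lemma mpow_orb_block:
  assumes y: "y \<in> orb \<delta>"
  shows "\<exists>g\<in>lie_k. \<exists>h\<in>lie_k. \<forall>k. mpow y k = g ** mpow (std False \<delta>) k ** h"
proof -
  obtain g where g: "g \<in> K" "y = conj_by g (std False \<delta>)" using y by (auto simp: orb_def)
  have "mpow y k = g ** mpow (std False \<delta>) k ** matrix_inv g" for k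
    using conj_by_mpow[OF K_invertible[OF g(1)]] by (simp add: g(2) conj_by_def)
  moreover have "g \<in> lie_k" "matrix_inv g \<in> lie_k" using g(1) K_inv[OF g(1)] by (simp_all add: K_iff)
  ultimately show ?thesis by blast
qed

text \<open>Conjugation by block diagonal matrices does not mix columns of different sign, so a
  single nonzero entry means rank at most one on these columns.\<close>

lemma orb_mpow_single_entry:
  fixes y :: "('n::finite) bmat"
  assumes single: "\<And>a b :: 'n + 'n. sg b = t \<Longrightarrow> mpow (std False \<delta>) k $ a $ b \<noteq> 0 \<Longrightarrow> a = a0 \<and> b = b0"
    and y: "y \<in> orb \<delta>"
  shows "\<exists>u v. \<forall>i j. sg j = t \<longrightarrow> mpow y k $ i $ j = u i * v j"
proof -
  let ?M = "mpow (std False \<delta>) k :: 'n bmat"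
  obtain g h :: "'n bmat" where gh: "g \<in> lie_k" "h \<in> lie_k"
    "\<And>k. mpow y k = g ** mpow (std False \<delta>) k ** h"
    using mpow_orb_block[OF y] by blast
  have "mpow y k $ i $ j = (g $ i $ a0 * ?M $ a0 $ b0) * h $ b0 $ j" if j: "sg j = t" for i j
  proof -
    have *: "(g ** ?M) $ i $ b * h $ b $ j = (if b
      = b0 then (g $ i $ a0 * ?M $ a0 $ b0) * h $ b0 $ j else 0)" for b
    proof (cases "sg b = t")
      case False
      then have "h $ b $ j = 0" using gh(2) j by (auto simp: lie_k_sg)
      then show ?thesis by auto
    next
      case True
      have "(g ** ?M) $ i $ b = (\<Sum>a\<in>{a0}. g $ i $ a * ?M $ a $ b)"
        unfolding matrix_mult_nth by (rule sum.mono_neutral_right) (use single[OF True] in auto)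
      then show ?thesis using single[OF True, of a0] by auto
    qed
    have "mpow y k $ i $ j = (\<Sum>b\<in>UNIV. (g ** ?M) $ i $ b * h $ b $ j)"
      unfolding gh(3) by (rule matrix_mult_nth)
    then show ?thesis by (simp add: *)
  qed
  then show ?thesis
    by (intro exI[of _ "\<lambda>i. g $ i $ a0 * ?M $ a0 $ b0"] exI[of _ "\<lambda>j. h $ b0 $ j"]) simp
qed

lemma closure_orb_zero:
  fixes y :: "('n::finite) bmat"
  assumes "\<And>a b :: 'n + 'n. sg b = t \<Longrightarrow> mpow (std False \<delta>) k $ a $ b = 0"
    and y: "y \<in> zariski closure_of (orb \<delta>)" and j: "sg j = t"
  shows "mpow y k $ i $ j = 0"
proof (rule poly_fun_vanish_closure[OF poly_funs_mpow _ y])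
  fix x :: "'n bmat" assume "x \<in> orb \<delta>"
  then obtain g h :: "'n bmat"
    where gh: "g \<in> lie_k" "h \<in> lie_k" "\<And>k. mpow x k = g ** mpow (std False \<delta>) k ** h"
    using mpow_orb_block by blast
  have z: "(g ** mpow (std False \<delta>) k) $ i $ b * h $ b $ j = 0" for b
    using assms(1) gh(2) j by (cases "sg b = t") (auto simp: lie_k_sg matrix_mult_nth)
  show "mpow x k $ i $ j = 0" unfolding gh(3) matrix_mult_nth[of "g ** _"]
    by (simp only: z sum.neutral_const)
qed

text \<open>Rank at most one is expressed by 2 by 2 minors, which are polynomial and hence vanish on
  the closure as well.\<close>

lemma closure_orb_minor:
  fixes y :: "('n::finite) bmat"
  assumes single: "\<And>a b :: 'n + 'n. sg b = t \<Longrightarrow> mpow (std False \<delta>) k $ a $ b \<noteq> 0 \<Longrightarrow> a = a0 \<and> b = b0"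
    and y: "y \<in> zariski closure_of (orb \<delta>)" and j: "sg j = t" "sg j' = t"
  shows "mpow y k $ i $ j * mpow y k $ i' $ j' = mpow y k $ i $ j' * mpow y k $ i' $ j"
proof -
  have "mpow y k $ i $ j * mpow y k $ i' $ j' - mpow y k $ i $ j' * mpow y k $ i' $ j = 0"
  proof (rule poly_fun_vanish_closure[OF _ _ y])
    show "(\<lambda>y. mpow y k $ i $ j * mpow y k $ i' $ j' - mpow y k $ i $ j' * mpow y k $ i' $ j) \<in>
      poly_funs"
      by (intro poly_funs_intros poly_funs_mpow)
    fix x :: "'n bmat" assume x: "x \<in> orb \<delta>"
    obtain u v where "\<forall>i j. sg j = t \<longrightarrow> mpow x k $ i $ j = u i * v j"
      using orb_mpow_single_entry[OF single x] by blast
    then show "mpow x k $ i $ j * mpow x k $ i' $ j' - mpow x k $ i $ j' * mpow x k $ i' $ j = 0"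
      using j by simp
  qed
  then show ?thesis by simp
qed

abbreviation orb_closure :: "sign \<Rightarrow> nat \<Rightarrow> ('n::finite) bmat set" where
  "orb_closure s d \<equiv> zariski closure_of (orb (offset s d))"

lemma std_in_orb_closure: "std False (offset s d) \<in> orb_closure s d"
  using std_in_orb subset_zariski_closure by (metis subsetD)

lemma offset_sg: "lev (offset s d) j = num j + (if sg j = s then 0 else d)"
  by (simp add: lev_def offset_def)

lemma mpow_std_offset:
  fixes i j :: "('n::finite) + 'n"
  assumes "d \<le> 1"
  shows "mpow (std False (offset s d)) k $ i $ j =
    (if num j + (if sg j = s then 0 else d) = num i + (if sg i = s then 0 else d) + k \<and>
      (sg i = sg j) = even k then 1 else 0)"
  unfolding mpow_std[OF offset_le[OF assms]] offset_sg ..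

text \<open>The rank of \<open>y^(n-1)\<close> on \<open>V s\<close> and on
  \<open>V (flip_sign s)\<close> is 0 and 2 for the orbit with rows starting with \<open>s\<close>,
  1 and 1 for the middle orbit, and 2 and 0 for the remaining one.\<close>

lemma not_subset_even:
  assumes n: "even CARD('n::finite)"
  shows "\<not> (orb_closure s' 0 :: 'n bmat set) \<subseteq> orb_closure s 1"
    "\<not> (orb_closure (flip_sign s) 1 :: 'n bmat set) \<subseteq> orb_closure s 1"
    "\<not> (orb_closure s 1 :: 'n bmat set) \<subseteq> orb_closure s' 0"
proof -
  let ?k = "CARD('n) - 1" and ?t = "flip_sign s"
  have "CARD('n) > 0" by simp
  then have n2: "CARD('n) \<ge> 2" using n
    by (metis One_nat_def Suc_leI le_neq_implies_less numeral_2_eq_2 odd_one)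
  have k: "odd ?k" "0 < CARD('n)" "?k < CARD('n)" "1 < CARD('n)" "CARD('n) - 2 < CARD('n)"
    using n n2 by auto
  have zero: "mpow (std False (offset s 1)) ?k $ a $ b = 0" if "sg b = s" for a b :: "'n + 'n"
    using that num_less[of b] k(1) by (auto simp: mpow_std_offset)
  {
    fix s'' d assume d: "d \<le> 1" and sub: "(orb_closure s'' d :: 'n bmat set) \<subseteq> orb_closure s 1"
    have "mpow (std False (offset s'' d) :: 'n bmat) ?k $ i $ j = 0" if "sg j = s" for i j
      using closure_orb_zero[OF zero subsetD[OF sub std_in_orb_closure] that] by simp
  }
  note * = this
  show "\<not> (orb_closure s' 0 :: 'n bmat set) \<subseteq> orb_closure s 1"
    using *[of 0 s' "idx s ?k" "idx ?t 0"] k idx[of ?k s, where 'n = 'n] idx[of 0 ?t, where 'n = 'n]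
      by (auto simp: mpow_std_offset)
  show "\<not> (orb_closure ?t 1 :: 'n bmat set) \<subseteq> orb_closure s 1"
    using *[of 1 ?t "idx s ?k" "idx ?t 1"] k idx[of ?k s, where 'n = 'n] idx[of 1 ?t, where 'n = 'n]
      by (auto simp: mpow_std_offset)
  show "\<not> (orb_closure s 1 :: 'n bmat set) \<subseteq> orb_closure s' 0"
  proof
    assume sub: "(orb_closure s 1 :: 'n bmat set) \<subseteq> orb_closure s' 0"
    have single: "a = idx s 0 \<and> b = idx ?t ?k"
      if "sg b = ?t" "mpow (std False (offset s' 0)) ?k $ a $ b \<noteq> 0" for a b :: "'n + 'n"
    proof -
      have "num b = num a + ?k" "sg a \<noteq> sg b" using that(2) k(1)
        by (auto simp: mpow_std_offset split: if_splits)
      then have "num a = 0" "num b = ?k" "sg a = s"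
        using num_less[of b] that(1) neq_sign_iff[of "sg a" ?t] by auto
      then show ?thesis using idx_unique[of a] idx_unique[of b] that(1) by simp
    qed
    let ?i = "idx s 0 :: 'n + 'n" and ?i' = "idx s 1 :: 'n + 'n" and ?j =
      "idx ?t (CARD('n) - 2) :: 'n + 'n" and ?j' = "idx ?t ?k :: 'n + 'n"
    have e: "sg ?i = s" "num ?i = 0" "sg ?i' = s" "num ?i' = 1" "sg ?j = ?t" "num ?j = CARD('n) - 2"
      "sg ?j' = ?t" "num ?j' = ?k"
      using k by (simp_all add: idx)
    let ?M = "mpow (std False (offset s 1) :: 'n bmat) ?k"
    have "?M $ ?i $ ?j * ?M $ ?i' $ ?j' = ?M $ ?i $ ?j' * ?M $ ?i' $ ?j"
      by (rule closure_orb_minor[OF single subsetD[OF sub std_in_orb_closure] e(5,7)])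
    moreover have "Suc (CARD('n) - 2) = CARD('n) - Suc 0" "CARD('n) \<noteq> CARD('n) - Suc 0" using n2
      by linarith+
    ultimately show False using e k(1) by (simp add: mpow_std_offset)
  qed
qed

text \<open>Only the orbit whose long row starts with \<open>s\<close> has \<open>y^n\<close>
  nonzero on \<open>V (flip_sign s)\<close>: its long row has n + 1 boxes and ends with this
  sign.\<close>

lemma not_subset_odd:
  assumes n: "odd CARD('n::finite)"
  shows "\<not> (orb_closure s 1 :: 'n bmat set) \<subseteq> orb_closure s' 0"
    "\<not> (orb_closure s 1 :: 'n bmat set) \<subseteq> orb_closure (flip_sign s) 1"
proof -
  let ?t = "flip_sign s"
  have zero: "mpow (std False (offset s' 0)) CARD('n) $ a $ b = 0"
    "mpow (std False (offset ?t 1)) CARD('n) $ a $ b = 0" if "sg b = ?t" for a b :: "'n + 'n" and s'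
    using that num_less[of b] n by (auto simp: mpow_std_offset)
  have e: "sg (idx s 0 :: 'n + 'n) = s" "num (idx s 0 :: 'n + 'n) = 0"
    "sg (idx ?t (CARD('n) - 1) :: 'n + 'n) = ?t" "num (idx ?t (CARD('n) - 1) :: 'n + 'n) = CARD('n) - 1"
    by (auto simp: idx)
  have "mpow (std False (offset s 1) :: 'n bmat) CARD('n) $ idx s 0 $ idx ?t (CARD('n) - 1) \<noteq> 0"
    using e n by (simp add: mpow_std_offset)
  then show "\<not> (orb_closure s 1 :: 'n bmat set) \<subseteq> orb_closure s' 0"
    "\<not> (orb_closure s 1 :: 'n bmat set) \<subseteq> orb_closure ?t 1"
    using closure_orb_zero[OF zero(1) _ e(3)] closure_orb_zero[OF zero(2) _ e(3)]
      std_in_orb_closure[of s 1]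
    by blast+
qed

text \<open>On \<open>V s\<close> the power \<open>y^(n-2)\<close> has rank 2 for the middle orbit.
  For the orbit starting with \<open>s\<close> it has rank 1, because only the long row has a box of
  sign \<open>s\<close> that far to the right. Here n is at least 3; for n = 1 the middle orbit is
  zero.\<close>

lemma not_subset_odd_0:
  assumes n: "odd CARD('n::finite)" "2 \<le> CARD('n)"
  shows "\<not> (orb_closure s' 0 :: 'n bmat set) \<subseteq> orb_closure s 1"
proof
  assume sub: "(orb_closure s' 0 :: 'n bmat set) \<subseteq> orb_closure s 1"
  let ?t = "flip_sign s" and ?k = "CARD('n) - 2"
  have "CARD('n) \<noteq> 2" using n(1) by auto
  then have n3: "3 \<le> CARD('n)" using n(2) by simp
  have k: "odd ?k" "0 < CARD('n)" "?k < CARD('n)" "1 < CARD('n)" "CARD('n) - 1 < CARD('n)"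
    using n n3 by auto
  have single: "a = idx ?t 0 \<and> b = idx s (CARD('n) - 1)"
    if "sg b = s" "mpow (std False (offset s 1)) ?k $ a $ b \<noteq> 0" for a b :: "'n + 'n"
  proof -
    have "num b = num a + 1 + ?k" "sg a \<noteq> sg b" using that k(1)
      by (auto simp: mpow_std_offset split: if_splits)
    then have "num a = 0" "num b = CARD('n) - 1" "sg a = ?t"
      using num_less[of b] that(1) neq_sign_iff[of "sg a" s] n3 by auto
    then show ?thesis using idx_unique[of a] idx_unique[of b] that(1) by simp
  qed
  let ?i = "idx ?t 0 :: 'n + 'n" and ?i' = "idx ?t 1 :: 'n + 'n" and ?j =
    "idx s ?k :: 'n + 'n" and ?j' = "idx s (CARD('n) - 1) :: 'n + 'n"
  have e: "sg ?i = ?t" "num ?i = 0" "sg ?i' = ?t" "num ?i' = 1" "sg ?j = s" "num ?j = ?k"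
    "sg ?j' = s" "num ?j' = CARD('n) - 1"
    using k by (simp_all add: idx)
  let ?M = "mpow (std False (offset s' 0) :: 'n bmat) ?k"
  have "?M $ ?i $ ?j * ?M $ ?i' $ ?j' = ?M $ ?i $ ?j' * ?M $ ?i' $ ?j"
    by (rule closure_orb_minor[OF single subsetD[OF sub std_in_orb_closure] e(5,7)])
  moreover have "CARD('n) - Suc 0 \<noteq> CARD('n) - 2" using n3 by linarith
  ultimately show False using e k(1) n3 by (auto simp: mpow_std_offset)
qed

subsection \<open>Dimensions of the orbit closures\<close>

definition bot :: "sign \<Rightarrow> nat \<Rightarrow> ('n::finite) + 'n \<Rightarrow> 'n + 'n" where
  "bot s d j = (THE i. box_row s d i = box_row s d j \<and> box_col s d i = 0)"

lemma bot_unique: "d \<le> 1 \<Longrightarrow> box_row s d i = box_row s d j \<Longrightarrow> box_col s d i = 0 \<Longrightarrow> bot s d j = i"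
  unfolding bot_def by (rule the_equality) (auto intro: box_inj[of d s])

lemma bot:
  assumes "d \<le> 1"
  shows "box_row s d (bot s d j) = box_row s d j" "box_col s d (bot s d j) = 0"
proof -
  note bij = boxes_rows[OF assms, of s, where 'n = 'a]
  have "(box_row s d j, box_col s d j) \<in> boxes (two_rows CARD('a) s d)" using bij_betwE[OF bij] by blast
  then have "(box_row s d j, 0) \<in> boxes (two_rows CARD('a) s d)" by (auto simp: boxes_def)
  then have "(box_row s d j, 0) \<in> range (\<lambda>i :: 'a + 'a. (box_row s d i, box_col s d i))"
    using bij_betw_imp_surj_on[OF bij] by simp
  then obtain i :: "'a + 'a" where "box_row s d i = box_row s d j" "box_col s d i = 0" by force
  then show "box_row s d (bot s d j) = box_row s d j" "box_col s d (bot s d j) = 0"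
    using bot_unique[OF assms, of s i j] by auto
qed

lemma lev_bot:
  assumes d: "d \<le> 1"
  shows "lev (offset s d) j = lev (offset s d) (bot s d j) + box_col s d j"
    "(sg (bot s d j) = sg j) = even (box_col s d j)"
proof -
  show l: "lev (offset s d) j = lev (offset s d) (bot s d j) + box_col s d j"
    using lev_col[OF d, of s j] lev_col[OF d, of s "bot s d j"] bot[OF d, of s j] by simp
  have "box_row s d (bot s d j) = box_row s d j" by (rule bot[OF d])
  then have "((sg (bot s d j) = s) = (sg j = s)) = even (box_col s d j)"
    using l unfolding box_row_def by (cases "sg (bot s d j) = s"; cases "sg j = s"; simp) presburger+
  moreover have "(sg (bot s d j) = s) = (sg j = s) \<longleftrightarrow> sg (bot s d j) = sg j" using neq_sign_iff by metis
  ultimately show "(sg (bot s d j) = sg j) = even (box_col s d j)" by simp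
qed

text \<open>Read as a row, this is the coordinate functional at \<open>i\<close>: hence every row of
  \<open>h\<close> is recovered from the row at the bottom of its chain.\<close>

lemma mpow_std_bot:
  fixes i l :: "('n::finite) + 'n"
  assumes d: "d \<le> 1"
  shows "mpow (std False (offset s d)) (box_col s d i) $ bot s d i $ l = (if l = i then 1 else 0)"
proof -
  have "l = i" if l: "lev (offset s d) l = lev (offset s d) (bot s d i) + box_col s d i"
    "(sg (bot s d i) = sg l) = even (box_col s d i)"
  proof (rule lev_eqI)
    show "lev (offset s d) l = lev (offset s d) i" using l(1) lev_bot(1)[OF d, of s i] by simp
    show "sg l = sg i" by (rule sign_eq_cases[where t = "sg (bot s d i)" and \<tau> =
      "even (box_col s d i)"])
        (use l(2) lev_bot(2)[OF d, of s i] in auto)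
  qed
  then show ?thesis using lev_bot[OF d, of s i] unfolding mpow_std[OF offset_le[OF d]] by auto
qed

lemma mpow_space_s: "y \<in> space_s \<Longrightarrow> mpow y k $ i $ j \<noteq> 0 \<Longrightarrow> (sg i = sg j) = even k"
proof (induction k arbitrary: i)
  case 0
  then show ?case by (auto simp: mat_1_nth split: if_splits)
next
  case (Suc k)
  then obtain l where "y $ i $ l * mpow y k $ l $ j \<noteq> 0"
    unfolding mpow_Suc matrix_mult_nth by (meson sum.not_neutral_contains_not_neutral)
  then have "sg i \<noteq> sg l" "(sg l = sg j) = even k" using Suc by (auto simp: space_s_sg)
  then show ?case by (cases "sg i"; cases "sg l"; cases "sg j") auto
qed

lemma orb_space_s: "orb \<delta> \<subseteq> space_s"
  using homog_std[of False \<delta>] conj_by_space_s unfolding homog_False by (auto simp: orb_def)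

text \<open>Every \<open>y = h\<inverse> y\<^sub>0 h\<close> in the orbit satisfies \<open>h y = y\<^sub>0 h\<close>, so \<open>h\<close> is determined by its rows at the
  bottoms \<open>i1\<close>,
    \<open>i2\<close> of the two chains: box_row \<open>i\<close> of \<open>h\<close> is box_row \<open>bot i\<close> times \<open>y\<close> to the power \<open>box_col i\<close>.
  Normalizing these two rows to coordinate functionals, up to a single coefficient \<open>\<alpha> / \<rho>\<close> in
  the exceptional case, gives a birational parametrization of the orbit by an affine space.\<close>
lemma krull_dim_orb_slice:
  fixes i1 i2 :: "('n::finite) + 'n" and \<rho> \<alpha> :: "'n bmat \<Rightarrow> complex" and free :: bool
  assumes d: "d \<le> 1" and i1: "box_row s d i1 = 0" "box_col s d i1 = 0" and i2: "box_row s d i2 = 1"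
    "box_col s d i2 = 0"
  defines "J \<equiv> {(i, j). sg i = sg j \<and> i \<noteq> i1 \<and> i \<noteq> i2} \<union> (if free then {(i2, i1)} else {})"
  defines "D \<equiv> {h :: 'n bmat. \<forall>i j. (i, j) \<notin> J \<longrightarrow> h $ i $ j = mat 1 $ i $ j}"
  assumes \<rho>: "\<rho> \<in> poly_funs" "\<rho> (std False (offset s d)) \<noteq> 0"
    and \<alpha>: "\<alpha> \<in> poly_funs" "\<alpha> (std False (offset s d)) = 0"
    and free: "if free then sg i1 = sg i2 else \<alpha> = (\<lambda>_. 0)"
    and rel: "\<And>h y. h \<in> D \<Longrightarrow> h \<in> lie_k \<Longrightarrow> det h \<noteq> 0 \<Longrightarrow> h ** y = std False (offset s d) ** h \<Longrightarrow>
      h $ i2 $ i1 * \<rho> y = \<alpha> y"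
    and top: "\<And>y i j. y \<in> orb (offset s d) \<Longrightarrow> \<nexists>l. nxt False (offset s d) i l \<Longrightarrow>
      \<rho> y * mpow y (Suc (box_col s d i)) $ bot s d i $ j +
      (if bot s d i = i2 then \<alpha> y * mpow y (Suc (box_col s d i)) $ i1 $ j else 0) = 0"
  shows "krull_dim zariski (orb_closure s d :: 'n bmat set) = enat (card J)"
proof -
  let ?y0 = "std False (offset s d) :: 'n bmat" and ?b = "bot s d" and ?c = "box_col s d"
  let ?\<phi> = "\<lambda>h. matrix_inv h ** ?y0 ** h"
  have neq: "i1 \<noteq> i2" using i1 i2 by auto
  have J_sg: "sg i = sg j" if "(i, j) \<in> J" for i j using that free
    by (auto simp: J_def split: if_splits)
  have D_lie: "D \<subseteq> lie_k" unfolding D_def lie_k_sg using J_sg by (auto simp: mat_1_nth)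
  interpret rational_map D det ?\<phi>
    by (rule rational_map_conj) (simp add: D_def)
  have bot_i: "?b i = i1 \<or> ?b i = i2" for i
  proof -
    have "box_row s d i = 0 \<or> box_row s d i = 1" using row_less[of s d i] by auto
    then show ?thesis using bot_unique[OF d, of s i1 i] bot_unique[OF d, of s i2 i] i1 i2 by auto
  qed
  have bot1: "?b i1 = i1" "?b i2 = i2" using bot_unique[OF d refl] i1 i2 by auto
  \<comment> \<open>With \<open>c = ?c i\<close> this is \<open>\<rho> y\<close> times row
    \<open>i\<close> of \<open>h\<close>, and with one more power the same for
    \<open>h ** y\<close>. The factor \<open>\<rho> y\<close> keeps the expression polynomial in
    \<open>y\<close>.\<close>
  define G where "G y c i j = \<rho> y * mpow y c $ ?b i $ j + (if ?b i
    = i2 then \<alpha> y * mpow y c $ i1 $ j else 0)" for y c i j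
  have G_poly: "(\<lambda>y. G y c i j) \<in> poly_funs" for c i j
    unfolding G_def by (cases "?b i = i2") (auto intro!: poly_funs_intros poly_funs_mpow \<rho> \<alpha>)
  have G0: "G ?y0 (?c i) i j = \<rho> ?y0 * mat 1 $ i $ j" for i j
    by (auto simp: G_def mpow_std_bot[OF d] \<alpha>(2) mat_1_nth)
  have entry: "h $ i $ j * \<rho> y = G y (?c i) i j"
    if h: "h \<in> D" "det h \<noteq> 0" and hy: "h ** y = ?y0 ** h" for h y i j
  proof -
    note pow = intertwine_mpow[OF hy]
    have row1: "h $ i1 $ l = (if l = i1 then 1 else 0)" for l
    proof -
      have "(i1, l) \<notin> J" using neq by (auto simp: J_def)
      then show ?thesis using h(1) by (auto simp: D_def mat_1_nth)
    qed
    define a where "a = h $ i2 $ i1"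
    have row2: "h $ i2 $ l = (if l = i2 then 1 else 0) + (if l = i1 then a else 0)" for l
    proof (cases "l = i1")
      case False
      then have "(i2, l) \<notin> J" by (auto simp: J_def)
      then show ?thesis using h(1) False by (auto simp: D_def mat_1_nth)
    qed (use neq in \<open>auto simp: a_def\<close>)
    have "h $ i $ j = (\<Sum>l\<in>UNIV. mpow ?y0 (?c i) $ ?b i $ l * h $ l $ j)"
      by (simp add: mpow_std_bot[OF d] if_distribR if_distrib cong: if_cong)
    also have "\<dots> = (h ** mpow y (?c i)) $ ?b i $ j" unfolding pow by (simp add: matrix_mult_nth)
    also have "\<dots> = mpow y (?c i) $ ?b i $ j + (if ?b i = i2 then a * mpow y (?c i) $ i1 $ j else 0)"
    proof -
      have "(h ** m) $ i1 $ j = (\<Sum>l\<in>UNIV. if l = i1 then m $ i1 $ j else 0)" for m :: "'n bmat"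
        unfolding matrix_mult_nth by (rule sum.cong) (simp_all add: row1)
      then have 1: "(h ** m) $ i1 $ j = m $ i1 $ j" for m :: "'n bmat" by simp
      have "(h ** m) $ i2 $ j = (\<Sum>l\<in>UNIV. (if l = i2 then m $ i2 $ j else 0) + (if l
        = i1 then a * m $ i1 $ j else 0))" for m :: "'n bmat"
        unfolding matrix_mult_nth by (rule sum.cong) (simp_all add: row2 neq)
      then have 2: "(h ** m) $ i2 $ j = m $ i2 $ j + a * m $ i1 $ j" for m :: "'n bmat"
        by (simp add: sum.distrib)
      show ?thesis using bot_i[of i] neq
        by (elim disjE) (simp_all only: 1 2 if_False if_True refl add_0_right)
    qed
    finally have "h $ i $ j * \<rho> y = \<rho> y * mpow y (?c i) $ ?b i $ j +
        (if ?b i = i2 then (a * \<rho> y) * mpow y (?c i) $ i1 $ j else 0)"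
      by (simp add: algebra_simps)
    also have "a * \<rho> y = \<alpha> y" unfolding a_def using rel[OF h(1) _ h(2) hy] h(1) D_lie by blast
    finally show ?thesis by (simp add: G_def)
  qed
  have \<phi>_rel: "h ** ?\<phi> h = ?y0 ** h" if "det h \<noteq> 0" for h :: "'n bmat"
  proof -
    have "h ** ?\<phi> h = (h ** matrix_inv h) ** ?y0 ** h" by (simp add: matrix_mul_assoc)
    then show ?thesis using that by (simp add: matrix_inv_mul invertible_det_nz)
  qed
  have "krull_dim zariski (zariski closure_of (?\<phi> ` dom)) = enat (card J)"
  proof (rule krull_dim_image[where ?h0.0 = "mat 1" and \<rho> = \<rho> and \<psi> =
    "\<lambda>(i, j) y. G y (?c i) i j - mat 1 $ i $ j * \<rho> y"])
    show "D = {h. \<forall>i j. (i, j) \<notin> J \<longrightarrow> h $ i $ j = mat 1 $ i $ j}" by (simp add: D_def)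
    show "det (mat 1 :: 'n bmat) \<noteq> 0" by simp
    show "\<rho> (?\<phi> (mat 1)) \<noteq> 0"
      using \<rho>(2) conj_by_1[of ?y0] matrix_inv_unique(1)[of "mat 1 :: 'n bmat" "mat 1"] by simp
    show "(case k of (i, j) \<Rightarrow> \<lambda>y. G y (?c i) i j - mat 1 $ i $ j * \<rho> y) \<in> poly_funs" for k
      by (cases k) (auto intro!: poly_funs_diff poly_funs.mult poly_funs.const \<rho> G_poly)
    show "(case (i, j) of (i, j) \<Rightarrow> \<lambda>y. G y (?c i) i j - mat 1 $ i $ j * \<rho> y) (?\<phi> h)
      = (h $ i $ j - mat 1 $ i $ j) * \<rho> (?\<phi> h)"
      if "h \<in> dom" for h i j
      using entry[of h "?\<phi> h" i j] \<phi>_rel[of h] that by (simp add: algebra_simps)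
  qed (rule \<rho>)
  moreover have "zariski closure_of (?\<phi> ` dom) = orb_closure s d"
  proof (rule antisym)
    show "zariski closure_of (?\<phi> ` dom) \<subseteq> orb_closure s d"
      unfolding orb_image using D_lie by (intro closure_of_mono) auto
    define H where "H y = (\<chi> i j. G y (?c i) i j)" for y
    have H_nth: "H y $ i $ j = G y (?c i) i j" for y i j by (simp add: H_def)
    \<comment> \<open>Where \<open>f\<close> is nonzero one may divide by \<open>\<rho> y\<close>,
      and the matrix rebuilt from \<open>y\<close> is invertible. This dense part of the orbit is
      reached by the slice \<open>D\<close>.\<close>
    define f where "f y = \<rho> y * det (H y)" for y
    have f: "f \<in> poly_funs"
      unfolding f_def[abs_def] by (intro poly_funs.mult \<rho> poly_funs_det) (simp add: H_nth G_poly)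
    have "invertible (H ?y0)"
      by (rule triangular_invertible[of _
        "\<lambda>_. 0"]) (use \<rho>(2) in \<open>auto simp: H_nth G0 mat_1_nth split: if_splits\<close>)
    then have "f ?y0 \<noteq> 0" using \<rho>(2) by (simp add: f_def invertible_det_nz)
    from irreducible_dense_open[OF irreducible_orb f std_in_orb this]
    have "orb (offset s d) \<subseteq> zariski closure_of {y \<in> orb (offset s d). f y \<noteq> 0}" .
    also have "{y \<in> orb (offset s d). f y \<noteq> 0} \<subseteq> ?\<phi> ` dom"
    proof
      fix y :: "'n bmat" assume "y \<in> {y \<in> orb (offset s d). f y \<noteq> 0}"
      then have y: "y \<in> orb (offset s d)" "\<rho> y \<noteq> 0" "det (H y) \<noteq> 0" by (auto simp: f_def)
      have ys: "y \<in> space_s" using y(1) orb_space_s by blast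
      define h where "h = mat (1 / \<rho> y) ** H y"
      have h_nth: "h $ i $ j = G y (?c i) i j / \<rho> y" for i j
      proof -
        have "h $ i $ j = (\<Sum>k\<in>UNIV. if i = k then H y $ k $ j / \<rho> y else 0)"
          unfolding h_def matrix_mult_nth by (rule sum.cong) (auto simp: mat_def)
        then show ?thesis by (simp add: H_nth)
      qed
      have "invertible (mat (1 / \<rho> y) :: 'n bmat)"
        by (rule triangular_invertible[of _
          "\<lambda>_. 0"]) (use y(2) in \<open>auto simp: mat_def split: if_splits\<close>)
      then have "invertible h" unfolding h_def using y(3)
        by (intro invertible_mult) (simp_all add: invertible_det_nz)
      then have deth: "det h \<noteq> 0" by (simp add: invertible_det_nz)
      have "h $ i $ j = mat 1 $ i $ j" if nJ: "(i, j) \<notin> J" for i j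
      proof (cases "sg i = sg j")
        case False
        have m: "mpow y (?c i) $ k $ j = 0" if "sg k = sg (?b i)" for k
        proof (rule ccontr)
          assume "mpow y (?c i) $ k $ j \<noteq> 0"
          then have "(sg (?b i) = sg j) = even (?c i)" using mpow_space_s[OF ys] that by metis
          moreover have "(sg (?b i) = sg i) = even (?c i)" by (rule lev_bot(2)[OF d])
          ultimately show False using False sign_eq_cases[of "sg i" "sg (?b i)" "even (?c i)"
            "sg j"] by auto
        qed
        have "(if ?b i = i2 then \<alpha> y * mpow y (?c i) $ i1 $ j else 0) = 0"
          using m[of i1] free by (cases free) auto
        then have "G y (?c i) i j = 0" using m[of "?b i"] by (simp add: G_def)
        then show ?thesis using False by (auto simp: h_nth mat_1_nth)
      next
        case True
        then have "i = i1 \<or> i = i2" using nJ by (auto simp: J_def)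
        then show ?thesis
        proof
          assume i: "i = i1"
          then show ?thesis using y(2) i1 bot1 neq by (simp add: h_nth G_def)
        next
          assume i: "i = i2"
          have "\<alpha> y = 0 \<or> j \<noteq> i1" using nJ free i by (auto simp: J_def split: if_splits)
          then show ?thesis using y(2) i2 bot1 i by (auto simp: h_nth G_def mat_1_nth)
        qed
      qed
      then have hD: "h \<in> D" by (simp add: D_def)
      \<comment> \<open>Inside a row both sides are the next power of \<open>y\<close> by
        construction. At the last box \<open>?y0\<close> gives 0, and \<open>top\<close> says that
        the other side is 0 too.\<close>
      have "(H y ** y) $ i $ j = (?y0 ** H y) $ i $ j" for i j
      proof -
        have "(H y ** y) $ i $ j = G y (Suc (?c i)) i j"
          by (cases "?b i = i2")
            (simp_all add: matrix_mult_nth H_nth G_def mpow_Suc2 sum_distrib_left sum.distrib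
              distrib_right mult.assoc)
        moreover have "(?y0 ** H y) $ i $ j = G y (Suc (?c i)) i j"
        proof (cases "\<exists>l. nxt False (offset s d) i l")
          case True
          then obtain l where l: "nxt False (offset s d) i l" by blast
          have "(?y0 ** H y) $ i $ j = (\<Sum>l'\<in>{l}. ?y0 $ i $ l' * H y $ l' $ j)"
            unfolding matrix_mult_nth by (rule sum.mono_neutral_right) (use nxt_unique1[OF l] in
              \<open>auto simp: std_nth\<close>)
          moreover have rc: "box_row s d i = box_row s d l" "?c l = Suc (?c i)"
            using l nxt_box[OF d] by blast+
          moreover have "?b l = ?b i" using bot_unique[OF d, of s "?b i" l] bot[OF d, of s i] rc by simp
          ultimately show ?thesis using l by (simp add: std_nth H_nth G_def)
        next
          case False
          then have "(?y0 ** H y) $ i $ j = 0" by (simp add: matrix_mult_nth std_nth)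
          then show ?thesis using top[OF y(1) False, of j] by (simp add: G_def)
        qed
        ultimately show ?thesis by simp
      qed
      then have Hy: "H y ** y = ?y0 ** H y" by (simp add: vec_eq_iff)
      have hH: "h $ i $ j = (1 / \<rho> y) * H y $ i $ j" for i j by (simp add: h_nth H_nth)
      have "h ** y = ?y0 ** h"
      proof -
        have "(h ** y) $ i $ j = (1 / \<rho> y) * (H y ** y) $ i $ j"
          "(?y0 ** h) $ i $ j = (1 / \<rho> y) * (?y0 ** H y) $ i $ j" for i j
          by (simp_all only: matrix_mult_nth hH sum_distrib_left mult.assoc mult.left_commute)
        then show ?thesis by (simp add: vec_eq_iff Hy)
      qed
      then have "?\<phi> h = (matrix_inv h ** h) ** y" by (simp add: matrix_mul_assoc[symmetric])
      also have "\<dots> = y" using \<open>invertible h\<close> by (simp add: matrix_inv_mul)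
      finally show "y \<in> ?\<phi> ` dom" using hD deth by force
    qed
    then have "zariski closure_of {y \<in> orb (offset s d). f y \<noteq> 0} \<subseteq> zariski closure_of (?\<phi> ` dom)"
      by (rule closure_of_mono)
    finally show "orb_closure s d \<subseteq> zariski closure_of (?\<phi> ` dom)"
      by (rule closure_of_minimal[OF _ closedin_zariski_closure])
  qed
  ultimately show ?thesis by simp
qed


section \<open>Dimension counts for equal and unequal row lengths\<close>

lemma ex_box:
  assumes "d \<le> 1" "(r, c) \<in> boxes (two_rows CARD('n::finite) s d)"
  obtains i :: "('n::finite) + 'n" where "box_row s d i = r" "box_col s d i = c"
proof -
  have "(r, c) \<in> range (\<lambda>i :: 'n + 'n. (box_row s d i, box_col s d i))"
    using assms bij_betw_imp_surj_on[OF boxes_rows[OF assms(1), of s, where 'n = 'n]] by simp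
  then show ?thesis using that by force
qed

lemma top_box:
  fixes i :: "('n::finite) + 'n"
  assumes d: "d \<le> 1" and top: "\<nexists>l. nxt False (offset s d) i l"
  shows "Suc (box_col s d i) = fst (two_rows CARD('n) s d ! box_row s d i)"
proof -
  have "(box_row s d i, box_col s d i) \<in> boxes (two_rows CARD('n) s d)"
    using bij_betwE[OF boxes_rows[OF d, of s, where 'n = 'n]] by blast
  then have *: "box_row s d i < length (two_rows CARD('n) s d)"
      "box_col s d i < fst (two_rows CARD('n) s d ! box_row s d i)"
    by (simp_all add: boxes_def)
  have "\<not> Suc (box_col s d i) < fst (two_rows CARD('n) s d ! box_row s d i)"
  proof
    assume "Suc (box_col s d i) < fst (two_rows CARD('n) s d ! box_row s d i)"
    then have "(box_row s d i, Suc (box_col s d i)) \<in> boxes (two_rows CARD('n) s d)"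
      using *(1) by (simp add: boxes_def)
    then obtain l :: "'n + 'n"
      where "box_row s d l = box_row s d i" "box_col s d l = Suc (box_col s d i)"
      using ex_box[OF d] by blast
    then show False using top nxt_box[OF d] by metis
  qed
  then show ?thesis using *(2) by simp
qed

lemma orb_mpow_zero:
  fixes y :: "('n::finite) bmat"
  assumes "y \<in> orb \<delta>" "mpow (std False \<delta>) k = (0 :: 'n bmat)"
  shows "mpow y k = 0"
proof -
  obtain g where "g \<in> K" "y = conj_by g (std False \<delta>)" using assms(1) by (auto simp: orb_def)
  then show ?thesis using conj_by_mpow[OF K_invertible, of g "std False \<delta>" k] assms(2) by simp
qed

lemma card_block_pairs:
  fixes i1 i2 :: "('n::finite) + 'n"
  assumes "i1 \<noteq> i2"
  shows "card {(i, j :: 'n + 'n). sg i = sg j \<and> i \<noteq> i1 \<and> i \<noteq> i2} = 2 * (CARD('n)\<^sup>2 - CARD('n))"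
proof -
  have "{(i, j :: 'n + 'n). sg i = sg j \<and> i \<noteq> i1 \<and>
    i \<noteq> i2} = Sigma (UNIV - {i1, i2}) (\<lambda>i. {j. sg j = sg i})" by auto
  then have "card {(i, j :: 'n + 'n). sg i = sg j \<and> i \<noteq> i1 \<and>
    i \<noteq> i2} = card (UNIV - {i1, i2}) * CARD('n)"
    by (simp add: card_sg)
  also have "card (UNIV - {i1, i2}) = 2 * CARD('n) - 2" using assms by (simp add: card_Diff_subset)
  finally show ?thesis by (simp add: power2_eq_square diff_mult_distrib)
qed

lemma two_bottoms:
  assumes d: "d \<le> 1" and n: "2 \<le> CARD('n::finite)"
  obtains i1 i2 :: "('n::finite) + 'n"
    where "box_row s d i1 = 0" "box_col s d i1 = 0" "box_row s d i2 = 1" "box_col s d i2 = 0"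
proof -
  have "CARD('n) - d > 0" using d n by linarith
  then have "(0, 0) \<in> boxes (two_rows CARD('n) s d)" "(1, 0) \<in> boxes (two_rows CARD('n) s d)"
    by (auto simp: boxes_def two_rows_def)
  then show ?thesis using ex_box[OF d, of 0 0 s, where 'n = 'n] ex_box[OF d, of 1 0 s,
    where 'n = 'n] that by metis
qed

text \<open>Both rows have n boxes, so \<open>y^n = 0\<close> on the orbit settles the condition at
  the row ends, and the two frozen rows can be pure coordinate functionals.\<close>

lemma krull_dim_orb_generic:
  assumes d: "d \<le> 1" "even CARD('n::finite) \<or> d = 0" and n: "2 \<le> CARD('n)"
  shows "krull_dim zariski (orb_closure s d :: 'n bmat set) = enat (2 * (CARD('n)\<^sup>2 - CARD('n)))"
proof -
  obtain i1 i2 :: "'n + 'n" where i: "box_row s d i1 = 0" "box_col s d i1 = 0" "box_row s d i2 = 1"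
    "box_col s d i2 = 0"
    by (rule two_bottoms[OF d(1) n])
  have neq: "i1 \<noteq> i2" using i by auto
  have zero: "mpow (std False (offset s d)) CARD('n) = (0 :: 'n bmat)"
  proof -
    have "mpow (std False (offset s d)) CARD('n) $ i $ j = 0" for i j :: "'n + 'n"
      using num_less[of j] d_cases[OF d(1)] d(2) unfolding mpow_std_offset[OF d(1)]
      by (auto split: if_splits)
    then show ?thesis by (simp add: vec_eq_iff)
  qed
  have len: "fst (two_rows CARD('n) s d ! box_row s d i) = CARD('n)" for i :: "'n + 'n"
    using row_less[of s d i] d(2) by (auto simp: two_rows_def less_2_cases_iff)
  have "krull_dim zariski (orb_closure s d :: 'n bmat set) = enat (card
      ({(i, j). sg i = sg j \<and> i \<noteq> i1 \<and> i \<noteq> i2} \<union> (if False then {(i2, i1)} else {})))"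
  proof (rule krull_dim_orb_slice[OF d(1) i, where \<rho> = "\<lambda>_. 1" and \<alpha> = "\<lambda>_. 0"])
    fix y :: "'n bmat" and i j :: "'n + 'n"
    assume "y \<in> orb (offset s d)" "\<nexists>l. nxt False (offset s d) i l"
    then have "mpow y (Suc (box_col s d i)) = 0"
      using orb_mpow_zero[OF _ zero] top_box[OF d(1), of s i] len[of i] by simp
    then show "1 * mpow y (Suc (box_col s d i)) $ bot s d i $ j +
        (if bot s d i = i2 then 0 * mpow y (Suc (box_col s d i)) $ i1 $ j else 0) = 0" by simp
  next
    fix h :: "'n bmat"
    assume "h \<in> {h. \<forall>i j. (i, j) \<notin> {(i, j). sg i = sg j \<and> i \<noteq> i1 \<and>
      i \<noteq> i2} \<union> (if False then {(i2, i1)} else {}) \<longrightarrow>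
      h $ i $ j = mat 1 $ i $ j}"
    then have "h $ i2 $ i1 = mat 1 $ i2 $ i1" by simp
    then show "h $ i2 $ i1 * 1 = 0" using neq by (simp add: mat_1_nth)
  qed (auto intro: poly_funs.const)
  then show ?thesis using card_block_pairs[OF neq] by simp
qed

text \<open>The row of \<open>h\<close> at the bottom \<open>i2\<close> of the short chain must
  annihilate \<open>y^(n-1)\<close>, which a coordinate functional does not do in general. On
  \<open>V s\<close> this power has rank one, so the single extra coefficient at \<open>i1\<close>,
  namely \<open>\<alpha> y / \<rho> y\<close>, is enough; it is the additional free
  parameter.\<close>

lemma krull_dim_orb_odd:
  assumes n: "odd CARD('n::finite)" "2 \<le> CARD('n)"
  shows "krull_dim zariski (orb_closure s 1 :: 'n bmat set) = enat (2 * (CARD('n)\<^sup>2 - CARD('n)) + 1)"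
proof -
  let ?k = "CARD('n) - 1"
  obtain i1 i2 :: "'n + 'n" where i: "box_row s 1 i1 = 0" "box_col s 1 i1 = 0" "box_row s 1 i2 = 1"
    "box_col s 1 i2 = 0"
    by (rule two_bottoms[OF order_refl n(2)])
  have neq: "i1 \<noteq> i2" using i by auto
  have lev: "lev (offset s 1) i1 = 0" "lev (offset s 1) i2 = 1"
    using lev_col[OF order_refl, of s i1] lev_col[OF order_refl, of s i2] i by simp_all
  have sgn: "sg i1 = s" "sg i2 = s"
    using lev i unfolding box_row_def by (auto split: if_splits)
  have num: "num i1 = 0" "num i2 = 1" using lev sgn by (simp_all add: offset_sg)
  have k: "even ?k" "?k < CARD('n)" "Suc ?k = CARD('n)" using n by auto
  define j0 where "j0 = (idx s ?k :: 'n + 'n)"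
  have j0: "sg j0 = s" "num j0 = ?k" using idx[OF k(2), of s] by (simp_all add: j0_def)
  define \<rho> where "\<rho> y = mpow y ?k $ i1 $ j0" for y :: "'n bmat"
  define \<alpha> where "\<alpha> y = - mpow y ?k $ i2 $ j0" for y :: "'n bmat"
  have row2: "mpow (std False (offset s 1)) ?k $ i2 $ j = 0" for j
    using num_less[of j] k sgn num by (auto simp: mpow_std_offset)
  have top0: "mpow (std False (offset s 1)) (Suc CARD('n)) = (0 :: 'n bmat)"
  proof -
    have "mpow (std False (offset s 1)) (Suc CARD('n)) $ i $ j = 0" for i j :: "'n + 'n"
      using num_less[of j] unfolding mpow_std_offset[OF order_refl] by (auto split: if_splits)
    then show ?thesis by (simp add: vec_eq_iff)
  qed
  have single: "a = i1 \<and> b = j0"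
    if "sg b = s" "mpow (std False (offset s 1)) ?k $ a $ b \<noteq> 0" for a b :: "'n + 'n"
  proof -
    have "num b = num a + ?k" "sg a = s" using that k(1)
      by (auto simp: mpow_std_offset split: if_splits)
    then have "num a = 0" "num b = ?k" using num_less[of b] by auto
    then show ?thesis using index_eqI[of a i1] index_eqI[of b j0] that(1) \<open>sg a = s\<close> sgn num j0 by simp
  qed
  have "krull_dim zariski (orb_closure s 1 :: 'n bmat set) = enat (card
      ({(i, j). sg i = sg j \<and> i \<noteq> i1 \<and> i \<noteq> i2} \<union> (if True then {(i2, i1)} else {})))"
  proof (rule krull_dim_orb_slice[OF order_refl i, where \<rho> = \<rho> and \<alpha> = \<alpha>])
    show "\<rho> \<in> poly_funs" unfolding \<rho>_def[abs_def] by (rule poly_funs_mpow)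
    show "\<alpha> \<in> poly_funs" unfolding \<alpha>_def[abs_def] by (intro poly_funs_uminus poly_funs_mpow)
    show "\<rho> (std False (offset s 1)) \<noteq> 0"
      using k(1) j0 sgn num by (simp add: \<rho>_def mpow_std_offset)
    show "\<alpha> (std False (offset s 1)) = 0" using row2 by (simp add: \<alpha>_def)
    show "if True then sg i1 = sg i2 else \<alpha> = (\<lambda>_. 0)" using sgn by simp
  next
    fix h y :: "'n bmat"
    assume D: "h \<in> {h. \<forall>i j. (i, j) \<notin> {(i, j). sg i = sg j \<and> i \<noteq> i1 \<and>
      i \<noteq> i2} \<union> (if True then {(i2, i1)} else {}) \<longrightarrow>
      h $ i $ j = mat 1 $ i $ j}" and hy: "h ** y = std False (offset s 1) ** h"
    note pow = intertwine_mpow[OF hy]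
    have h2: "h $ i2 $ l = (if l = i2 then 1 else 0)" if "l \<noteq> i1" for l
      using D that by (auto simp: mat_1_nth)
    \<comment> \<open>The short chain has only n - 1 boxes, so row \<open>i2\<close> of the power n
      - 1 of \<open>std\<close> vanishes. Comparing with \<open>h ** mpow y ?k\<close> at
      \<open>j0\<close> determines the coefficient at \<open>i1\<close>.\<close>
    have "0 = (mpow (std False (offset s 1)) ?k ** h) $ i2 $ j0"
      by (simp only: matrix_mult_nth row2 mult_zero_left sum.neutral_const)
    also have "\<dots> = (\<Sum>l\<in>UNIV. h $ i2 $ l * mpow y ?k $ l $ j0)" unfolding pow[symmetric]
      by (rule matrix_mult_nth)
    also have "\<dots> = (\<Sum>l\<in>{i1, i2}. h $ i2 $ l * mpow y ?k $ l $ j0)"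
      by (rule sum.mono_neutral_right) (use h2 in auto)
    also have "\<dots> = h $ i2 $ i1 * mpow y ?k $ i1 $ j0 + mpow y ?k $ i2 $ j0" using neq h2[of i2] by simp
    finally show "h $ i2 $ i1 * \<rho> y = \<alpha> y" by (simp add: \<rho>_def \<alpha>_def eq_neg_iff_add_eq_0)
  next
    fix y :: "'n bmat" and i j :: "'n + 'n"
    assume y: "y \<in> orb (offset s 1)" and t: "\<nexists>l. nxt False (offset s 1) i l"
    have c: "Suc (box_col s 1 i) = fst (two_rows CARD('n) s 1 ! box_row s 1 i)"
      by (rule top_box[OF order_refl t])
    show "\<rho> y * mpow y (Suc (box_col s 1 i)) $ bot s 1 i $ j +
        (if bot s 1 i = i2 then \<alpha> y * mpow y (Suc (box_col s 1 i)) $ i1 $ j else 0) = 0"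
    proof (cases "box_row s 1 i = 0")
      case True
      then have "Suc (box_col s 1 i) = Suc CARD('n)" using c n(1) by (simp add: two_rows_def)
      then have "mpow y (Suc (box_col s 1 i)) = 0" using orb_mpow_zero[OF y top0] by simp
      then show ?thesis by simp
    next
      case False
      then have r: "box_row s 1 i = 1" using row_less[of s 1 i] by simp
      then have "Suc (box_col s 1 i) = ?k" using c n(1) by (simp add: two_rows_def)
      moreover have "bot s 1 i = i2" using bot_unique[OF order_refl, of s i2 i] i r by simp
      moreover have "\<rho> y * mpow y ?k $ i2 $ j + \<alpha> y * mpow y ?k $ i1 $ j = 0"
      proof (cases "sg j = s")
        case True
        \<comment> \<open>By rank one, the equation that defines the coefficient in column
          \<open>j0\<close> holds in all columns of sign \<open>s\<close>.\<close>
        have "mpow y ?k $ i1 $ j0 * mpow y ?k $ i2 $ j = mpow y ?k $ i1 $ j * mpow y ?k $ i2 $ j0"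
          by (rule closure_orb_minor[OF single _ j0(1) True]) (use y subset_zariski_closure[of
            "orb (offset s 1)"] in auto)
        then show ?thesis by (simp add: \<rho>_def \<alpha>_def)
      next
        case False
        have "y \<in> space_s" using y orb_space_s by blast
        then have "mpow y ?k $ i2 $ j = 0" "mpow y ?k $ i1 $ j = 0"
          using mpow_space_s[of y ?k _ j] False sgn k(1) by metis+
        then show ?thesis by simp
      qed
      ultimately show ?thesis by simp
    qed
  qed
  moreover have "(i2, i1) \<notin> {(i, j). sg i = sg j \<and> i \<noteq> i1 \<and> i \<noteq> i2}" by simp
  ultimately show ?thesis using card_block_pairs[OF neq] by simp
qed

subsection \<open>Irreducible components\<close>

lemma orb_closures:
  "(N_Xs :: ('n::finite) bmat set) = \<Union>{orb_closure Plus 1, orb_closure Plus 0, orb_closure Minus 1}"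
  unfolding N_Xs_eq orbits_def by (simp add: closure_of_Un Un_assoc)

lemma orb_subset_N_s: "orb \<delta> \<subseteq> N_s"
proof
  fix y :: "'a bmat" assume y: "y \<in> orb \<delta>"
  then have "y \<in> space_s" using orb_space_s by blast
  moreover have "nilpotent_matrix y"
    using y nilpotent_conj_by[OF K_invertible lowers_nilpotent[OF lowers_std]] by (auto simp: orb_def)
  ultimately show "y \<in> N_s" by (simp add: N_s_def)
qed

text \<open>A nilpotent 2 by 2 matrix has square zero, so \<open>y\<close> is completed by zero
  diagonal blocks.\<close>

lemma N_Xs_one:
  assumes n: "CARD('n::finite) = 1"
  shows "(N_Xs :: 'n bmat set) = N_s"
proof (rule antisym)
  show "(N_Xs :: 'n bmat set) \<subseteq> N_s"
    unfolding N_Xs_eq using orb_subset_N_s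
      by (intro closure_of_minimal closedin_N_s) (auto simp: orbits_def)
  show "(N_s :: 'n bmat set) \<subseteq> N_Xs"
  proof
    fix y :: "'n bmat" assume y: "y \<in> N_s"
    then have s: "y \<in> space_s" "nilpotent_matrix y" by (auto simp: N_s_def)
    have "mpow y CARD('n + 'n) = 0" using nilpotent_mpow_card[OF s(2)] .
    then have "y ** y = 0" using n by (simp add: numeral_2_eq_2 mpow_Suc)
    moreover have "diag_part y = 0" "offdiag_part y = y"
      using diag_offdiag_unique[of 0 y] s(1) by (auto simp: lie_k_sg)
    moreover have "nilpotent_matrix (0 :: 'n bmat)" unfolding nilpotent_matrix_mpow
      by (rule exI[of _ 1]) simp
    ultimately have "y \<in> offdiag_part ` square_zero"
      by (intro image_eqI[of _ _ y]) (simp_all add: square_zero_def)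
    then show "y \<in> N_Xs" unfolding N_Xs_def conormal_images using subset_zariski_closure
      by (metis subsetD)
  qed
qed

lemma components_one:
  assumes n: "CARD('n::finite) = 1"
  shows "card (irreducible_components zariski (N_s :: 'n bmat set)) = 2"
proof -
  have "(orb_closure Plus 0 :: 'n bmat set) \<subseteq> orb_closure Plus 1"
  proof (rule closure_of_minimal[OF _ closedin_zariski_closure])
    \<comment> \<open>With one index of each sign all levels are 0, so the middle orbit is the zero
      matrix and lies in the closures of the other two.\<close>
    have std0: "std False (offset Plus 0) = (0 :: 'n bmat)"
      using num_less[where 'n = 'n] n by (auto simp: vec_eq_iff std_nth nxt_def offset_sg)
    have "(0 :: 'n bmat) \<in> orb_closure Plus 1"
      by (rule closure_normal_form[of "offset Plus 1" False])
        (use offset_le[of 1 Plus] in \<open>auto simp: homog_def lowers_def orb_def\<close>)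
    then show "orb (offset Plus 0) \<subseteq> (orb_closure Plus 1 :: 'n bmat set)" by (auto simp: orb_def std0)
  qed
  then have eq: "(N_s :: 'n bmat set) = \<Union>{orb_closure Plus 1, orb_closure Minus 1}"
    using orb_closures[where 'n = 'n] N_Xs_one[OF n] by auto
  have odd: "odd CARD('n)" using n by simp
  have ns: "\<not> (orb_closure Plus 1 :: 'n bmat set) \<subseteq> orb_closure Minus 1"
    "\<not> (orb_closure Minus 1 :: 'n bmat set) \<subseteq> orb_closure Plus 1"
    using not_subset_odd(2)[OF odd, of Plus] not_subset_odd(2)[OF odd, of Minus] by simp_all
  have "irreducible_components zariski (N_s :: 'n bmat set) = {orb_closure Plus 1, orb_closure Minus 1}"
    unfolding eq by (rule irreducible_components_Union) (use ns in \<open>auto intro!: irreducible_closure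
      irreducible_orb\<close>)
  moreover have "(orb_closure Plus 1 :: 'n bmat set) \<noteq> orb_closure Minus 1" using ns by auto
  ultimately show ?thesis by simp
qed

lemma components_ge_two:
  assumes n: "2 \<le> CARD('n::finite)"
  shows "irreducible_components zariski (N_Xs :: 'n bmat set)
    = {orb_closure Plus 1, orb_closure Plus 0, orb_closure Minus 1}"
    and "(orb_closure Plus 1 :: 'n bmat set) \<noteq> orb_closure Plus 0"
      "(orb_closure Plus 1 :: 'n bmat set) \<noteq> orb_closure Minus 1"
      "(orb_closure Plus 0 :: 'n bmat set) \<noteq> orb_closure Minus 1"
proof -
  have ns: "\<not> (orb_closure Plus 0 :: 'n bmat set) \<subseteq> orb_closure s 1"
    "\<not> (orb_closure s 1 :: 'n bmat set) \<subseteq> orb_closure Plus 0"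
      "\<not> (orb_closure (flip_sign s) 1 :: 'n bmat set) \<subseteq> orb_closure s 1" for s
    using not_subset_even(1)[where 'n = 'n and s = s and s' = Plus] not_subset_even(2)[where 'n
      = 'n and s = s]
      not_subset_even(3)[where 'n = 'n and s = s and s' = Plus] not_subset_odd(1)[where 'n
        = 'n and s = s and s' = Plus]
      not_subset_odd(2)[where 'n = 'n and s =
        "flip_sign s"] not_subset_odd_0[where 'n = 'n and s = s and s' = Plus] n
    by (cases "even CARD('n)"; simp)+
  note ns' = ns(1,2)[of Plus] ns(1,2)[of Minus] ns(3)[of Plus, simplified] ns(3)[of Minus, simplified]
  show "irreducible_components zariski (N_Xs :: 'n bmat set)
    = {orb_closure Plus 1, orb_closure Plus 0, orb_closure Minus 1}"
    unfolding orb_closures by (rule irreducible_components_Union) (use ns' in \<open>auto intro!: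
      irreducible_closure irreducible_orb\<close>)
  show "(orb_closure Plus 1 :: 'n bmat set) \<noteq> orb_closure Plus 0"
    "(orb_closure Plus 1 :: 'n bmat set) \<noteq> orb_closure Minus 1"
      "(orb_closure Plus 0 :: 'n bmat set) \<noteq> orb_closure Minus 1" using ns' by auto
qed

theorem theorem1p6:
  fixes n :: nat
  assumes n: "n = CARD('n::finite)"
  shows "(N_Xk :: 'n bmat set) = N_k \<and>
    \<not> irreducible_in zariski (N_Xs :: 'n bmat set) \<and>
    (n = 1 \<longrightarrow>
      (N_Xs :: 'n bmat set) = N_s \<and>
      card (irreducible_components zariski (N_s :: 'n bmat set)) = 2) \<and>
    (n \<ge> 2 \<longrightarrow>
      card (irreducible_components zariski (N_Xs :: 'n bmat set)) = 3 \<and>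
      (even n \<longrightarrow>
        signed_orbit ` {{#(n, Plus), (n, Plus)#},
                        {#(n, Plus), (n, Minus)#},
                        {#(n, Minus), (n, Minus)#}} \<subseteq> K_orbits (N_s :: 'n bmat set) \<and>
        irreducible_components zariski (N_Xs :: 'n bmat set) =
          {zariski closure_of signed_orbit {#(n, Plus), (n, Plus)#},
           zariski closure_of signed_orbit {#(n, Plus), (n, Minus)#},
           zariski closure_of signed_orbit {#(n, Minus), (n, Minus)#}} \<and>
        equidimensional zariski (N_Xs :: 'n bmat set) \<and>
        krull_dim zariski (N_Xs :: 'n bmat set) = enat (2 * (n\<^sup>2 - n))) \<and>
      (odd n \<longrightarrow>
        signed_orbit ` {{#(n + 1, Plus), (n - 1, Plus)#},
                        {#(n, Plus), (n, Minus)#},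
                        {#(n + 1, Minus), (n - 1, Minus)#}} \<subseteq> K_orbits (N_s :: 'n bmat set) \<and>
        irreducible_components zariski (N_Xs :: 'n bmat set) =
          {zariski closure_of signed_orbit {#(n + 1, Plus), (n - 1, Plus)#},
           zariski closure_of signed_orbit {#(n, Plus), (n, Minus)#},
           zariski closure_of signed_orbit {#(n + 1, Minus), (n - 1, Minus)#}} \<and>
        \<not> equidimensional zariski (N_Xs :: 'n bmat set) \<and>
        card {C \<in> irreducible_components zariski (N_Xs :: 'n bmat set).
                krull_dim zariski C = enat (2 * (n\<^sup>2 - n) + 1)} = 2 \<and>
        card {C \<in> irreducible_components zariski (N_Xs :: 'n bmat set).
                krull_dim zariski C = enat (2 * (n\<^sup>2 - n))} = 1))"
proof -
  have sub: "orb (offset s d) \<in> K_orbits (N_s :: 'n bmat set)" for s d by (rule orb_in_K_orbits)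
  have orb0: "signed_orbit {#(n, Plus), (n, Minus)#} = (orb (offset Plus 0) :: 'n bmat set)"
    using signed_orbit_eq_orb[of 0 Plus, where 'n = 'n] n by (simp add: two_rows_def)
  have even_orb: "signed_orbit {#(n, s), (n, s)#} = (orb (offset s 1) :: 'n bmat set)" if "even n" for s
    using signed_orbit_eq_orb[of 1 s, where 'n = 'n] n that by (simp add: two_rows_def)
  have odd_orb: "signed_orbit {#(n + 1, s), (n - 1, s)#} = (orb (offset s 1) :: 'n bmat set)" if "odd n" for s
    using signed_orbit_eq_orb[of 1 s, where 'n = 'n] n that by (simp add: two_rows_def)
  have card: "card (irreducible_components zariski (N_Xs :: 'n bmat set)) = 3" if "2 \<le> n"
    using components_ge_two[where 'n = 'n] that n by simp
  have "n = 1 \<or> 2 \<le> n"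
  proof -
    have "0 < n" unfolding n by simp
    then show ?thesis by linarith
  qed
  \<comment> \<open>An irreducible set is its own only component, whereas there are two or three
    here.\<close>
  then have red: "\<not> irreducible_in zariski (N_Xs :: 'n bmat set)"
  proof
    assume "n = 1"
    then have "card (irreducible_components zariski (N_Xs :: 'n bmat set)) = 2"
      using components_one[where 'n = 'n] N_Xs_one[where 'n = 'n] n by simp
    then show ?thesis using irreducible_components_irreducible[of zariski "N_Xs :: 'n bmat set"] by auto
  next
    assume "2 \<le> n"
    then show ?thesis using card irreducible_components_irreducible[of zariski "N_Xs :: 'n bmat set"] by auto
  qed
  let "_ \<and> _ \<and> _ \<and> (_ \<longrightarrow> _ \<and> (_ \<longrightarrow> ?E) \<and> (_ \<longrightarrow> ?O))" = ?thesis
  show ?thesis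
  proof (rule conjI[OF N_Xk_eq conjI[OF red conjI]]; intro impI)
    assume "n = 1"
    then show "(N_Xs :: 'n bmat set) = N_s \<and> card (irreducible_components zariski (N_s :: 'n bmat set)) = 2"
      using components_one[where 'n = 'n] N_Xs_one[where 'n = 'n] n by simp
  next
    assume n2: "2 \<le> n"
    note comps = components_ge_two[where 'n = 'n, OF n2[unfolded n]]
    have dim0: "krull_dim zariski (orb_closure Plus 0 :: 'n bmat set) = enat (2 * (n\<^sup>2 - n))"
      using krull_dim_orb_generic[of 0 Plus, where 'n = 'n] n2 n by simp
    show "card (irreducible_components zariski (N_Xs :: 'n bmat set)) = 3 \<and> (even n \<longrightarrow> ?E) \<and> (odd n \<longrightarrow> ?O)"
    proof (rule conjI[OF card[OF n2] conjI]; intro impI)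
      assume e: "even n"
      have dim1: "krull_dim zariski (orb_closure s 1 :: 'n bmat set) = enat (2 * (n\<^sup>2 - n))" for s
        using krull_dim_orb_generic[of 1 s, where 'n = 'n] e n2 n by simp
      have "krull_dim zariski (N_Xs :: 'n bmat set) = enat (2 * (n\<^sup>2 - n))"
        unfolding orb_closures by (rule krull_dim_Union) (use dim0 dim1 in auto)
      moreover have "equidimensional zariski (N_Xs :: 'n bmat set)"
        unfolding equidimensional_def comps(1) using dim0 dim1 by auto
      ultimately show ?E unfolding even_orb[OF e] orb0 using sub comps(1) by (simp add: even_orb[OF e] orb0)
    next
      assume o: "odd n"
      have dim1: "krull_dim zariski (orb_closure s 1 :: 'n bmat set) = enat (2 * (n\<^sup>2 - n) + 1)" for s
        using krull_dim_orb_odd[of s, where 'n = 'n] n2 o n by simp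
      let ?I = "irreducible_components zariski (N_Xs :: 'n bmat set)"
      have "{C \<in> ?I. krull_dim zariski C = enat (2 * (n\<^sup>2 - n) + 1)} = {orb_closure Plus 1, orb_closure Minus 1}"
        "{C \<in> ?I. krull_dim zariski C = enat (2 * (n\<^sup>2 - n))} = {orb_closure Plus 0}"
        unfolding comps(1) using dim0 dim1 by auto
      moreover have "\<not> equidimensional zariski (N_Xs :: 'n bmat set)"
        unfolding equidimensional_def comps(1) using dim0 dim1[of Plus] by auto
      ultimately show ?O
        unfolding odd_orb[OF o] orb0 using sub comps by (simp add: odd_orb[OF o, simplified] orb0)
    qed
  qed
qed

end
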